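(* Let $D$ be a smooth ($C^1$) Jordan domain in $\mathbb C$, let $\varphi:\partial D\to\mathbb R$ be a continuous function, and let $\delta>0$. Then there is a weak solution $U$ of the quasilinear Poisson equation $$\triangle U(z)=\delta\cdot e^{U(z)}$$ in $D$ which is continuous in $\overline D$ with $U|_{\partial D}=\varphi$ and $U\in C^{1,\alpha}_{\rm loc}(D)$ for all $\alpha\in(0,1)$. If in addition $\varphi$ is Hölder continuous with some order $\beta\in(0,1)$, then $U$ is also Hölder continuous in $\overline D$ with the same order.
   Context: A Jordan domain is a bounded domain in $\mathbb C$ whose boundary is a Jordan curve (a continuous one-to-one image of the unit circle); smooth means that this curve is $C^1$. A weak solution of $\triangle U=f(U)$ in $D$ is a function $U\in C(D)\cap W^{1,2}_{\rm loc}(D)$ such that $\int_D\langle\nabla U,\nabla\eta\rangle\,dm+\int_D f(U)\,\eta\,dm=0$ for all $\eta\in C(D)\cap W^{1,2}(D)$ with compact support in $D$, where $dm$ is Lebesgue measure in the plane. *)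

theory Defs
  imports "HOL-Analysis.Analysis"
begin

definition jordan_parametrization :: "(complex \<Rightarrow> complex) \<Rightarrow> complex set \<Rightarrow> bool" where
  "jordan_parametrization c J \<longleftrightarrow>
     continuous_on (sphere 0 1) c \<and> inj_on c (sphere 0 1) \<and> c ` sphere 0 1 = J"

definition jordan_domain :: "complex set \<Rightarrow> bool" where
  "jordan_domain D \<longleftrightarrow>
     open D \<and> connected D \<and> D \<noteq> {} \<and> bounded D \<and> (\<exists>c. jordan_parametrization c (frontier D))"

text \<open>
  A curve is \<open>C\<^sup>1\<close> if it has a regular \<open>C\<^sup>1\<close> parametrization over the circle. Without
  \<open>\<gamma>' t \<noteq> 0\<close> the definition would admit curves with corners and cusps. Differentiating
  \<open>c (cis t)\<close> over the whole real line makes the tangents match up at the closing point.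
\<close>

definition smooth_jordan_domain :: "complex set \<Rightarrow> bool" where
  "smooth_jordan_domain D \<longleftrightarrow> jordan_domain D \<and>
     (\<exists>c \<gamma>'. jordan_parametrization c (frontier D) \<and>
        (\<forall>t. ((\<lambda>t. c (cis t)) has_vector_derivative \<gamma>' t) (at t) \<and> \<gamma>' t \<noteq> 0) \<and>
        continuous_on UNIV \<gamma>')"

definition holder_on :: "real \<Rightarrow> 'a::metric_space set \<Rightarrow> ('a \<Rightarrow> 'b::metric_space) \<Rightarrow> bool" where
  "holder_on \<alpha> S f \<longleftrightarrow> (\<exists>C. \<forall>x\<in>S. \<forall>y\<in>S. dist (f x) (f y) \<le> C * dist x y powr \<alpha>)"

text \<open>
  Gradients of real functions on the plane are complex numbers, with \<open>\<bullet>\<close> as Euclidean inner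
  product. Functions on \<open>D\<close> are total functions whose values outside \<open>D\<close> are irrelevant.
\<close>

definition C1_holder_loc :: "real \<Rightarrow> complex set \<Rightarrow> (complex \<Rightarrow> real) \<Rightarrow> bool" where
  "C1_holder_loc \<alpha> D u \<longleftrightarrow>
     (\<exists>g. (\<forall>z\<in>D. GDERIV u z :> g z) \<and> (\<forall>K. compact K \<and> K \<subseteq> D \<longrightarrow> holder_on \<alpha> K g))"

definition compactly_supported_in :: "complex set \<Rightarrow> (complex \<Rightarrow> real) \<Rightarrow> bool" where
  "compactly_supported_in D \<eta> \<longleftrightarrow>
     compact (closure {z\<in>D. \<eta> z \<noteq> 0}) \<and> closure {z\<in>D. \<eta> z \<noteq> 0} \<subseteq> D"

definition L1_loc :: "complex set \<Rightarrow> (complex \<Rightarrow> 'b::{banach, second_countable_topology}) \<Rightarrow> bool" where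
  "L1_loc D f \<longleftrightarrow> (\<forall>K. compact K \<and> K \<subseteq> D \<longrightarrow> set_integrable lebesgue K f)"

definition L2_on :: "complex set \<Rightarrow> (complex \<Rightarrow> 'b::{banach, second_countable_topology}) \<Rightarrow> bool" where
  "L2_on S f \<longleftrightarrow>
     set_borel_measurable lebesgue S f \<and> set_integrable lebesgue S (\<lambda>z. (norm (f z))\<^sup>2)"

definition L2_loc :: "complex set \<Rightarrow> (complex \<Rightarrow> 'b::{banach, second_countable_topology}) \<Rightarrow> bool" where
  "L2_loc D f \<longleftrightarrow> (\<forall>K. compact K \<and> K \<subseteq> D \<longrightarrow> L2_on K f)"

text \<open>
  Both components of the weak gradient are tested at once, against \<open>C\<^sup>1\<close> functions with compact
  support in \<open>D\<close> (equivalent to testing against smooth ones).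
\<close>

definition has_weak_gradient :: "complex set \<Rightarrow> (complex \<Rightarrow> real) \<Rightarrow> (complex \<Rightarrow> complex) \<Rightarrow> bool" where
  "has_weak_gradient D u g \<longleftrightarrow> L1_loc D u \<and> L1_loc D g \<and>
     (\<forall>\<psi> \<psi>'. (\<forall>z\<in>D. GDERIV \<psi> z :> \<psi>' z) \<and> continuous_on D \<psi>' \<and> compactly_supported_in D \<psi> \<longrightarrow>
        set_lebesgue_integral lebesgue D (\<lambda>z. u z *\<^sub>R \<psi>' z) =
        - set_lebesgue_integral lebesgue D (\<lambda>z. \<psi> z *\<^sub>R g z))"

text \<open>
  The next two predicates say that \<open>u\<close> lies in \<open>W\<^sup>1\<^sup>,\<^sup>2(D)\<close>, respectively in \<open>W\<^sup>1\<^sup>,\<^sup>2\<close> locally on \<open>D\<close>,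
  with \<open>g\<close> as a representative of its weak gradient, which is unique up to null sets.
\<close>

definition W12 :: "complex set \<Rightarrow> (complex \<Rightarrow> real) \<Rightarrow> (complex \<Rightarrow> complex) \<Rightarrow> bool" where
  "W12 D u g \<longleftrightarrow> has_weak_gradient D u g \<and> L2_on D u \<and> L2_on D g"

definition W12_loc :: "complex set \<Rightarrow> (complex \<Rightarrow> real) \<Rightarrow> (complex \<Rightarrow> complex) \<Rightarrow> bool" where
  "W12_loc D u g \<longleftrightarrow> has_weak_gradient D u g \<and> L2_loc D u \<and> L2_loc D g"

definition weak_poisson_solution ::
    "complex set \<Rightarrow> (real \<Rightarrow> real) \<Rightarrow> (complex \<Rightarrow> real) \<Rightarrow> bool" where
  "weak_poisson_solution D f U \<longleftrightarrow> continuous_on D U \<and>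
     (\<exists>G. W12_loc D U G \<and>
        (\<forall>\<eta> H. continuous_on D \<eta> \<and> W12 D \<eta> H \<and> compactly_supported_in D \<eta> \<longrightarrow>
           set_lebesgue_integral lebesgue D (\<lambda>z. G z \<bullet> H z) +
           set_lebesgue_integral lebesgue D (\<lambda>z. f (U z) * \<eta> z) = 0))"

end

theory Submission
  imports Defs "HOL-Complex_Analysis.Complex_Analysis"
begin

text \<open>
  The equation \<open>\<triangle>V = f\<close> is understood in a sense closed under uniform limits: \<open>V\<close> and \<open>f\<close> are uniform
  limits of \<open>C\<^sup>2\<close> functions and of their Laplacians. The maximum principle survives this limit, and
  so does the interior gradient bound, which on a disc of radius \<open>r\<close> reads
  \<open>\<bar>\<nabla>V\<bar> \<le> 4 sup \<bar>V\<bar> / r + r sup \<bar>f\<bar> / 4\<close>. These two estimates replace potential theory.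

  A \<open>C\<^sup>1\<close> Jordan domain has at each boundary point an exterior cone with angle close to \<open>\<pi>\<close>, so
  \<open>Re (z - z0)\<^sup>\<beta>\<close>, suitably rotated, is a barrier for every \<open>\<beta> < 1\<close>. It gives continuity at the
  boundary for the harmonic extension of polynomials, obtained by sweeping out, and later the Hoelder
  bound at the boundary. For polynomial right-hand sides \<open>\<triangle>V = f\<close> is solved explicitly up to a
  harmonic function, hence for continuous \<open>f\<close> by approximation. The increasing nonlinearity \<open>\<delta> e\<^sup>U\<close>,
  truncated above \<open>max \<phi>\<close> to be Lipschitz, is reached by a continuity method, since the maximum principle
  bounds the solution of \<open>\<triangle>U = s F(U) + g\<close> by the data uniformly in \<open>s\<close>.

  The gradient bound applied to \<open>U(\<cdot> + k) - U\<close> makes the gradient of \<open>U\<close> locally Lipschitz.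
\<close>

section \<open>C2 functions and the maximum principle\<close>

text \<open>For merely continuous \<open>f\<close> a solution of \<triangle>V = f is in general not
  C^2, and \<delta> e^U inherits only the continuity of U; a limit notion keeps existence and
  estimates in one class, and the limits of the approximating gradients later enter the weak
  equation. A C^1 boundary need not have exterior touching discs, only cones whose opening
  approaches pi. On the complementary sector of half-angle pi/2 + \<tau> the power
  \<open>z^\<beta>\<close> has positive real part if \<open>\<beta> (pi/2 + \<tau>) < pi/2\<close>,
  so every order below 1 is reached, each with its own \<tau>. This real part is comparable with
  \<open>|z|^\<beta>\<close> from both sides, which is why the order on the boundary passes to the
  closure without loss. The step of the continuity method is governed by \<open>R^2 / 4\<close>, the
  maximum of the solution of \<triangle>v = -1 with zero boundary values on a disc of radius R. Test
  functions of the weak equation have only a weak gradient; the definition of that gradient is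
  therefore tested with derivatives of the C^2 approximants, and the limit is taken on a compact
  set.\<close>

text \<open>
  \<open>W\<close> is \<open>C\<^sup>2\<close> on \<open>S\<close> with gradient \<open>g\<close> and Laplacian \<open>p\<close>; the columns of the Hessian are \<open>gx\<close> and \<open>gy\<close>.
\<close>

definition c2_on :: "complex set \<Rightarrow> (complex \<Rightarrow> real) \<Rightarrow> (complex \<Rightarrow> complex) \<Rightarrow> (complex \<Rightarrow> real) \<Rightarrow> bool" where
  "c2_on S W g p \<longleftrightarrow> (\<exists>gx gy. continuous_on S gx \<and> continuous_on S gy \<and>
     (\<forall>z\<in>S. (W has_derivative (\<lambda>h. g z \<bullet> h)) (at z) \<and>
        (g has_derivative (\<lambda>h. Re h *\<^sub>R gx z + Im h *\<^sub>R gy z)) (at z) \<and>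
        p z = Re (gx z) + Im (gy z)))"

lemma c2_onI:
  assumes "continuous_on S gx" "continuous_on S gy"
    and "\<And>z. z \<in> S \<Longrightarrow> (W has_derivative (\<lambda>h. g z \<bullet> h)) (at z)"
    and "\<And>z. z \<in> S \<Longrightarrow> (g has_derivative (\<lambda>h. Re h *\<^sub>R gx z + Im h *\<^sub>R gy z)) (at z)"
    and "\<And>z. z \<in> S \<Longrightarrow> p z = Re (gx z) + Im (gy z)"
  shows "c2_on S W g p"
  using assms unfolding c2_on_def by blast

lemma c2_onE:
  assumes "c2_on S W g p"
  obtains gx gy where "continuous_on S gx" "continuous_on S gy"
    and "\<And>z. z \<in> S \<Longrightarrow> (W has_derivative (\<lambda>h. g z \<bullet> h)) (at z)"
    and "\<And>z. z \<in> S \<Longrightarrow> (g has_derivative (\<lambda>h. Re h *\<^sub>R gx z + Im h *\<^sub>R gy z)) (at z)"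
    and "\<And>z. z \<in> S \<Longrightarrow> p z = Re (gx z) + Im (gy z)"
  proof -
  obtain gx gy where *: "continuous_on S gx" "continuous_on S gy"
     "\<forall>z\<in>S. (W has_derivative (\<lambda>h. g z \<bullet> h)) (at z) \<and>
        (g has_derivative (\<lambda>h. Re h *\<^sub>R gx z + Im h *\<^sub>R gy z)) (at z) \<and>
        p z = Re (gx z) + Im (gy z)"
    using assms(1) unfolding c2_on_def by (elim exE conjE)
  show thesis by (rule that[OF *(1,2)]) (use *(3) in simp_all)
qed

lemma c2_on_gradient:
  assumes "c2_on S W g p" "z \<in> S"
  shows "(W has_derivative (\<lambda>h. g z \<bullet> h)) (at z)"
  using assms unfolding c2_on_def by blast

lemma c2_on_continuous:
  assumes "c2_on S W g p"
  shows "continuous_on S W" "continuous_on S g" "continuous_on S p"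
proof -
  obtain gx gy where *: "continuous_on S gx" "continuous_on S gy"
    "\<And>z. z \<in> S \<Longrightarrow> (W has_derivative (\<lambda>h. g z \<bullet> h)) (at z)"
    "\<And>z. z \<in> S \<Longrightarrow> (g has_derivative (\<lambda>h. Re h *\<^sub>R gx z + Im h *\<^sub>R gy z)) (at z)"
    "\<And>z. z \<in> S \<Longrightarrow> p z = Re (gx z) + Im (gy z)"
    by (rule c2_onE[OF assms(1)]) (rule that)
  show "continuous_on S W" "continuous_on S g"
    using * by (meson continuous_at_imp_continuous_on has_derivative_continuous)+
  have "continuous_on S (\<lambda>z. Re (gx z) + Im (gy z))"
    by (intro continuous_intros *)
  then show "continuous_on S p"
    using * by (simp cong: continuous_on_cong)
qed

lemma c2_on_subset: "c2_on S W g p \<Longrightarrow> T \<subseteq> S \<Longrightarrow> c2_on T W g p"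
  unfolding c2_on_def by (meson continuous_on_subset subsetD)

lemma c2_on_cong:
  assumes "c2_on S W g p" "open S" "\<And>z. z \<in> S \<Longrightarrow> W z = W' z" "\<And>z. z \<in> S \<Longrightarrow> g z = g' z"
    "\<And>z. z \<in> S \<Longrightarrow> p z = p' z"
  shows "c2_on S W' g' p'"
proof -
  obtain gx gy where *: "continuous_on S gx" "continuous_on S gy"
    "\<And>z. z \<in> S \<Longrightarrow> (W has_derivative (\<lambda>h. g z \<bullet> h)) (at z)"
    "\<And>z. z \<in> S \<Longrightarrow> (g has_derivative (\<lambda>h. Re h *\<^sub>R gx z + Im h *\<^sub>R gy z)) (at z)"
    "\<And>z. z \<in> S \<Longrightarrow> p z = Re (gx z) + Im (gy z)"
    by (rule c2_onE[OF assms(1)]) (rule that)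
  show ?thesis
  proof (rule c2_onI[OF *(1,2)])
    fix z assume z: "z \<in> S"
    show "(W' has_derivative (\<lambda>h. g' z \<bullet> h)) (at z)"
      using has_derivative_transform_within_open[OF *(3)[OF z] assms(2) z assms(3)] assms(4) z by simp
    show "(g' has_derivative (\<lambda>h. Re h *\<^sub>R gx z + Im h *\<^sub>R gy z)) (at z)"
      using has_derivative_transform_within_open[OF *(4)[OF z] assms(2) z assms(4)] by simp
    show "p' z = Re (gx z) + Im (gy z)"
      using * assms z by metis
  qed
qed

lemma c2_on_lin:
  assumes "c2_on S W g p" "c2_on S V h q"
  shows "c2_on S (\<lambda>z. a * W z + b * V z) (\<lambda>z. a *\<^sub>R g z + b *\<^sub>R h z) (\<lambda>z. a * p z + b * q z)"
proof -
  obtain gx gy where *: "continuous_on S gx" "continuous_on S gy"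
    "\<And>z. z \<in> S \<Longrightarrow> (W has_derivative (\<lambda>h. g z \<bullet> h)) (at z)"
    "\<And>z. z \<in> S \<Longrightarrow> (g has_derivative (\<lambda>h. Re h *\<^sub>R gx z + Im h *\<^sub>R gy z)) (at z)"
    "\<And>z. z \<in> S \<Longrightarrow> p z = Re (gx z) + Im (gy z)"
    by (rule c2_onE[OF assms(1)]) (rule that)
  obtain hx hy where **: "continuous_on S hx" "continuous_on S hy"
    "\<And>z. z \<in> S \<Longrightarrow> (V has_derivative (\<lambda>k. h z \<bullet> k)) (at z)"
    "\<And>z. z \<in> S \<Longrightarrow> (h has_derivative (\<lambda>h. Re h *\<^sub>R hx z + Im h *\<^sub>R hy z)) (at z)"
    "\<And>z. z \<in> S \<Longrightarrow> q z = Re (hx z) + Im (hy z)"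
    by (rule c2_onE[OF assms(2)]) (rule that)
  show ?thesis
  proof (rule c2_onI[where gx="\<lambda>z. a *\<^sub>R gx z + b *\<^sub>R hx z" and gy="\<lambda>z. a *\<^sub>R gy z + b *\<^sub>R hy z"])
    fix z assume z: "z \<in> S"
    show "((\<lambda>z. a * W z + b * V z) has_derivative (\<bullet>) (a *\<^sub>R g z + b *\<^sub>R h z)) (at z)"
      by (rule has_derivative_eq_rhs, (rule derivative_intros *(3)[OF z] **(3)[OF z])+)
        (auto simp: inner_simps)
    show "((\<lambda>z. a *\<^sub>R g z + b *\<^sub>R h z) has_derivative
         (\<lambda>k. Re k *\<^sub>R (a *\<^sub>R gx z + b *\<^sub>R hx z) + Im k *\<^sub>R (a *\<^sub>R gy z + b *\<^sub>R hy z))) (at z)"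
      by (rule has_derivative_eq_rhs, (rule derivative_intros *(4)[OF z] **(4)[OF z])+)
        (auto simp: algebra_simps)
    show "a * p z + b * q z = Re (a *\<^sub>R gx z + b *\<^sub>R hx z) + Im (a *\<^sub>R gy z + b *\<^sub>R hy z)"
      using * ** z by (simp add: algebra_simps)
  qed (intro continuous_intros * **)+
qed

lemma c2_on_diff:
  assumes "c2_on S W g p" "c2_on S V h q"
  shows "c2_on S (\<lambda>z. W z - V z) (\<lambda>z. g z - h z) (\<lambda>z. p z - q z)"
  using c2_on_lin[OF assms, of 1 "-1"] by simp

lemma c2_on_add:
  assumes "c2_on S W g p" "c2_on S V h q"
  shows "c2_on S (\<lambda>z. W z + V z) (\<lambda>z. g z + h z) (\<lambda>z. p z + q z)"
  using c2_on_lin[OF assms, of 1 1] by simp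

lemma c2_on_affine: "c2_on S (\<lambda>z. c + v \<bullet> z) (\<lambda>z. v) (\<lambda>z. 0)"
  by (rule c2_onI[where gx="\<lambda>_. 0" and gy="\<lambda>_. 0"])
    (auto intro!: derivative_eq_intros continuous_intros)

lemma c2_on_const: "c2_on S (\<lambda>z. c) (\<lambda>z. 0) (\<lambda>z. 0)"
  using c2_on_affine[of S c 0] by simp

lemma c2_on_scale:
  assumes "c2_on S W g p"
  shows "c2_on S (\<lambda>z. a * W z) (\<lambda>z. a *\<^sub>R g z) (\<lambda>z. a * p z)"
  using c2_on_lin[OF assms c2_on_const, of a 0] by simp

lemma c2_on_norm_square: "c2_on S (\<lambda>z. (norm (z - a))\<^sup>2) (\<lambda>z. 2 *\<^sub>R (z - a)) (\<lambda>z. 4)"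
proof (rule c2_onI[where gx="\<lambda>_. 2" and gy="\<lambda>_. 2 * \<i>"])
  fix z assume "z \<in> S"
  show "((\<lambda>z. (norm (z - a))\<^sup>2) has_derivative (\<bullet>) (2 *\<^sub>R (z - a))) (at z)"
    unfolding power2_norm_eq_inner
    by (rule has_derivative_eq_rhs, (rule derivative_intros)+) (auto simp: inner_simps inner_commute)
  show "((\<lambda>z. 2 *\<^sub>R (z - a)) has_derivative (\<lambda>h. Re h *\<^sub>R 2 + Im h *\<^sub>R (2 * \<i>))) (at z)"
    by (rule has_derivative_eq_rhs, (rule derivative_intros)+) (auto simp: complex_eq_iff)
qed (auto intro!: continuous_intros)

text \<open>By the Cauchy-Riemann equations the gradient of \<open>Re f\<close> is
  \<open>cnj f'\<close>; its partial derivatives are \<open>cnj f''\<close> and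
  \<open>- \<i> cnj f''\<close>, whose contributions to the trace cancel.\<close>

lemma c2_on_Re_holomorphic:
  assumes "f holomorphic_on S" "open S"
  shows "c2_on S (\<lambda>z. Re (f z)) (\<lambda>z. cnj (deriv f z)) (\<lambda>z. 0)"
proof (rule c2_onI[where gx="\<lambda>z. cnj (deriv (deriv f) z)" and gy="\<lambda>z. - (\<i> * cnj (deriv (deriv f) z))"])
  have d: "deriv f holomorphic_on S" "deriv (deriv f) holomorphic_on S"
    using assms by (auto intro: holomorphic_deriv)
  note cont = holomorphic_on_imp_continuous_on[OF d(2)]
  show "continuous_on S (\<lambda>z. cnj (deriv (deriv f) z))"
    by (intro continuous_intros cont)
  show "continuous_on S (\<lambda>z. - (\<i> * cnj (deriv (deriv f) z)))"
    by (intro continuous_intros cont)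
  fix z assume z: "z \<in> S"
  have "(f has_field_derivative deriv f z) (at z)"
    using assms z by (meson holomorphic_derivI)
  then have "(f has_derivative (*) (deriv f z)) (at z)"
    by (simp add: has_field_derivative_def)
  then have "((\<lambda>z. Re (f z)) has_derivative (\<lambda>h. Re (deriv f z * h))) (at z)"
    by (rule derivative_intros)
  then show "((\<lambda>z. Re (f z)) has_derivative (\<bullet>) (cnj (deriv f z))) (at z)"
    by (rule has_derivative_eq_rhs) (auto simp: inner_complex_def)
  have "(deriv f has_field_derivative deriv (deriv f) z) (at z)"
    using d(1) assms z by (meson holomorphic_derivI)
  then have "(deriv f has_derivative (*) (deriv (deriv f) z)) (at z)"
    by (simp add: has_field_derivative_def)
  then have "((\<lambda>z. cnj (deriv f z)) has_derivative (\<lambda>h. cnj (deriv (deriv f) z * h))) (at z)"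
    by (rule derivative_intros)
  then show "((\<lambda>z. cnj (deriv f z)) has_derivative
    (\<lambda>h. Re h *\<^sub>R cnj (deriv (deriv f) z) + Im h *\<^sub>R - (\<i> * cnj (deriv (deriv f) z)))) (at z)"
    by (rule has_derivative_eq_rhs) (auto simp: complex_eq_iff)
qed auto

text \<open>The Laplacian is the trace of the Hessian, and conjugation by a rotation preserves the
  trace. The case \<open>\<omega> = 1\<close> serves as translation invariance.\<close>

lemma c2_on_rotate:
  assumes "c2_on S W g p" "norm \<omega> = 1"
  shows "c2_on {z. a + \<omega> * z \<in> S} (\<lambda>z. W (a + \<omega> * z)) (\<lambda>z. cnj \<omega> * g (a + \<omega> * z)) (\<lambda>z. p (a + \<omega> * z))"
proof -
  obtain gx gy where *: "continuous_on S gx" "continuous_on S gy"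
    "\<And>z. z \<in> S \<Longrightarrow> (W has_derivative (\<lambda>h. g z \<bullet> h)) (at z)"
    "\<And>z. z \<in> S \<Longrightarrow> (g has_derivative (\<lambda>h. Re h *\<^sub>R gx z + Im h *\<^sub>R gy z)) (at z)"
    "\<And>z. z \<in> S \<Longrightarrow> p z = Re (gx z) + Im (gy z)"
    by (rule c2_onE[OF assms(1)]) (rule that)
  have w: "Re \<omega> * Re \<omega> + Im \<omega> * Im \<omega> = 1"
    using assms(2) by (metis cmod_power2 one_power2 power2_eq_square)
  let ?T = "{z. a + \<omega> * z \<in> S}"
  let ?t = "\<lambda>z. a + \<omega> * z"
  have cgx: "continuous_on ?T (\<lambda>z. gx (?t z))" and cgy: "continuous_on ?T (\<lambda>z. gy (?t z))"
    by (auto intro!: continuous_on_compose2[OF *(1)] continuous_on_compose2[OF *(2)] continuous_intros)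
  have dt: "(?t has_derivative (\<lambda>h. \<omega> * h)) (at z)" for z
    by (auto intro!: derivative_eq_intros)
  show ?thesis
  proof (rule c2_onI[where gx="\<lambda>z. cnj \<omega> * (Re \<omega> *\<^sub>R gx (?t z) + Im \<omega> *\<^sub>R gy (?t z))"
        and gy="\<lambda>z. cnj \<omega> * (- Im \<omega> *\<^sub>R gx (?t z) + Re \<omega> *\<^sub>R gy (?t z))"])
    fix z assume "z \<in> ?T"
    then have z: "?t z \<in> S" by simp
    show "((\<lambda>z. W (?t z)) has_derivative (\<bullet>) (cnj \<omega> * g (?t z))) (at z)"
      by (rule has_derivative_eq_rhs[OF has_derivative_compose[OF dt *(3)[OF z]]])
        (auto simp: inner_complex_def algebra_simps)
    show "((\<lambda>z. cnj \<omega> * g (?t z)) has_derivative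
         (\<lambda>h. Re h *\<^sub>R (cnj \<omega> * (Re \<omega> *\<^sub>R gx (?t z) + Im \<omega> *\<^sub>R gy (?t z))) +
              Im h *\<^sub>R (cnj \<omega> * (- Im \<omega> *\<^sub>R gx (?t z) + Re \<omega> *\<^sub>R gy (?t z))))) (at z)"
      by (rule has_derivative_eq_rhs[OF has_derivative_mult_right[OF has_derivative_compose[OF dt *(4)[OF z]]]])
        (auto simp: complex_eq_iff algebra_simps)
    \<comment> \<open>The mixed second derivatives cancel; the diagonal ones come out multiplied by
      \<open>|\<omega>|^2\<close>, so this factor is inserted on the left.\<close>
    have e: "Re (gx (?t z)) = Re (gx (?t z)) * (Re \<omega> * Re \<omega> + Im \<omega> * Im \<omega>)"
      "Im (gy (?t z)) = Im (gy (?t z)) * (Re \<omega> * Re \<omega> + Im \<omega> * Im \<omega>)" using w by auto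
    show "p (?t z) = Re (cnj \<omega> * (Re \<omega> *\<^sub>R gx (?t z) + Im \<omega> *\<^sub>R gy (?t z))) +
      Im (cnj \<omega> * (- Im \<omega> *\<^sub>R gx (?t z) + Re \<omega> *\<^sub>R gy (?t z)))"
      unfolding *(5)[OF z] by (subst e(1), subst e(2)) (simp add: algebra_simps)
  qed (intro continuous_intros cgx cgy)+
qed

lemma c2_on_cnj:
  assumes "c2_on S W g p"
  shows "c2_on {z. cnj z \<in> S} (\<lambda>z. W (cnj z)) (\<lambda>z. cnj (g (cnj z))) (\<lambda>z. p (cnj z))"
proof -
  obtain gx gy where *: "continuous_on S gx" "continuous_on S gy"
    "\<And>z. z \<in> S \<Longrightarrow> (W has_derivative (\<lambda>h. g z \<bullet> h)) (at z)"
    "\<And>z. z \<in> S \<Longrightarrow> (g has_derivative (\<lambda>h. Re h *\<^sub>R gx z + Im h *\<^sub>R gy z)) (at z)"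
    "\<And>z. z \<in> S \<Longrightarrow> p z = Re (gx z) + Im (gy z)"
    by (rule c2_onE[OF assms(1)]) (rule that)
  let ?T = "{z. cnj z \<in> S}"
  have cgx: "continuous_on ?T (\<lambda>z. gx (cnj z))" and cgy: "continuous_on ?T (\<lambda>z. gy (cnj z))"
    by (auto intro!: continuous_on_compose2[OF *(1)] continuous_on_compose2[OF *(2)] continuous_intros)
  have dt: "(cnj has_derivative cnj) (at z)" for z
    by (rule bounded_linear_imp_has_derivative) (rule bounded_linear_cnj)
  show ?thesis
  proof (rule c2_onI[where gx="\<lambda>z. cnj (gx (cnj z))" and gy="\<lambda>z. - cnj (gy (cnj z))"])
    fix z assume "z \<in> ?T"
    then have z: "cnj z \<in> S" by simp
    show "((\<lambda>z. W (cnj z)) has_derivative (\<bullet>) (cnj (g (cnj z)))) (at z)"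
      by (rule has_derivative_eq_rhs[OF has_derivative_compose[OF dt *(3)[OF z]]])
        (auto simp: inner_complex_def algebra_simps)
    show "((\<lambda>z. cnj (g (cnj z))) has_derivative
         (\<lambda>h. Re h *\<^sub>R cnj (gx (cnj z)) + Im h *\<^sub>R - cnj (gy (cnj z)))) (at z)"
      by (rule has_derivative_eq_rhs[OF has_derivative_cnj[OF has_derivative_compose[OF dt *(4)[OF z]]]])
        (auto simp: complex_eq_iff algebra_simps)
  qed (auto intro!: continuous_intros cgx cgy simp: *)
qed

text \<open>Gradient and Hessian at a point are determined by \<open>W\<close> alone, so the local
  choices agree on overlaps. This is how a limit known only disc by disc, as the real part of a
  different holomorphic function on each disc, becomes one C^2 function on \<open>S\<close>.\<close>

lemma c2_on_local:
  assumes "open S" "\<And>z. z \<in> S \<Longrightarrow> \<exists>N g. open N \<and> z \<in> N \<and> c2_on N W g p"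
  shows "\<exists>g. c2_on S W g p"
proof -
  obtain N G where NG: "\<And>z. z \<in> S \<Longrightarrow> open (N z) \<and> z \<in> N z \<and> c2_on (N z) W (G z) p"
    using assms(2) by metis
  define gr where "gr = (\<lambda>z. G z z)"
  have gr: "gr w = G z w" if "z \<in> S" "w \<in> N z" "w \<in> S" for z w
  proof -
    have "(W has_derivative (\<bullet>) (G z w)) (at w)"
      using NG[OF that(1)] that c2_on_gradient by blast
    moreover have "(W has_derivative (\<bullet>) (G w w)) (at w)"
      using NG[OF that(3)] that c2_on_gradient by blast
    ultimately have "(\<bullet>) (G z w) = (\<bullet>) (G w w)" by (rule has_derivative_unique)
    then show ?thesis unfolding gr_def by (metis inner_commute vector_eq_rdot)
  qed
  have "\<forall>z\<in>S. \<exists>gx gy. continuous_on (N z \<inter> S) gx \<and> continuous_on (N z \<inter> S) gy \<and> (\<forall>w\<in>N z \<inter> S. (W has_derivative (\<lambda>h. gr w \<bullet> h)) (at w) \<and>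
        (gr has_derivative (\<lambda>h. Re h *\<^sub>R gx w + Im h *\<^sub>R gy w)) (at w) \<and>
        p w = Re (gx w) + Im (gy w))"
  proof
    fix z assume z: "z \<in> S"
    have "c2_on (N z \<inter> S) W gr p"
      by (rule c2_on_cong[OF c2_on_subset]) (use NG[OF z] assms gr z in auto)
    then show "\<exists>gx gy. continuous_on (N z \<inter> S) gx \<and> continuous_on (N z \<inter> S) gy \<and> (\<forall>w\<in>N z \<inter> S. (W has_derivative (\<lambda>h. gr w \<bullet> h)) (at w) \<and>
        (gr has_derivative (\<lambda>h. Re h *\<^sub>R gx w + Im h *\<^sub>R gy w)) (at w) \<and>
        p w = Re (gx w) + Im (gy w))"
      unfolding c2_on_def by blast
  qed
  from bchoice[OF this] obtain X where "\<forall>z\<in>S. \<exists>gy. continuous_on (N z \<inter> S) (X z) \<and> continuous_on (N z \<inter> S) gy \<and> (\<forall>w\<in>N z \<inter> S. (W has_derivative (\<lambda>h. gr w \<bullet> h)) (at w) \<and>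
        (gr has_derivative (\<lambda>h. Re h *\<^sub>R X z w + Im h *\<^sub>R gy w)) (at w) \<and>
        p w = Re (X z w) + Im (gy w))"
    by (elim exE)
  from bchoice[OF this] obtain Y where XY: "\<forall>z\<in>S. continuous_on (N z \<inter> S) (X z) \<and> continuous_on (N z \<inter> S) (Y z) \<and> (\<forall>w\<in>N z \<inter> S. (W has_derivative (\<lambda>h. gr w \<bullet> h)) (at w) \<and>
        (gr has_derivative (\<lambda>h. Re h *\<^sub>R X z w + Im h *\<^sub>R Y z w)) (at w) \<and>
        p w = Re (X z w) + Im (Y z w))"
    by (elim exE)
  note XY = conjunct1[OF bspec[OF XY]] conjunct1[OF conjunct2[OF bspec[OF XY]]]
    conjunct2[OF conjunct2[OF bspec[OF XY]], THEN bspec, THEN conjunct1]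
    conjunct2[OF conjunct2[OF bspec[OF XY]], THEN bspec, THEN conjunct2, THEN conjunct1]
    conjunct2[OF conjunct2[OF bspec[OF XY]], THEN bspec, THEN conjunct2, THEN conjunct2]
  define gx where "gx = (\<lambda>z. X z z)"
  define gy where "gy = (\<lambda>z. Y z z)"
  have eq: "gx w = X z w" "gy w = Y z w" if "z \<in> S" "w \<in> N z" "w \<in> S" for z w
  proof -
    have "(gr has_derivative (\<lambda>h. Re h *\<^sub>R X z w + Im h *\<^sub>R Y z w)) (at w)"
         "(gr has_derivative (\<lambda>h. Re h *\<^sub>R X w w + Im h *\<^sub>R Y w w)) (at w)"
      using XY(4)[OF that(1), of w] XY(4)[OF that(3), of w] NG[OF that(3)] that(2,3) by blast+
    then have e: "(\<lambda>h. Re h *\<^sub>R X z w + Im h *\<^sub>R Y z w) = (\<lambda>h. Re h *\<^sub>R X w w + Im h *\<^sub>R Y w w)"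
      by (rule has_derivative_unique)
    show "gx w = X z w" "gy w = Y z w"
      using fun_cong[OF e, of 1] fun_cong[OF e, of \<i>] by (auto simp: gx_def gy_def)
  qed
  have cont: "isCont gx z \<and> isCont gy z" if z: "z \<in> S" for z
  proof -
    have o: "open (N z \<inter> S)" "z \<in> N z \<inter> S" using NG z assms by auto
    have "continuous_on (N z \<inter> S) gx" "continuous_on (N z \<inter> S) gy"
      using continuous_on_eq[OF XY(1)[OF z]] continuous_on_eq[OF XY(2)[OF z]] eq[OF z] by auto
    then show ?thesis using o by (simp add: continuous_on_eq_continuous_at)
  qed
  have "c2_on S W gr p"
  proof (rule c2_onI[of _ gx gy])
    show "continuous_on S gx" "continuous_on S gy"
      using cont by (auto simp: continuous_at_imp_continuous_on)
  qed (use XY(3-5) NG in \<open>simp_all add: gx_def gy_def\<close>)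
  then show ?thesis by blast
qed

section \<open>Interior maxima and the maximum principle\<close>

text \<open>If \<open>D\<close> were positive, \<open>f'\<close> would rise from
  \<open>f' 0 = 0\<close> to positive values right of 0, and the mean value theorem would give a
  value above the maximum.\<close>

lemma second_derivative_at_max:
  fixes f f' :: "real \<Rightarrow> real"
  assumes "r > 0" and d: "\<And>t. \<bar>t\<bar> < r \<Longrightarrow> (f has_real_derivative f' t) (at t)"
    and d2: "(f' has_real_derivative D) (at 0)" and mx: "\<And>t. \<bar>t\<bar> < r \<Longrightarrow> f t \<le> f 0"
  shows "D \<le> 0"
proof (rule ccontr)
  assume "\<not> D \<le> 0"
  then have D: "D > 0" by simp
  have f0: "f' 0 = 0"
    using DERIV_local_max[OF d[of 0], of r] mx assms(1) by auto
  obtain e where e: "e > 0" "\<And>h. 0 < h \<Longrightarrow> h < e \<Longrightarrow> f' 0 < f' (0 + h)"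
    using DERIV_pos_inc_right[OF d2 D] by blast
  define h where "h = min e r / 2"
  have h: "0 < h" "h < e" "h < r" using e(1) assms(1) by (auto simp: h_def)
  obtain x where x: "0 < x" "x < h" "f h - f 0 = (h - 0) * f' x"
    using MVT2[OF h(1), of f f'] d h by auto
  have "f' x > 0" using e(2)[of x] x h f0 by auto
  then have "f h > f 0" using mult_pos_pos[OF h(1), of "f' x"] x(3) by simp
  then show False using mx[of h] h by auto
qed

text \<open>The second derivatives of \<open>W\<close> along the lines through \<open>a\<close> in
  the directions 1 and \<i> are the two diagonal entries of the Hessian.\<close>

lemma laplacian_at_max:
  assumes "c2_on S W g p" "open S" "a \<in> S" "\<And>z. z \<in> S \<Longrightarrow> W z \<le> W a"
  shows "p a \<le> 0"
proof -
  obtain gx gy where *: "continuous_on S gx" "continuous_on S gy"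
    "\<And>z. z \<in> S \<Longrightarrow> (W has_derivative (\<lambda>h. g z \<bullet> h)) (at z)"
    "\<And>z. z \<in> S \<Longrightarrow> (g has_derivative (\<lambda>h. Re h *\<^sub>R gx z + Im h *\<^sub>R gy z)) (at z)"
    "\<And>z. z \<in> S \<Longrightarrow> p z = Re (gx z) + Im (gy z)"
    by (rule c2_onE[OF assms(1)]) (rule that)
  obtain r where r: "r > 0" "ball a r \<subseteq> S" using assms open_contains_ball by blast
  have key: "(Re v *\<^sub>R gx a + Im v *\<^sub>R gy a) \<bullet> v \<le> 0" if "norm v = 1" for v
  proof (rule second_derivative_at_max[OF r(1), where f="\<lambda>t. W (a + t *\<^sub>R v)" and f'="\<lambda>t. g (a + t *\<^sub>R v) \<bullet> v"])
    have inS: "a + t *\<^sub>R v \<in> S" if "\<bar>t\<bar> < r" for t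
      using r that \<open>norm v = 1\<close> by (auto simp: dist_norm subset_iff)
    have dt: "((\<lambda>t. a + t *\<^sub>R v) has_derivative (\<lambda>h. h *\<^sub>R v)) (at t)" for t
      by (auto intro!: derivative_eq_intros)
    fix t :: real assume t: "\<bar>t\<bar> < r"
    show "((\<lambda>t. W (a + t *\<^sub>R v)) has_real_derivative g (a + t *\<^sub>R v) \<bullet> v) (at t)"
      unfolding has_field_derivative_def
      by (rule has_derivative_eq_rhs[OF has_derivative_compose[OF dt *(3)[OF inS[OF t]]]]) auto
    show "W (a + t *\<^sub>R v) \<le> W (a + 0 *\<^sub>R v)" using assms(4) inS[OF t] by simp
  next
    have dt: "((\<lambda>t. a + t *\<^sub>R v) has_derivative (\<lambda>h. h *\<^sub>R v)) (at 0)"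
      by (auto intro!: derivative_eq_intros)
    have "((\<lambda>t. g (a + t *\<^sub>R v)) has_derivative (\<lambda>h. Re (h *\<^sub>R v) *\<^sub>R gx a + Im (h *\<^sub>R v) *\<^sub>R gy a)) (at 0)"
      by (rule has_derivative_compose[OF dt]) (use *(4)[OF assms(3)] in simp)
    then have "((\<lambda>t. g (a + t *\<^sub>R v) \<bullet> v) has_derivative (\<lambda>h. (Re (h *\<^sub>R v) *\<^sub>R gx a + Im (h *\<^sub>R v) *\<^sub>R gy a) \<bullet> v)) (at 0)"
      by (rule has_derivative_inner_left)
    then show "((\<lambda>t. g (a + t *\<^sub>R v) \<bullet> v) has_real_derivative (Re v *\<^sub>R gx a + Im v *\<^sub>R gy a) \<bullet> v) (at 0)"
      unfolding has_field_derivative_def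
      by (rule has_derivative_eq_rhs) (auto simp: inner_simps algebra_simps)
  qed
  have "Re (gx a) \<le> 0" "Im (gy a) \<le> 0"
    using key[of 1] key[of \<i>] by (auto simp: inner_complex_def)
  then show ?thesis using *(5)[OF assms(3)] by simp
qed

text \<open>
  \<open>poisson S V f\<close> is the equation \<open>\<triangle>V = f\<close> in a sense that is stable under uniform limits.
\<close>

definition poisson :: "complex set \<Rightarrow> (complex \<Rightarrow> real) \<Rightarrow> (complex \<Rightarrow> real) \<Rightarrow> bool" where
  "poisson S V f \<longleftrightarrow> (\<forall>e>0. \<exists>W g p. c2_on S W g p \<and> (\<forall>z\<in>S. \<bar>W z - V z\<bar> < e \<and> \<bar>p z - f z\<bar> < e))"

lemma poissonE:
  assumes "poisson S V f" "e > 0"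
  obtains W g p where "c2_on S W g p" "\<And>z. z \<in> S \<Longrightarrow> \<bar>W z - V z\<bar> < e" "\<And>z. z \<in> S \<Longrightarrow> \<bar>p z - f z\<bar> < e"
  using assms unfolding poisson_def by metis

lemma c2_on_imp_poisson: "c2_on S W g p \<Longrightarrow> poisson S W p"
  unfolding poisson_def by force

lemma poisson_subset: "poisson S V f \<Longrightarrow> T \<subseteq> S \<Longrightarrow> poisson T V f"
  unfolding poisson_def by (meson c2_on_subset subsetD)

lemma poisson_cong:
  assumes "poisson S V f" "\<And>z. z \<in> S \<Longrightarrow> V z = V' z" "\<And>z. z \<in> S \<Longrightarrow> f z = f' z"
  shows "poisson S V' f'"
  using assms unfolding poisson_def by simp

lemma poisson_diff:
  assumes "poisson S V f" "poisson S V' f'"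
  shows "poisson S (\<lambda>z. V z - V' z) (\<lambda>z. f z - f' z)"
  unfolding poisson_def
proof (intro allI impI)
  fix e :: real assume "e > 0"
  then have e: "e / 2 > 0" by simp
  obtain W g p where W: "c2_on S W g p" "\<And>z. z \<in> S \<Longrightarrow> \<bar>W z - V z\<bar> < e/2" "\<And>z. z \<in> S \<Longrightarrow> \<bar>p z - f z\<bar> < e/2"
    using poissonE[OF assms(1) e] by metis
  obtain W' g' p' where W': "c2_on S W' g' p'" "\<And>z. z \<in> S \<Longrightarrow> \<bar>W' z - V' z\<bar> < e/2" "\<And>z. z \<in> S \<Longrightarrow> \<bar>p' z - f' z\<bar> < e/2"
    using poissonE[OF assms(2) e] by metis
  have "\<forall>z\<in>S. \<bar>(W z - W' z) - (V z - V' z)\<bar> < e \<and> \<bar>(p z - p' z) - (f z - f' z)\<bar> < e"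
    using W(2,3) W'(2,3) by (smt (verit) field_sum_of_halves)
  then show "\<exists>W g p. c2_on S W g p \<and> (\<forall>z\<in>S. \<bar>W z - (V z - V' z)\<bar> < e \<and> \<bar>p z - (f z - f' z)\<bar> < e)"
    using c2_on_diff[OF W(1) W'(1)] by blast
qed

lemma poisson_uminus:
  assumes "poisson S V f"
  shows "poisson S (\<lambda>z. - V z) (\<lambda>z. - f z)"
  using poisson_diff[OF c2_on_imp_poisson[OF c2_on_const[of S 0]] assms] by simp

lemma poisson_limit:
  assumes "\<And>e. e > 0 \<Longrightarrow> \<exists>V' f'. poisson S V' f' \<and> (\<forall>z\<in>S. \<bar>V' z - V z\<bar> \<le> e \<and> \<bar>f' z - f z\<bar> \<le> e)"
  shows "poisson S V f"
  unfolding poisson_def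
proof (intro allI impI)
  fix e :: real assume "e > 0"
  then have e: "e / 2 > 0" by simp
  obtain V' f' where V': "poisson S V' f'" "\<And>z. z \<in> S \<Longrightarrow> \<bar>V' z - V z\<bar> \<le> e/2" "\<And>z. z \<in> S \<Longrightarrow> \<bar>f' z - f z\<bar> \<le> e/2"
    using assms[OF e] by blast
  obtain W g p where W: "c2_on S W g p" "\<And>z. z \<in> S \<Longrightarrow> \<bar>W z - V' z\<bar> < e/2" "\<And>z. z \<in> S \<Longrightarrow> \<bar>p z - f' z\<bar> < e/2"
    using poissonE[OF V'(1) e] by metis
  have "\<forall>z\<in>S. \<bar>W z - V z\<bar> < e \<and> \<bar>p z - f z\<bar> < e"
    using W(2,3) V'(2,3) by (smt (verit) field_sum_of_halves)
  then show "\<exists>W g p. c2_on S W g p \<and> (\<forall>z\<in>S. \<bar>W z - V z\<bar> < e \<and> \<bar>p z - f z\<bar> < e)"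
    using W(1) by blast
qed

text \<open>\<open>V\<close> has no second derivatives, so the argument is run on an approximant
  \<open>W\<close> with the term \<open>k |z|^2\<close> added, which makes the Laplacian strictly
  positive. \<open>W\<close> is controlled only on the open set \<open>S\<close>; an attained
  maximum is secured by a compact \<open>K\<close> inside \<open>S\<close> such that on
  \<open>S - K\<close> the perturbed function stays below its value at \<open>a\<close>.\<close>

lemma maximum_principle:
  assumes "open S" "bounded S" "continuous_on (closure S) V" "poisson S V f"
    and f: "\<And>z. z \<in> S \<Longrightarrow> f z \<ge> 0" and m: "\<And>z. z \<in> frontier S \<Longrightarrow> V z \<le> m"
    and a: "a \<in> S"
  shows "V a \<le> m"
proof (rule ccontr)
  assume "\<not> V a \<le> m"
  then have gap: "V a - m > 0" by simp
  obtain R where R: "R > 0" "\<And>z. z \<in> closure S \<Longrightarrow> norm z \<le> R"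
    using bounded_closure[OF assms(2)] unfolding bounded_pos by blast
  \<comment> \<open>One third of the gap bounds the perturbation on \<open>closure S\<close>, so
    that \<open>Q \<le> m + g < V a - g\<close> on the frontier. The error satisfies
    \<open>2 e \<le> g\<close> for the comparison outside \<open>K\<close>, and
    \<open>e \<le> k\<close> so that \<open>4 k - e\<close> stays positive.\<close>
  define g where "g = (V a - m) / 3"
  define k where "k = g / R\<^sup>2"
  define e where "e = min (g / 2) k"
  have pos0: "g > 0" "k > 0"
    using gap R by (simp_all add: g_def k_def)
  then have pos: "g > 0" "k > 0" "e > 0" "e \<le> g / 2" "e \<le> k"
    unfolding e_def by simp_all
  have kR: "0 \<le> k * (norm z)\<^sup>2" "k * (norm z)\<^sup>2 \<le> g" if "z \<in> closure S" for z
  proof -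
    have "k * (norm z)\<^sup>2 \<le> k * R\<^sup>2"
      using R(2)[OF that] pos by (intro mult_left_mono power_mono) auto
    then show "0 \<le> k * (norm z)\<^sup>2" "k * (norm z)\<^sup>2 \<le> g" using R pos by (auto simp: k_def)
  qed
  define Q where "Q = (\<lambda>z. V z + k * (norm z)\<^sup>2)"
  define K where "K = {z \<in> closure S. Q z \<ge> V a - g}"
  have contQ: "continuous_on (closure S) Q" unfolding Q_def by (intro continuous_intros assms(3))
  have "K = closure S \<inter> Q -` {V a - g..}" unfolding K_def by blast
  then have "closed K"
    using continuous_closed_preimage[OF contQ closed_closure, of "{V a - g..}"] by simp
  moreover have "bounded K" using bounded_closure[OF assms(2)] by (rule bounded_subset) (auto simp: K_def)
  ultimately have cK: "compact K" by (simp add: compact_eq_bounded_closed)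
  have KS: "K \<subseteq> S"
  proof
    fix z assume z: "z \<in> K"
    then have "z \<in> closure S" "Q z \<ge> V a - g" by (auto simp: K_def)
    moreover have "z \<notin> frontier S"
    proof
      assume "z \<in> frontier S"
      then have "Q z \<le> m + g" using m[OF \<open>z \<in> frontier S\<close>] kR(2)[OF \<open>z \<in> closure S\<close>] by (simp add: Q_def)
      moreover have "m + g < V a - g" using pos by (simp add: g_def field_simps)
      ultimately show False using \<open>Q z \<ge> V a - g\<close> by simp
    qed
    ultimately show "z \<in> S" using assms(1) by (simp add: frontier_def interior_open)
  qed
  have aS: "a \<in> closure S" using a closure_subset by auto
  have "V a - g \<le> Q a" using kR(1)[OF aS] pos(1) unfolding Q_def by linarith
  then have aK: "a \<in> K" using aS by (simp add: K_def)
  obtain W h p where W: "c2_on S W h p" "\<And>z. z \<in> S \<Longrightarrow> \<bar>W z - V z\<bar> < e" "\<And>z. z \<in> S \<Longrightarrow> \<bar>p z - f z\<bar> < e"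
    using poissonE[OF assms(4) pos(3)] by metis
  have c2: "c2_on S (\<lambda>z. W z + k * (norm z)\<^sup>2) (\<lambda>z. h z + k *\<^sub>R (2 *\<^sub>R z)) (\<lambda>z. p z + k * 4)"
    using c2_on_add[OF W(1) c2_on_scale[OF c2_on_norm_square[of S 0], of k]] by simp
  have "continuous_on K (\<lambda>z. W z + k * (norm z)\<^sup>2)"
    using c2_on_continuous(1)[OF c2] KS continuous_on_subset by blast
  then obtain b where b: "b \<in> K" "\<And>z. z \<in> K \<Longrightarrow> W z + k * (norm z)\<^sup>2 \<le> W b + k * (norm b)\<^sup>2"
    using continuous_attains_sup[OF cK] aK by blast
  have "W z + k * (norm z)\<^sup>2 \<le> W b + k * (norm b)\<^sup>2" if z: "z \<in> S" for z
  proof (cases "z \<in> K")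
    case False
    have zc: "z \<in> closure S" using z closure_subset by auto
    then have "Q z < V a - g" using False by (auto simp: K_def)
    then have "W z + k * (norm z)\<^sup>2 < V a - g + e" using W(2)[OF z] by (auto simp: Q_def)
    also have "\<dots> \<le> V a - e" using pos by auto
    also have "\<dots> \<le> W a + k * (norm a)\<^sup>2" using W(2)[OF a] kR(1)[OF aS] by auto
    also have "\<dots> \<le> W b + k * (norm b)\<^sup>2" using b(2)[OF aK] .
    finally show ?thesis by simp
  qed (use b in auto)
  moreover have bS: "b \<in> S" using b KS by auto
  ultimately have "p b + k * 4 \<le> 0"
    using laplacian_at_max[OF c2 assms(1)] by blast
  moreover have "p b > - e" using W(3)[OF bS] f[OF bS] by auto
  ultimately show False using pos by auto
qed

text \<open>Adding \<open>(B/4) |z - c|^2\<close>, whose Laplacian is \<open>B\<close> and which is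
  at most \<open>B R^2 / 4\<close> on \<open>S\<close>, makes the Laplacians of \<open>V\<close> and
  of \<open>- V\<close> nonnegative.\<close>

lemma poisson_bound:
  assumes "open S" "bounded S" "continuous_on (closure S) V" "poisson S V f"
    and f: "\<And>z. z \<in> S \<Longrightarrow> \<bar>f z\<bar> \<le> B" and m: "\<And>z. z \<in> frontier S \<Longrightarrow> \<bar>V z\<bar> \<le> m"
    and R: "S \<subseteq> cball c R" and z: "z \<in> S" and "B \<ge> 0"
  shows "\<bar>V z\<bar> \<le> m + B * R\<^sup>2 / 4"
proof -
  have *: "U z \<le> m + B * R\<^sup>2 / 4"
    if U: "continuous_on (closure S) U" "poisson S U q" "\<And>z. z \<in> S \<Longrightarrow> q z \<ge> - B" "\<And>z. z \<in> frontier S \<Longrightarrow> U z \<le> m" for U q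
  proof -
    let ?Q = "\<lambda>z. (B/4) * (norm (z - c))\<^sup>2"
    have cl: "closure S \<subseteq> cball c R" using R by (simp add: closure_minimal)
    have Qb: "0 \<le> ?Q w" "?Q w \<le> B * R\<^sup>2 / 4" if "w \<in> closure S" for w
    proof -
      have "norm (w - c) \<le> R" using cl that by (auto simp: dist_norm norm_minus_commute)
      then have "(norm (w - c))\<^sup>2 \<le> R\<^sup>2" by (intro power_mono) auto
      then have "B * (norm (w - c))\<^sup>2 \<le> B * R\<^sup>2" using \<open>B \<ge> 0\<close> by (rule mult_left_mono)
      then show "?Q w \<le> B * R\<^sup>2 / 4" by simp
      show "0 \<le> ?Q w" using \<open>B \<ge> 0\<close> by simp
    qed
    have "U z - - ?Q z \<le> m + B * R\<^sup>2 / 4"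
    proof (rule maximum_principle[OF assms(1,2), where V="\<lambda>z. U z - - ?Q z" and a=z])
      show "continuous_on (closure S) (\<lambda>z. U z - - ?Q z)"
        by (intro continuous_intros U(1))
      have "c2_on S (\<lambda>z. (- B/4) * (norm (z - c))\<^sup>2) (\<lambda>z. (- B/4) *\<^sub>R (2 *\<^sub>R (z - c))) (\<lambda>z. (- B/4) * 4)"
        by (rule c2_on_scale[OF c2_on_norm_square])
      from poisson_diff[OF U(2) c2_on_imp_poisson[OF this]]
      show "poisson S (\<lambda>z. U z - - ?Q z) (\<lambda>z. q z + B)" by simp
      show "0 \<le> q z + B" if "z \<in> S" for z using U(3)[OF that] by simp
      show "U z - - ?Q z \<le> m + B * R\<^sup>2 / 4" if "z \<in> frontier S" for z
        using U(4)[OF that] Qb(2)[of z] that by (simp add: frontier_def)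
    qed (rule z)
    then show ?thesis using Qb(1)[of z] z closure_subset by force
  qed
  have "V z \<le> m + B * R\<^sup>2 / 4"
    by (rule *[OF assms(3,4)]) (use f m in \<open>force simp: abs_le_iff\<close>)+
  moreover have "- V z \<le> m + B * R\<^sup>2 / 4"
    by (rule *[OF continuous_on_minus[OF assms(3)] poisson_uminus[OF assms(4)]]) (use f m in \<open>force simp: abs_le_iff\<close>)+
  ultimately show ?thesis by linarith
qed

section \<open>Interior gradient bound\<close>

text \<open>
  The reflection argument of Gilbarg and Trudinger: the odd part of \<open>W\<close> across the line through
  \<open>a\<close> orthogonal to the gradient is compared on a half-square with a quadratic \<open>\<psi>\<close>, \<open>\<triangle>\<psi> = -B\<close>.
\<close>

lemma gradient_bound:
  assumes W: "c2_on (ball a r) W g p" and r: "r > 0"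
    and A: "\<And>z. z \<in> ball a r \<Longrightarrow> \<bar>W z\<bar> \<le> A" and B: "\<And>z. z \<in> ball a r \<Longrightarrow> \<bar>p z\<bar> \<le> B"
  shows "norm (g a) \<le> 4 * A / r + B * r / 4"
proof (cases "g a = 0")
  case True
  have "A \<ge> 0" "B \<ge> 0" using A[of a] B[of a] r by auto
  then show ?thesis using True r by simp
next
  case False
  have A0: "A \<ge> 0" and B0: "B \<ge> 0" using A[of a] B[of a] r by auto
  \<comment> \<open>The rotation carries \<i> to the direction of the gradient, so the odd part
    below is taken across the real axis and its derivative along \<i> is
    \<open>norm (g a)\<close>.\<close>
  define \<omega> where "\<omega> = - \<i> * sgn (g a)"
  have \<omega>: "norm \<omega> = 1" using False by (simp add: \<omega>_def norm_mult norm_sgn)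
  \<comment> \<open>The corners of the closed half-square \<open>T\<close> have modulus at most
    \<open>sqrt 2 * d < r\<close>, so it stays in the disc together with its reflection.\<close>
  define d where "d = r / 2"
  have d: "d > 0" using r by (simp add: d_def)
  define u1 where "u1 = (\<lambda>z. W (a + \<omega> * z))"
  define q1 where "q1 = (\<lambda>z. p (a + \<omega> * z))"
  have mem: "a + \<omega> * z \<in> ball a r \<longleftrightarrow> z \<in> ball 0 r" for z
    using \<omega> by (simp add: dist_norm norm_mult)
  have u1: "c2_on (ball 0 r) u1 (\<lambda>z. cnj \<omega> * g (a + \<omega> * z)) q1"
    using c2_on_rotate[OF W \<omega>, of a] unfolding mem u1_def q1_def Collect_mem_eq .
  have u2: "c2_on (ball 0 r) (\<lambda>z. u1 (cnj z)) (\<lambda>z. cnj (cnj \<omega> * g (a + \<omega> * cnj z))) (\<lambda>z. q1 (cnj z))"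
    by (rule c2_on_subset[OF c2_on_cnj[OF u1]]) (auto simp: dist_norm)
  define \<phi> where "\<phi> = (\<lambda>z. (1/2) * u1 z + (- 1/2) * u1 (cnj z))"
  obtain gp where \<phi>: "c2_on (ball 0 r) \<phi> gp (\<lambda>z. (1/2) * q1 z + (- 1/2) * q1 (cnj z))"
    using c2_on_lin[OF u1 u2, of "1/2" "-1/2"] unfolding \<phi>_def by blast
  define C where "C = 2 * A / d + B * d / 2"
  \<comment> \<open>Best read in the form \<open>\<psi>_eq\<close>: the first term is harmonic and
    at least \<open>A\<close> on the three sides off the real axis, the second vanishes for
    \<open>Im z = 0\<close> and \<open>Im z = d\<close> and supplies the Laplacian
    \<open>- B\<close>. \<open>C\<close> is the derivative of \<psi> along \<i> at 0.\<close>
  define \<psi> where "\<psi> = (\<lambda>z. ((A / d\<^sup>2 + B / 4) * Re (z\<^sup>2) + 1 * (0 + (C *\<^sub>R \<i>) \<bullet> z)) + (- B / 4) * (norm (z - 0))\<^sup>2)"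
  have \<psi>_eq: "\<psi> z = (A / d\<^sup>2) * ((Re z)\<^sup>2 + Im z * (2 * d - Im z)) + (B / 2) * (Im z * (d - Im z))" for z
  proof -
    have "(A / d\<^sup>2) * (Im z * (2 * d)) = 2 * A / d * Im z"
      using d by (simp add: power2_eq_square)
    then show ?thesis
      unfolding \<psi>_def C_def cmod_power2 by (simp add: inner_complex_def power2_eq_square algebra_simps add_divide_distrib)
  qed
  have hol: "(\<lambda>z. z\<^sup>2) holomorphic_on ball 0 r" by (intro holomorphic_intros)
  obtain gq where \<psi>: "c2_on (ball 0 r) \<psi> gq (\<lambda>z. - B)"
    using c2_on_add[OF c2_on_lin[OF c2_on_Re_holomorphic[OF hol open_ball] c2_on_affine[of _ 0 "C *\<^sub>R \<i>"], where a="A / d\<^sup>2 + B / 4" and b=1]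
        c2_on_scale[OF c2_on_norm_square[of _ 0], where a="- B / 4"]]
    unfolding \<psi>_def by simp
  define S where "S = {z. \<bar>Re z\<bar> < d \<and> 0 < Im z \<and> Im z < d}"
  define T where "T = {z. \<bar>Re z\<bar> \<le> d \<and> 0 \<le> Im z \<and> Im z \<le> d}"
  have "open S" unfolding S_def
    by (intro open_Collect_conj open_Collect_less continuous_intros)
  have "closed T" unfolding T_def
    by (intro closed_Collect_conj closed_Collect_le continuous_intros)
  then have clS: "closure S \<subseteq> T" by (rule closure_minimal[rotated]) (auto simp: S_def T_def)
  have Tr: "T \<subseteq> ball 0 r"
  proof
    fix z assume z: "z \<in> T"
    have "(norm z)\<^sup>2 \<le> d\<^sup>2 + d\<^sup>2"
      unfolding cmod_power2 using z by (intro add_mono) (auto simp: T_def abs_le_square_iff[symmetric] d less_imp_le)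
    also have "\<dots> < r\<^sup>2" using r by (simp add: d_def power2_eq_square)
    finally have "norm z < r" using r by (simp add: power2_less_imp_less)
    then show "z \<in> ball 0 r" by simp
  qed
  have "bounded S" using bounded_subset[OF bounded_ball] closure_subset clS Tr by blast
  have Sr: "S \<subseteq> ball 0 r" using closure_subset clS Tr by blast
  have le: "\<phi> z - \<psi> z \<le> 0" if z: "z \<in> S" for z
  proof (rule maximum_principle[OF \<open>open S\<close> \<open>bounded S\<close>, where V="\<lambda>z. \<phi> z - \<psi> z" and a=z])
    have c: "c2_on (ball 0 r) (\<lambda>z. \<phi> z - \<psi> z) (\<lambda>z. gp z - gq z) (\<lambda>z. ((1/2) * q1 z + (- 1/2) * q1 (cnj z)) - - B)"
      by (rule c2_on_diff[OF \<phi> \<psi>])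
    show "continuous_on (closure S) (\<lambda>z. \<phi> z - \<psi> z)"
      using c2_on_continuous(1)[OF c] clS Tr by (blast intro: continuous_on_subset)
    show "poisson S (\<lambda>z. \<phi> z - \<psi> z) (\<lambda>z. ((1/2) * q1 z + (- 1/2) * q1 (cnj z)) - - B)"
      by (rule c2_on_imp_poisson[OF c2_on_subset[OF c Sr]])
    fix w assume "w \<in> S"
    then have "w \<in> ball 0 r" "cnj w \<in> ball 0 r" using Sr by auto
    then have "\<bar>q1 w\<bar> \<le> B" "\<bar>q1 (cnj w)\<bar> \<le> B"
      unfolding q1_def using B mem by blast+
    then show "0 \<le> ((1/2) * q1 w + (- 1/2) * q1 (cnj w)) - - B" by (simp add: abs_le_iff)
  next
    fix w assume w: "w \<in> frontier S"
    then have wT: "w \<in> T" using clS by (auto simp: frontier_def)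
    have "w \<notin> S" using w \<open>open S\<close> by (simp add: frontier_def interior_open)
    have "w \<in> ball 0 r" "cnj w \<in> ball 0 r" using wT Tr by auto
    then have "\<bar>u1 w\<bar> \<le> A" "\<bar>u1 (cnj w)\<bar> \<le> A"
      unfolding u1_def using A mem by blast+
    then have \<phi>A: "\<phi> w \<le> A" by (simp add: \<phi>_def abs_le_iff)
    have nn: "0 \<le> A / d\<^sup>2" using A0 by simp
    have n2: "0 \<le> Im w * (2 * d - Im w)" "0 \<le> (B / 2) * (Im w * (d - Im w))"
      using wT B0 d by (auto simp: T_def)
    from wT \<open>w \<notin> S\<close> consider "Im w = 0" | "\<bar>Re w\<bar> = d" | "Im w = d"
      by (force simp: S_def T_def)
    then show "\<phi> w - \<psi> w \<le> 0"
    proof cases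
      case 1
      then have "cnj w = w" by (simp add: complex_eq_iff)
      then have "\<phi> w = 0" by (simp add: \<phi>_def)
      moreover have "\<psi> w \<ge> 0" unfolding \<psi>_eq using A0 1 by simp
      ultimately show ?thesis by simp
    next
      case 2
      then have "(Re w)\<^sup>2 = d\<^sup>2" by (metis power2_abs)
      then have "A / d\<^sup>2 * d\<^sup>2 \<le> (A / d\<^sup>2) * ((Re w)\<^sup>2 + Im w * (2 * d - Im w))"
        using nn n2 by (intro mult_left_mono) auto
      then have "A \<le> \<psi> w" unfolding \<psi>_eq using n2 d by simp
      then show ?thesis using \<phi>A by simp
    next
      case 3
      then have "A / d\<^sup>2 * d\<^sup>2 \<le> (A / d\<^sup>2) * ((Re w)\<^sup>2 + Im w * (2 * d - Im w))"
        using nn by (intro mult_left_mono) (auto simp: power2_eq_square)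
      then have "A \<le> \<psi> w" unfolding \<psi>_eq using n2 d by simp
      then show ?thesis using \<phi>A by simp
    qed
  qed (rule z)
  define F where "F = (\<lambda>t. \<psi> (t *\<^sub>R \<i>) - \<phi> (t *\<^sub>R \<i>))"
  have F0: "F 0 = 0" by (simp add: F_def \<psi>_eq \<phi>_def)
  have Fpos: "F t \<ge> 0" if "0 < t" "t < d" for t
    using le[of "t *\<^sub>R \<i>"] that by (simp add: F_def S_def)
  have \<omega>i: "\<omega> * \<i> = sgn (g a)" by (simp add: \<omega>_def complex_eq_iff)
  have "(\<lambda>t. u1 (t *\<^sub>R \<i>)) = (\<lambda>t. W (a + t *\<^sub>R sgn (g a)))"
    unfolding u1_def \<omega>i[symmetric] by (simp add: scaleR_conv_of_real mult_ac)
  moreover have "(\<lambda>t. u1 (cnj (t *\<^sub>R \<i>))) = (\<lambda>t. W (a + (- t) *\<^sub>R sgn (g a)))"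
    unfolding u1_def \<omega>i[symmetric] by (simp add: scaleR_conv_of_real mult_ac)
  ultimately have \<phi>t: "(\<lambda>t. \<phi> (t *\<^sub>R \<i>)) = (\<lambda>t. (1/2) * W (a + t *\<^sub>R sgn (g a)) + (- 1/2) * W (a + (- t) *\<^sub>R sgn (g a)))"
    unfolding \<phi>_def by metis
  have Wd: "(W has_derivative (\<bullet>) (g a)) (at a)" using c2_on_gradient[OF W] r by simp
  have ip: "g a \<bullet> sgn (g a) = norm (g a)"
    using False by (simp add: sgn_div_norm power2_norm_eq_inner[symmetric] power2_eq_square)
  have "((\<lambda>t. W (a + t *\<^sub>R sgn (g a))) has_derivative (\<lambda>h. g a \<bullet> (h *\<^sub>R sgn (g a)))) (at 0)"
    by (rule has_derivative_compose[where g=W and f="\<lambda>t. a + t *\<^sub>R sgn (g a)"]) (auto intro!: derivative_eq_intros Wd)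
  then have d1: "((\<lambda>t. W (a + t *\<^sub>R sgn (g a))) has_real_derivative norm (g a)) (at 0)"
    unfolding has_field_derivative_def by (rule has_derivative_eq_rhs) (auto simp: ip mult.commute)
  have "((\<lambda>t. W (a + (-t) *\<^sub>R sgn (g a))) has_derivative (\<lambda>h. g a \<bullet> ((-h) *\<^sub>R sgn (g a)))) (at 0)"
    by (rule has_derivative_compose[where g=W and f="\<lambda>t. a + (-t) *\<^sub>R sgn (g a)"]) (auto intro!: derivative_eq_intros Wd)
  then have d2: "((\<lambda>t. W (a + (-t) *\<^sub>R sgn (g a))) has_real_derivative - norm (g a)) (at 0)"
    unfolding has_field_derivative_def by (rule has_derivative_eq_rhs) (auto simp: ip mult.commute)
  have "((\<lambda>t. (1/2) * W (a + t *\<^sub>R sgn (g a)) + (- 1/2) * W (a + (- t) *\<^sub>R sgn (g a)))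
     has_real_derivative (1/2) * norm (g a) + (- 1/2) * (- norm (g a))) (at 0)"
    by (intro DERIV_add DERIV_cmult d1 d2)
  then have d3: "((\<lambda>t. \<phi> (t *\<^sub>R \<i>)) has_real_derivative norm (g a)) (at 0)"
    unfolding \<phi>t by simp
  have d4: "((\<lambda>t. \<psi> (t *\<^sub>R \<i>)) has_real_derivative C) (at 0)"
    unfolding \<psi>_eq C_def using d by (auto intro!: derivative_eq_intros simp: power2_eq_square field_simps)
  have d5: "(F has_real_derivative C - norm (g a)) (at 0)"
    unfolding F_def by (rule DERIV_diff[OF d4 d3])
  \<comment> \<open>\<open>F\<close> vanishes at 0 and is nonnegative just to the right of it, so
    its derivative \<open>C - norm (g a)\<close> there cannot be negative.\<close>
  have "norm (g a) \<le> C"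
  proof (rule ccontr)
    assume "\<not> norm (g a) \<le> C"
    then have "C - norm (g a) < 0" by simp
    from DERIV_neg_dec_right[OF d5 this] obtain e where e: "e > 0" "\<And>h. 0 < h \<Longrightarrow> h < e \<Longrightarrow> F (0 + h) < F 0"
      by blast
    define h where "h = min e d / 2"
    have "0 < h" "h < e" "h < d" using e(1) d by (auto simp: h_def)
    then show False using e(2)[of h] Fpos[of h] F0 by simp
  qed
  also have "C = 4 * A / r + B * r / 4" by (simp add: C_def d_def)
  finally show ?thesis .
qed

text \<open>The gradient bound for \<open>W n - W m\<close> makes the gradients \<open>g n\<close>
  Cauchy at a rate depending only on the radius of a disc inside \<open>S\<close>. So
  \<open>V\<close> is C^1 although it was only a uniform limit. The approximating sequence is
  exported with its rates because the weak equation is proved for its members first.\<close>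

lemma poisson_approximation:
  assumes "open S" "poisson S V f"
  obtains W :: "nat \<Rightarrow> complex \<Rightarrow> real" and g p G where
    "\<And>n. c2_on S (W n) (g n) (p n)"
    "\<And>n z. z \<in> S \<Longrightarrow> \<bar>W n z - V z\<bar> \<le> inverse (Suc n)"
    "\<And>n z. z \<in> S \<Longrightarrow> \<bar>p n z - f z\<bar> \<le> inverse (Suc n)"
    "\<And>n a r. r > 0 \<Longrightarrow> ball a r \<subseteq> S \<Longrightarrow> norm (g n a - G a) \<le> (4 / r + r / 4) * inverse (Suc n)"
    "\<And>z. z \<in> S \<Longrightarrow> (V has_derivative (\<lambda>h. G z \<bullet> h)) (at z)"
    "continuous_on S G"
    "\<And>a r A B. r > 0 \<Longrightarrow> ball a r \<subseteq> S \<Longrightarrow> \<forall>z\<in>ball a r. \<bar>V z\<bar> \<le> A \<Longrightarrow>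
       \<forall>z\<in>ball a r. \<bar>f z\<bar> \<le> B \<Longrightarrow> norm (G a) \<le> 4 * A / r + B * r / 4"
proof -
  define e where "e = (\<lambda>n. inverse (real (Suc n)))"
  have e0: "e n > 0" for n by (simp add: e_def)
  have elim: "e \<longlonglongrightarrow> 0" unfolding e_def by (rule LIMSEQ_inverse_real_of_nat)
  have "\<forall>n. \<exists>W. \<exists>g p. c2_on S W g p \<and> (\<forall>z\<in>S. \<bar>W z - V z\<bar> < e n \<and> \<bar>p z - f z\<bar> < e n)"
    using assms(2) e0 unfolding poisson_def by simp
  from choice[OF this] obtain W where "\<forall>n. \<exists>g. \<exists>p. c2_on S (W n) g p \<and> (\<forall>z\<in>S. \<bar>W n z - V z\<bar> < e n \<and> \<bar>p z - f z\<bar> < e n)"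
    by (elim exE)
  from choice[OF this] obtain g where "\<forall>n. \<exists>p. c2_on S (W n) (g n) p \<and> (\<forall>z\<in>S. \<bar>W n z - V z\<bar> < e n \<and> \<bar>p z - f z\<bar> < e n)"
    by (elim exE)
  from choice[OF this] obtain p where *: "\<forall>n. c2_on S (W n) (g n) (p n) \<and> (\<forall>z\<in>S. \<bar>W n z - V z\<bar> < e n \<and> \<bar>p n z - f z\<bar> < e n)"
    by (elim exE)
  have c2: "c2_on S (W n) (g n) (p n)" for n using * by simp
  have WV: "\<bar>W n z - V z\<bar> < e n" and pf: "\<bar>p n z - f z\<bar> < e n" if "z \<in> S" for n z
    using * that by simp_all
  have diff: "norm (g n a - g m a) \<le> (4 / r + r / 4) * (e n + e m)" if r: "r > 0" "ball a r \<subseteq> S" for n m a r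
  proof -
    have "norm (g n a - g m a) \<le> 4 * (e n + e m) / r + (e n + e m) * r / 4"
    proof (rule gradient_bound[OF _ r(1), where W="\<lambda>z. W n z - W m z" and p="\<lambda>z. p n z - p m z" and g="\<lambda>z. g n z - g m z" and a=a])
      show "c2_on (ball a r) (\<lambda>z. W n z - W m z) (\<lambda>z. g n z - g m z) (\<lambda>z. p n z - p m z)"
        by (rule c2_on_subset[OF c2_on_diff[OF c2 c2] r(2)])
      fix z assume "z \<in> ball a r"
      then have z: "z \<in> S" using r by auto
      show "\<bar>W n z - W m z\<bar> \<le> e n + e m" using WV[OF z, of n] WV[OF z, of m] by linarith
      show "\<bar>p n z - p m z\<bar> \<le> e n + e m" using pf[OF z, of n] pf[OF z, of m] by linarith
    qed
    then show ?thesis by (simp add: algebra_simps add_divide_distrib)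
  qed
  define G where "G = (\<lambda>a. lim (\<lambda>n. g n a))"
  have conv: "(\<lambda>n. g n a) \<longlonglongrightarrow> G a" if a: "a \<in> S" for a
  proof -
    obtain r where r: "r > 0" "ball a r \<subseteq> S" using assms(1) a open_contains_ball by blast
    define c where "c = 4 / r + r / 4"
    have c: "c > 0" using r by (simp add: c_def add_pos_pos)
    have "Cauchy (\<lambda>n. g n a)"
    proof (rule metric_CauchyI)
      fix \<epsilon> :: real assume "\<epsilon> > 0"
      then have "\<epsilon> / (2 * c) > 0" using c by simp
      from order_tendstoD(2)[OF elim this] obtain N where N: "\<And>n. n \<ge> N \<Longrightarrow> e n < \<epsilon> / (2 * c)"
        by (auto simp: eventually_sequentially)
      have "dist (g n a) (g m a) < \<epsilon>" if "n \<ge> N" "m \<ge> N" for n m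
      proof -
        have "dist (g n a) (g m a) \<le> c * (e n + e m)" using diff[OF r] by (simp add: dist_norm c_def)
        also have "\<dots> < c * (\<epsilon> / (2 * c) + \<epsilon> / (2 * c))"
          using c N[OF that(1)] N[OF that(2)] by (intro mult_strict_left_mono add_strict_mono) auto
        also have "\<dots> = \<epsilon>" using c by (simp add: field_simps)
        finally show ?thesis .
      qed
      then show "\<exists>M. \<forall>m\<ge>M. \<forall>n\<ge>M. dist (g m a) (g n a) < \<epsilon>" by blast
    qed
    then show ?thesis unfolding G_def using Cauchy_convergent convergent_LIMSEQ_iff by blast
  qed
  have gG: "norm (g n a - G a) \<le> (4 / r + r / 4) * e n" if r: "r > 0" "ball a r \<subseteq> S" for n a r
  proof (rule LIMSEQ_le)
    have "a \<in> S" using r by auto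
    then show "(\<lambda>m. norm (g n a - g m a)) \<longlonglongrightarrow> norm (g n a - G a)"
      by (intro tendsto_intros conv)
    have "(\<lambda>m. (4 / r + r / 4) * (e n + e m)) \<longlonglongrightarrow> (4 / r + r / 4) * (e n + 0)"
      by (intro tendsto_intros elim)
    then show "(\<lambda>m. (4 / r + r / 4) * (e n + e m)) \<longlonglongrightarrow> (4 / r + r / 4) * e n" by simp
    show "\<exists>N. \<forall>m\<ge>N. norm (g n a - g m a) \<le> (4 / r + r / 4) * (e n + e m)"
      using diff[OF r] by blast
  qed
  have loc: "(V has_derivative (\<lambda>h. G a \<bullet> h)) (at a) \<and> isCont G a" if a: "a \<in> S" for a
  proof -
    obtain r where r: "r > 0" "ball a r \<subseteq> S" using assms(1) a open_contains_ball by blast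
    \<comment> \<open>Halving leaves a disc of radius \<open>s\<close> inside \<open>S\<close>
      around every point of \<open>ball a s\<close>, hence one rate \<open>c\<close> on that
      ball.\<close>
    define s where "s = r / 2"
    have s: "s > 0" using r by (simp add: s_def)
    have sub: "ball b s \<subseteq> S" if "b \<in> ball a s" for b
    proof -
      have "ball b s \<subseteq> ball a r"
      proof
        fix x assume "x \<in> ball b s"
        then show "x \<in> ball a r" using that dist_triangle[of a x b] by (simp add: s_def)
      qed
      then show ?thesis using r by auto
    qed
    define c where "c = 4 / s + s / 4"
    have c: "c > 0" using s by (simp add: c_def add_pos_pos)
    have bd: "norm (g n b - G b) \<le> c * e n" if "b \<in> ball a s" for n b
      using gG[OF s sub[OF that]] by (simp add: c_def)
    have ev: "\<forall>\<^sub>F n in sequentially. c * e n < \<epsilon>" if "\<epsilon> > 0" for \<epsilon>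
      using order_tendstoD(2)[OF tendsto_mult_left[OF elim, of c], of \<epsilon>] that by simp
    \<comment> \<open>The convergence theorem for derivatives returns some limit \<open>U\<close>;
      the uniform approximation of \<open>V\<close> by \<open>W n\<close> identifies it with
      \<open>V\<close> on the ball.\<close>
    have "\<exists>U. \<forall>x\<in>ball a s. (\<lambda>n. W n x) \<longlonglongrightarrow> U x \<and> (U has_derivative (\<lambda>h. G x \<bullet> h)) (at x within ball a s)"
    proof (rule has_derivative_sequence[where f'="\<lambda>n x h. g n x \<bullet> h" and l="V a"])
      show "(W n has_derivative (\<bullet>) (g n x)) (at x within ball a s)" if "x \<in> ball a s" for n x
        using c2_on_gradient[OF c2] sub[OF that] s that by (meson centre_in_ball has_derivative_at_withinI subsetD)
      show "(\<lambda>n. W n a) \<longlonglongrightarrow> V a"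
      proof (rule LIM_zero_cancel, rule Lim_null_comparison[OF _ elim])
        show "\<forall>\<^sub>F n in sequentially. norm (W n a - V a) \<le> e n"
          using WV[OF a] by (simp add: less_imp_le)
      qed
      fix \<epsilon> :: real assume "\<epsilon> > 0"
      show "\<forall>\<^sub>F n in sequentially. \<forall>x\<in>ball a s. \<forall>h. norm (g n x \<bullet> h - G x \<bullet> h) \<le> \<epsilon> * norm h"
        using ev[OF \<open>\<epsilon> > 0\<close>]
      proof (rule eventually_mono, intro ballI allI)
        fix n x h assume "c * e n < \<epsilon>" "x \<in> ball a s"
        then have "norm (g n x - G x) \<le> \<epsilon>" using bd[of x n] by linarith
        then have "norm ((g n x - G x) \<bullet> h) \<le> \<epsilon> * norm h"
          using Cauchy_Schwarz_ineq2[of "g n x - G x" h] mult_right_mono[of "norm (g n x - G x)" \<epsilon> "norm h"] by simp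
        then show "norm (g n x \<bullet> h - G x \<bullet> h) \<le> \<epsilon> * norm h" by (simp add: inner_diff_left)
      qed
    qed (use s in auto)
    then obtain U where U: "\<And>x. x \<in> ball a s \<Longrightarrow> (\<lambda>n. W n x) \<longlonglongrightarrow> U x"
      "\<And>x. x \<in> ball a s \<Longrightarrow> (U has_derivative (\<lambda>h. G x \<bullet> h)) (at x within ball a s)" by blast
    have UV: "U x = V x" if x: "x \<in> ball a s" for x
    proof -
      have xS: "x \<in> S" using sub[OF x] s by auto
      have "(\<lambda>n. W n x) \<longlonglongrightarrow> V x"
      proof (rule LIM_zero_cancel, rule Lim_null_comparison[OF _ elim])
        show "\<forall>\<^sub>F n in sequentially. norm (W n x - V x) \<le> e n"
          using WV[OF xS] by (simp add: less_imp_le)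
      qed
      then show ?thesis using U(1)[OF x] LIMSEQ_unique by blast
    qed
    have "(U has_derivative (\<lambda>h. G a \<bullet> h)) (at a)"
      using U(2)[of a] s by (simp add: at_within_open[OF _ open_ball])
    then have dV: "(V has_derivative (\<lambda>h. G a \<bullet> h)) (at a)"
      by (rule has_derivative_transform_within_open[OF _ open_ball[of a s]]) (use s UV in auto)
    have "uniform_limit (ball a s) g G sequentially"
    proof (rule uniform_limitI)
      fix \<epsilon> :: real assume "\<epsilon> > 0"
      show "\<forall>\<^sub>F n in sequentially. \<forall>x\<in>ball a s. dist (g n x) (G x) < \<epsilon>"
        using ev[OF \<open>\<epsilon> > 0\<close>] by (rule eventually_mono) (auto simp: dist_norm simp del: mem_ball intro: le_less_trans[OF bd])
    qed
    moreover have "\<forall>\<^sub>F n in sequentially. continuous_on (ball a s) (g n)"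
    proof -
      have "ball a s \<subseteq> S" using sub[of a] s by simp
      then show ?thesis
        by (intro always_eventually allI continuous_on_subset[OF c2_on_continuous(2)[OF c2]])
    qed
    ultimately have "continuous_on (ball a s) G"
      by (intro uniform_limit_theorem) auto
    then have "isCont G a" using s by (simp add: continuous_on_eq_continuous_at)
    with dV show ?thesis by blast
  qed
  have bound: "norm (G a) \<le> 4 * A / r + B * r / 4"
    if r: "r > 0" "ball a r \<subseteq> S" "\<And>z. z \<in> ball a r \<Longrightarrow> \<bar>V z\<bar> \<le> A" "\<And>z. z \<in> ball a r \<Longrightarrow> \<bar>f z\<bar> \<le> B" for a r A B
  proof (rule LIMSEQ_le)
    have "a \<in> S" using r by auto
    then show "(\<lambda>m. norm (g m a)) \<longlonglongrightarrow> norm (G a)" by (intro tendsto_intros conv)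
    have "(\<lambda>m. 4 * (A + e m) / r + (B + e m) * r / 4) \<longlonglongrightarrow> 4 * (A + 0) / r + (B + 0) * r / 4"
      using r by (intro tendsto_intros elim) auto
    then show "(\<lambda>m. 4 * (A + e m) / r + (B + e m) * r / 4) \<longlonglongrightarrow> 4 * A / r + B * r / 4" by simp
    have "norm (g m a) \<le> 4 * (A + e m) / r + (B + e m) * r / 4" for m
    proof (rule gradient_bound[OF c2_on_subset[OF c2 r(2)] r(1)])
      fix z assume z: "z \<in> ball a r"
      then have zS: "z \<in> S" using r by auto
      show "\<bar>W m z\<bar> \<le> A + e m" using WV[OF zS, of m] r(3)[OF z] by linarith
      show "\<bar>p m z\<bar> \<le> B + e m" using pf[OF zS, of m] r(4)[OF z] by linarith
    qed
    then show "\<exists>N. \<forall>m\<ge>N. norm (g m a) \<le> 4 * (A + e m) / r + (B + e m) * r / 4" by blast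
  qed
  show thesis
  proof (rule that[where W=W and g=g and p=p and G=G])
    show "continuous_on S G" using loc by (simp add: continuous_at_imp_continuous_on)
    show "\<bar>W n z - V z\<bar> \<le> inverse (Suc n)" "\<bar>p n z - f z\<bar> \<le> inverse (Suc n)" if "z \<in> S" for n z
      using WV[OF that, of n] pf[OF that, of n] by (simp_all add: e_def)
    show "norm (g n a - G a) \<le> (4 / r + r / 4) * inverse (Suc n)" if "r > 0" "ball a r \<subseteq> S" for n a r
      using gG[OF that] by (simp add: e_def)
  qed (use c2 loc bound in blast)+
qed

text \<open>Each point of the half disc is the centre of a disc of radius \<open>r / 2\<close>
  inside the large one; there the gradient bound holds with its first constant doubled and its
  second halved. The mean value inequality does the rest.\<close>

lemma poisson_lipschitz:
  assumes "poisson (ball a r) V f" "r > 0"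
    and "\<And>z. z \<in> ball a r \<Longrightarrow> \<bar>V z\<bar> \<le> A" "\<And>z. z \<in> ball a r \<Longrightarrow> \<bar>f z\<bar> \<le> B"
    and xy: "x \<in> ball a (r / 2)" "y \<in> ball a (r / 2)"
  shows "\<bar>V x - V y\<bar> \<le> (8 * A / r + B * r / 8) * dist x y"
proof -
  obtain G where G: "\<And>z. z \<in> ball a r \<Longrightarrow> (V has_derivative (\<lambda>h. G z \<bullet> h)) (at z)"
    and bd: "\<And>b s A B. s > 0 \<Longrightarrow> ball b s \<subseteq> ball a r \<Longrightarrow> \<forall>z\<in>ball b s. \<bar>V z\<bar> \<le> A \<Longrightarrow>
       \<forall>z\<in>ball b s. \<bar>f z\<bar> \<le> B \<Longrightarrow> norm (G b) \<le> 4 * A / s + B * s / 4"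
    by (rule poisson_approximation[OF open_ball assms(1)]) (rule that)
  have sub: "ball b (r/2) \<subseteq> ball a r" if "b \<in> ball a (r/2)" for b
  proof
    fix x assume "x \<in> ball b (r/2)"
    then show "x \<in> ball a r" using that dist_triangle[of a x b] by simp
  qed
  have b: "norm (G b) \<le> 8 * A / r + B * r / 8" if "b \<in> ball a (r/2)" for b
  proof -
    have "norm (G b) \<le> 4 * A / (r/2) + B * (r/2) / 4"
      by (rule bd[OF _ sub[OF that]]) (use assms(2-4) sub[OF that] in auto)
    then show ?thesis by simp
  qed
  have "norm (V x - V y) \<le> (8 * A / r + B * r / 8) * norm (x - y)"
  proof (rule differentiable_bound[of "ball a (r/2)" V "\<lambda>z h. G z \<bullet> h"])
    fix b assume b2: "b \<in> ball a (r/2)"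
    then have "b \<in> ball a r" using assms(2) by auto
    then show "(V has_derivative (\<bullet>) (G b)) (at b within ball a (r/2))"
      using G has_derivative_at_withinI by blast
    have "norm (G b \<bullet> h) \<le> (8 * A / r + B * r / 8) * norm h" for h
      using Cauchy_Schwarz_ineq2[of "G b" h] mult_right_mono[OF b[OF b2], of "norm h"] by simp
    then show "onorm ((\<bullet>) (G b)) \<le> 8 * A / r + B * r / 8"
      by (intro onorm_bound) (use order_trans[OF norm_ge_zero b[OF b2]] in auto)
  qed (use xy in auto)
  then show ?thesis by (simp add: dist_norm)
qed

section \<open>The Dirichlet problem on discs\<close>

text \<open>
  Real polynomials in \<open>x, y\<close> are handled as complex polynomials in \<open>z\<close> and \<open>cnj z\<close>: in these variables
  the Laplacian can be inverted monomial by monomial, and on the unit circle \<open>cnj z = 1 / z\<close>.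
\<close>

inductive zpoly :: "(complex \<Rightarrow> complex) \<Rightarrow> bool" where
  monom: "zpoly (\<lambda>z. c * z ^ m * cnj z ^ n)"
| add: "zpoly P \<Longrightarrow> zpoly Q \<Longrightarrow> zpoly (\<lambda>z. P z + Q z)"

lemma zpoly_mult_monom: "zpoly P \<Longrightarrow> zpoly (\<lambda>z. P z * (c * z ^ m * cnj z ^ n))"
proof (induction rule: zpoly.induct)
  case (monom d k l)
  have "(\<lambda>z. d * z ^ k * cnj z ^ l * (c * z ^ m * cnj z ^ n)) = (\<lambda>z. (d * c) * z ^ (k + m) * cnj z ^ (l + n))"
    by (auto simp: power_add)
  then show ?case using zpoly.monom by metis
next
  case (add P Q)
  then show ?case using zpoly.add[OF add(3,4)] by (simp add: algebra_simps)
qed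

lemma zpoly_mult:
  assumes "zpoly P" "zpoly Q"
  shows "zpoly (\<lambda>z. P z * Q z)"
  using assms(2)
proof (induction rule: zpoly.induct)
  case (monom d k l)
  show ?case by (rule zpoly_mult_monom[OF assms(1)])
next
  case (add P' Q')
  then show ?case using zpoly.add[OF add(3,4)] by (simp add: algebra_simps)
qed

lemma zpoly_real_polynomial:
  assumes "real_polynomial_function p"
  shows "zpoly (\<lambda>z. complex_of_real (p z))"
  using assms
proof (induction rule: real_polynomial_function.induct)
  case (linear f)
  interpret bounded_linear f by fact
  have "f z = Re z * f 1 + Im z * f \<i>" for z
  proof -
    have "f z = f (Re z *\<^sub>R 1 + Im z *\<^sub>R \<i>)" by (rule arg_cong[of _ _ f]) (simp add: complex_eq_iff)
    then show ?thesis by (simp add: add scaleR)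
  qed
  note f = this
  \<comment> \<open>\<open>Re z\<close> and \<open>Im z\<close> written as
    \<open>(z + cnj z) / 2\<close> and \<open>(z - cnj z) / (2 \<i>)\<close>.\<close>
  have id: "complex_of_real (Re z * s + Im z * t) = ((s - \<i> * t) / 2) * z ^ 1 * cnj z ^ 0 + ((s + \<i> * t) / 2) * z ^ 0 * cnj z ^ 1"
    for s t :: real and z by (simp add: complex_eq_iff field_simps)
  have "(\<lambda>z. complex_of_real (f z)) = (\<lambda>z. ((f 1 - \<i> * f \<i>) / 2) * z ^ 1 * cnj z ^ 0 + ((f 1 + \<i> * f \<i>) / 2) * z ^ 0 * cnj z ^ 1)"
    by (rule ext) (subst f, rule id)
  then show ?case by (simp only:) (intro zpoly.intros)
next
  case (const c)
  show ?case using zpoly.monom[of "of_real c" 0 0] by simp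
next
  case (add f g)
  then show ?case using zpoly.add[OF add(3,4)] by simp
next
  case (mult f g)
  then show ?case using zpoly_mult[OF mult(3,4)] by simp
qed

lemma zpoly_dense:
  assumes "compact S" "continuous_on S f" "0 < e"
  obtains P where "zpoly P" "\<And>x. x \<in> S \<Longrightarrow> \<bar>Re (P x) - f x\<bar> < e"
proof -
  obtain p where p: "real_polynomial_function p" "\<And>x. x \<in> S \<Longrightarrow> \<bar>f x - p x\<bar> < e"
    using Stone_Weierstrass_real_polynomial_function[OF assms] by blast
  show thesis
    by (rule that[OF zpoly_real_polynomial[OF p(1)]]) (use p(2) in \<open>simp add: abs_minus_commute\<close>)
qed

section \<open>Inverting the Laplacian on polynomials\<close>

text \<open>The coefficients of \<open>h\<close> and \<open>cnj h\<close> are the Wirtinger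
  derivatives. For \<open>m = 0\<close> or \<open>n = 0\<close> the truncated exponent does no harm,
  since it is multiplied by 0.\<close>

lemma zmonom_derivative:
  "((\<lambda>z. z ^ m * cnj z ^ n) has_derivative
     (\<lambda>h. of_nat m * (z ^ (m - 1) * cnj z ^ n) * h + of_nat n * (z ^ m * cnj z ^ (n - 1)) * cnj h)) (at z)"
proof -
  have "(cnj has_derivative cnj) (at z)"
    by (rule bounded_linear_imp_has_derivative) (rule bounded_linear_cnj)
  then show ?thesis
    by (auto intro!: derivative_eq_intros simp: algebra_simps)
qed

text \<open>The Laplacian is four times the product of the two Wirtinger derivatives, so on
  monomials it lowers both exponents by one. The gradient \<open>g\<close> is twice the
  \<open>cnj z\<close>-derivative of the real part.\<close>

lemma c2_on_zmonom:
  "\<exists>g. c2_on S (\<lambda>z. Re (c * z ^ Suc m * cnj z ^ Suc n)) g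
     (\<lambda>z. Re (4 * of_nat (Suc m) * of_nat (Suc n) * c * z ^ m * cnj z ^ n))"
proof -
  define M where "M = complex_of_nat (Suc m)"
  define N where "N = complex_of_nat (Suc n)"
  define g where "g = (\<lambda>z. cnj (c * M) * (z ^ Suc n * cnj z ^ m) + c * N * (z ^ Suc m * cnj z ^ n))"
  \<comment> \<open>\<open>a\<close> and \<open>b\<close> are the derivatives of \<open>g\<close> in
    \<open>z\<close> and \<open>cnj z\<close>; hence the Hessian columns \<open>a + b\<close> and
    \<open>\<i> (a - b)\<close> and the Laplacian \<open>2 Re a\<close>.\<close>
  define a where "a = (\<lambda>z. cnj (c * M) * (N * (z ^ n * cnj z ^ m)) + c * N * (M * (z ^ m * cnj z ^ n)))"
  define b where "b = (\<lambda>z. cnj (c * M) * (of_nat m * (z ^ Suc n * cnj z ^ (m - 1))) + c * N * (of_nat n * (z ^ Suc m * cnj z ^ (n - 1))))"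
  have cM: "cnj M = M" "cnj N = N" by (simp_all add: M_def N_def)
  have gd: "(g has_derivative (\<lambda>h. a z * h + b z * cnj h)) (at z)" for z
  proof -
    have "(g has_derivative (\<lambda>h. cnj (c * M) * (of_nat (Suc n) * (z ^ (Suc n - 1) * cnj z ^ m) * h + of_nat m * (z ^ Suc n * cnj z ^ (m - 1)) * cnj h)
      + c * N * (of_nat (Suc m) * (z ^ (Suc m - 1) * cnj z ^ n) * h + of_nat n * (z ^ Suc m * cnj z ^ (n - 1)) * cnj h))) (at z)"
      unfolding g_def by (intro has_derivative_add has_derivative_mult_right zmonom_derivative)
    then show ?thesis by (rule has_derivative_eq_rhs) (simp add: a_def b_def M_def N_def algebra_simps)
  qed
  have "c2_on S (\<lambda>z. Re (c * z ^ Suc m * cnj z ^ Suc n)) g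
     (\<lambda>z. Re (4 * of_nat (Suc m) * of_nat (Suc n) * c * z ^ m * cnj z ^ n))"
  proof (rule c2_onI[where gx="\<lambda>z. a z + b z" and gy="\<lambda>z. \<i> * (a z - b z)"])
    show "continuous_on S (\<lambda>z. a z + b z)" "continuous_on S (\<lambda>z. \<i> * (a z - b z))"
      unfolding a_def b_def by (intro continuous_intros)+
    fix z
    have "((\<lambda>z. Re (c * (z ^ Suc m * cnj z ^ Suc n))) has_derivative
       (\<lambda>h. Re (c * (of_nat (Suc m) * (z ^ (Suc m - 1) * cnj z ^ Suc n) * h + of_nat (Suc n) * (z ^ Suc m * cnj z ^ (Suc n - 1)) * cnj h)))) (at z)"
      by (intro has_derivative_Re has_derivative_mult_right zmonom_derivative)
    moreover have "Re (c * (of_nat (Suc m) * (z ^ (Suc m - 1) * cnj z ^ Suc n) * h + of_nat (Suc n) * (z ^ Suc m * cnj z ^ (Suc n - 1)) * cnj h)) = g z \<bullet> h" for h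
    proof -
      have "Re (c * (of_nat (Suc m) * (z ^ (Suc m - 1) * cnj z ^ Suc n) * h + of_nat (Suc n) * (z ^ Suc m * cnj z ^ (Suc n - 1)) * cnj h))
        = Re ((c * M) * (z ^ m * cnj z ^ Suc n) * h) + Re (c * N * (z ^ Suc m * cnj z ^ n) * cnj h)"
        by (simp add: M_def N_def algebra_simps)
      also have "Re ((c * M) * (z ^ m * cnj z ^ Suc n) * h) = Re (cnj ((c * M) * (z ^ m * cnj z ^ Suc n)) * cnj h)"
        by (metis cnj.simps(1) complex_cnj_mult)
      also have "\<dots> + Re (c * N * (z ^ Suc m * cnj z ^ n) * cnj h) = Re (g z * cnj h)"
        unfolding g_def by (simp only: complex_cnj_mult complex_cnj_power complex_cnj_cnj distrib_right distrib_left plus_complex.simps(1) mult_ac)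
      also have "\<dots> = g z \<bullet> h" by (simp add: inner_complex_def)
      finally show ?thesis .
    qed
    ultimately show "((\<lambda>z. Re (c * z ^ Suc m * cnj z ^ Suc n)) has_derivative (\<bullet>) (g z)) (at z)"
      by (simp add: mult.assoc)
    show "(g has_derivative (\<lambda>h. Re h *\<^sub>R (a z + b z) + Im h *\<^sub>R (\<i> * (a z - b z)))) (at z)"
      by (rule has_derivative_eq_rhs[OF gd]) (auto simp: complex_eq_iff algebra_simps)
    have e: "a z = cnj (c * M * N * (z ^ m * cnj z ^ n)) + c * M * N * (z ^ m * cnj z ^ n)"
      by (simp add: a_def cM mult_ac)
    have "2 * Re (cnj w + w) = Re (4 * w)" for w by simp
    then have "2 * Re (a z) = Re (4 * (c * M * N * (z ^ m * cnj z ^ n)))" unfolding e .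
    also have "4 * (c * M * N * (z ^ m * cnj z ^ n)) = 4 * of_nat (Suc m) * of_nat (Suc n) * c * z ^ m * cnj z ^ n"
      unfolding M_def[symmetric] N_def[symmetric] by (simp only: mult_ac)
    finally show "Re (4 * of_nat (Suc m) * of_nat (Suc n) * c * z ^ m * cnj z ^ n) = Re (a z + b z) + Im (\<i> * (a z - b z))"
      by simp
  qed
  then show ?thesis by blast
qed

text \<open>A monomial is hit by raising both exponents by one and dividing out the factor that the
  Laplacian produces.\<close>

lemma zpoly_laplacian_inverse:
  assumes "zpoly P"
  shows "\<exists>W g. c2_on UNIV W g (\<lambda>z. Re (P z))"
  using assms
proof (induction rule: zpoly.induct)
  case (monom c m n)
  let ?c = "c / (4 * of_nat (Suc m) * of_nat (Suc n))"
  have "4 * of_nat (Suc m) * of_nat (Suc n) * ?c = c"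
    by (simp del: of_nat_Suc)
  then obtain g where "c2_on UNIV (\<lambda>z. Re (?c * z ^ Suc m * cnj z ^ Suc n)) g (\<lambda>z. Re (c * z ^ m * cnj z ^ n))"
    using c2_on_zmonom[of UNIV ?c m n] by (elim exE) (simp only:)
  then show ?case by (intro exI)
next
  case (add P Q)
  then obtain W g W' g' where "c2_on UNIV W g (\<lambda>z. Re (P z))" "c2_on UNIV W' g' (\<lambda>z. Re (Q z))" by blast
  from c2_on_add[OF this] show ?case by auto
qed

text \<open>A monomial in which one variable is absent is holomorphic or antiholomorphic, and in
  either case its real part is that of a holomorphic monomial; the others are covered by
  \<open>c2_on_zmonom\<close>.\<close>

lemma c2_on_zpoly:
  assumes "zpoly P"
  shows "\<exists>g p. c2_on UNIV (\<lambda>z. Re (P z)) g p"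
  using assms
proof (induction rule: zpoly.induct)
  case (monom c m n)
  have hol: "c2_on UNIV (\<lambda>z. Re (a * z ^ k)) (\<lambda>z. cnj (deriv (\<lambda>z. a * z ^ k) z)) (\<lambda>z. 0)" for a k
    by (rule c2_on_Re_holomorphic) (auto intro!: holomorphic_intros)
  consider "n = 0" | "m = 0" | k l where "m = Suc k" "n = Suc l"
    by (metis not0_implies_Suc)
  then show ?case
  proof cases
    case 1
    then show ?thesis using hol[of c m] by auto
  next
    case 2
    have "Re (c * z ^ m * cnj z ^ n) = Re (cnj c * z ^ n)" for z
      using 2 by (metis cnj.simps(1) complex_cnj_cnj complex_cnj_mult complex_cnj_power mult.right_neutral power_0)
    then show ?thesis using hol[of "cnj c" n] by auto
  next
    case 3
    then show ?thesis using c2_on_zmonom[of UNIV c k l] by blast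
  qed
next
  case (add P Q)
  then obtain g p g' p' where "c2_on UNIV (\<lambda>z. Re (P z)) g p" "c2_on UNIV (\<lambda>z. Re (Q z)) g' p'" by blast
  from c2_on_add[OF this] show ?case by auto
qed

section \<open>Harmonic functions on discs\<close>

text \<open>Equal powers of \<open>z\<close> and \<open>cnj z\<close> cancel on the circle. What
  remains is a power of \<open>z\<close>, or one of \<open>cnj z\<close>, whose conjugate has the
  same real part; this gives an explicit harmonic extension to the disc.\<close>

lemma zpoly_on_circle:
  assumes "zpoly P"
  shows "\<exists>q. q holomorphic_on UNIV \<and> (\<forall>z\<in>sphere 0 1. Re (q z) = Re (P z))"
  using assms
proof (induction rule: zpoly.induct)
  case (monom c m n)
  have zz: "z ^ k * cnj z ^ k = 1" if "z \<in> sphere 0 1" for z :: complex and k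
    using that by (simp add: power_mult_distrib[symmetric] complex_norm_square[symmetric])
  show ?case
  proof (cases "n \<le> m")
    case True
    have "Re (c * z ^ (m - n)) = Re (c * z ^ m * cnj z ^ n)" if "z \<in> sphere 0 1" for z
    proof -
      have "z ^ m = z ^ (m - n) * z ^ n"
        using True by (simp flip: power_add)
      then have "c * z ^ m * cnj z ^ n = c * z ^ (m - n) * (z ^ n * cnj z ^ n)"
        by (simp only: mult.assoc mult.commute mult.left_commute)
      then show ?thesis by (simp only: zz[OF that] mult_1_right)
    qed
    then show ?thesis by (intro exI[of _ "\<lambda>z. c * z ^ (m - n)"]) (auto intro!: holomorphic_intros)
  next
    case False
    have "Re (cnj c * z ^ (n - m)) = Re (c * z ^ m * cnj z ^ n)" if "z \<in> sphere 0 1" for z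
    proof -
      have "cnj z ^ n = cnj z ^ (n - m) * cnj z ^ m"
        using False by (simp flip: power_add)
      then have "c * z ^ m * cnj z ^ n = c * cnj z ^ (n - m) * (z ^ m * cnj z ^ m)"
        by (simp only: mult_ac)
      then have "c * z ^ m * cnj z ^ n = cnj (cnj c * z ^ (n - m))"
        by (simp only: zz[OF that] mult_1_right complex_cnj_mult complex_cnj_cnj complex_cnj_power)
      then show ?thesis by (simp only: cnj.simps(1))
    qed
    then show ?thesis by (intro exI[of _ "\<lambda>z. cnj c * z ^ (n - m)"]) (auto intro!: holomorphic_intros)
  qed
next
  case (add P Q)
  then obtain q r where "q holomorphic_on UNIV" "\<forall>z\<in>sphere 0 1. Re (q z) = Re (P z)"
    "r holomorphic_on UNIV" "\<forall>z\<in>sphere 0 1. Re (r z) = Re (Q z)" by blast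
  then show ?case by (intro exI[of _ "\<lambda>z. q z + r z"]) (auto intro!: holomorphic_intros)
qed

text \<open>Exponentiating turns real parts into moduli, to which Montel's theorem applies.\<close>

lemma bounded_harmonic_limit:
  assumes hol: "\<And>n. f n holomorphic_on ball a r"
    and bd: "\<And>n z. z \<in> ball a r \<Longrightarrow> Re (f n z) \<le> M"
    and lim: "\<And>z. z \<in> ball a r \<Longrightarrow> (\<lambda>n. Re (f n z)) \<longlonglongrightarrow> u z"
  shows "\<exists>h. h holomorphic_on ball a r \<and> (\<forall>z\<in>ball a r. u z = Re (h z))"
proof -
  define F where "F = (\<lambda>n z. exp (f n z))"
  obtain g \<sigma> where g: "g holomorphic_on ball a r" "strict_mono (\<sigma> :: nat \<Rightarrow> nat)"
    "\<And>x. x \<in> ball a r \<Longrightarrow> ((\<lambda>n. F (\<sigma> n) x) \<longlonglongrightarrow> g x)"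
  proof (rule Montel[of "ball a r" "range F" F])
    show "h holomorphic_on ball a r" if "h \<in> range F" for h
      using that hol by (auto simp: F_def intro!: holomorphic_intros)
    show "\<exists>B. \<forall>h\<in>range F. \<forall>z\<in>K. cmod (h z) \<le> B" if "compact K" "K \<subseteq> ball a r" for K
      by (rule exI[of _ "exp M"]) (use that bd in \<open>auto simp: F_def\<close>)
  qed auto
  \<comment> \<open>Only a subsequence of the exponentials converges, but its moduli have the limit
    \<open>exp (u z)\<close> known from the full sequence. The limit therefore has no zeros and
    admits a holomorphic logarithm on the disc.\<close>
  have ng: "norm (g z) = exp (u z)" if z: "z \<in> ball a r" for z
  proof (rule LIMSEQ_unique)
    show "(\<lambda>n. norm (F (\<sigma> n) z)) \<longlonglongrightarrow> norm (g z)" by (intro tendsto_norm g(3)[OF z])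
    have "(\<lambda>n. Re (f (\<sigma> n) z)) \<longlonglongrightarrow> u z"
      using LIMSEQ_subseq_LIMSEQ[OF lim[OF z] g(2)] by (simp add: o_def)
    then show "(\<lambda>n. norm (F (\<sigma> n) z)) \<longlonglongrightarrow> exp (u z)"
      unfolding F_def norm_exp_eq_Re by (rule tendsto_exp)
  qed
  have "g z \<noteq> 0" if "z \<in> ball a r" for z using ng[OF that] by auto
  then obtain h where h: "h holomorphic_on ball a r" "\<And>z. z \<in> ball a r \<Longrightarrow> g z = exp (h z)"
    by (rule contractible_imp_holomorphic_log[OF g(1) convex_imp_contractible[OF convex_ball]]) (assumption, rule that)
  have "u z = Re (h z)" if "z \<in> ball a r" for z
    using ng[OF that] h(2)[OF that] by simp
  then show ?thesis using h(1) by blast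
qed

text \<open>After rescaling, polynomial boundary values extend by the entire functions of
  \<open>zpoly_on_circle\<close>, and the maximum principle turns uniform convergence on the circle
  into uniform convergence on the closed disc. \<open>bounded_harmonic_limit\<close> replaces the
  Poisson integral.\<close>

lemma harmonic_disc_dirichlet:
  assumes "continuous_on (sphere a r) u" "r > 0"
  shows "\<exists>v h. continuous_on (cball a r) v \<and> (\<forall>z\<in>sphere a r. v z = u z) \<and>
           h holomorphic_on ball a r \<and> (\<forall>z\<in>ball a r. v z = Re (h z))"
proof -
  define \<rho> where "\<rho> = (\<lambda>n. inverse (real (Suc n)))"
  have \<rho>: "\<rho> n > 0" for n by (simp add: \<rho>_def)
  have \<rho>lim: "\<rho> \<longlonglongrightarrow> 0" unfolding \<rho>_def by (rule LIMSEQ_inverse_real_of_nat)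
  have "\<exists>q. q holomorphic_on UNIV \<and> (\<forall>z\<in>sphere a r. \<bar>Re (q z) - u z\<bar> < e)" if e: "e > 0" for e
  proof -
    have "continuous_on (sphere (0::complex) 1) (\<lambda>z. u (a + r * z))"
      by (rule continuous_on_compose2[OF assms(1)]) (use assms(2) in \<open>auto intro!: continuous_intros simp: dist_norm norm_mult\<close>)
    then obtain P where P: "zpoly P" "\<And>x::complex. x \<in> sphere 0 1 \<Longrightarrow> \<bar>Re (P x) - u (a + r * x)\<bar> < e"
      by (rule zpoly_dense[OF compact_sphere _ e]) (rule that)
    obtain q where q: "q holomorphic_on UNIV" "\<forall>z\<in>sphere 0 1. Re (q z) = Re (P z)"
      using zpoly_on_circle[OF P(1)] by blast
    have "(q \<circ> (\<lambda>z. (z - a) / r)) holomorphic_on UNIV"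
      by (rule holomorphic_on_compose_gen[OF _ q(1)]) (use assms(2) in \<open>auto intro!: holomorphic_intros\<close>)
    then have "(\<lambda>z. q ((z - a) / r)) holomorphic_on UNIV" by (simp add: o_def)
    moreover have "\<bar>Re (q ((z - a) / r)) - u z\<bar> < e" if z: "z \<in> sphere a r" for z
    proof -
      have "(z - a) / r \<in> sphere 0 1" using z assms(2) by (simp add: norm_divide dist_norm norm_minus_commute)
      then show ?thesis using P(2)[of "(z - a) / r"] q(2) assms(2) by simp
    qed
    ultimately show ?thesis by blast
  qed
  then have "\<forall>n. \<exists>q. q holomorphic_on UNIV \<and> (\<forall>z\<in>sphere a r. \<bar>Re (q z) - u z\<bar> < \<rho> n)"
    using \<rho> by simp
  from choice[OF this] obtain q where q: "\<And>n. q n holomorphic_on UNIV"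
    "\<And>n z. z \<in> sphere a r \<Longrightarrow> \<bar>Re (q n z) - u z\<bar> < \<rho> n" by blast
  have qh: "q n holomorphic_on S" for n S by (rule holomorphic_on_subset[OF q(1)]) auto
  have qc: "continuous_on S (\<lambda>z. Re (q n z))" for n S
    by (intro continuous_intros holomorphic_on_imp_continuous_on qh)
  have diff: "\<bar>Re (q n z) - Re (q m z)\<bar> \<le> \<rho> n + \<rho> m" if z: "z \<in> cball a r" for n m z
  proof (cases "z \<in> sphere a r")
    case True
    then show ?thesis using q(2)[OF True, of n] q(2)[OF True, of m] by linarith
  next
    case False
    then have zb: "z \<in> ball a r" using z by auto
    have "\<bar>Re (q n z) - Re (q m z)\<bar> \<le> (\<rho> n + \<rho> m) + 0 * r\<^sup>2 / 4"
    proof (rule poisson_bound[OF open_ball bounded_ball _ _ _ _ ball_subset_cball zb, where V="\<lambda>z. Re (q n z) - Re (q m z)"])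
      show "continuous_on (closure (ball a r)) (\<lambda>z. Re (q n z) - Re (q m z))"
        by (intro continuous_intros qc)
      show "poisson (ball a r) (\<lambda>z. Re (q n z) - Re (q m z)) (\<lambda>z. 0 - 0)"
        by (intro poisson_diff c2_on_imp_poisson[OF c2_on_Re_holomorphic] qh open_ball)
      show "\<bar>Re (q n z) - Re (q m z)\<bar> \<le> \<rho> n + \<rho> m" if "z \<in> frontier (ball a r)" for z
      proof -
        have z: "z \<in> sphere a r" using that assms(2) by simp
        show ?thesis using q(2)[OF z, of n] q(2)[OF z, of m] by linarith
      qed
    qed auto
    then show ?thesis by simp
  qed
  have "uniformly_Cauchy_on (cball a r) (\<lambda>n z. Re (q n z))"
    unfolding uniformly_Cauchy_on_def
  proof (intro allI impI)
    fix e :: real assume "e > 0"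
    then have "e / 2 > 0" by simp
    from order_tendstoD(2)[OF \<rho>lim this] obtain N where N: "\<And>n. n \<ge> N \<Longrightarrow> \<rho> n < e / 2"
      by (auto simp: eventually_sequentially)
    show "\<exists>M. \<forall>x\<in>cball a r. \<forall>m\<ge>M. \<forall>n\<ge>M. dist (Re (q m x)) (Re (q n x)) < e"
    proof (intro exI[of _ N] ballI allI impI)
      fix x m n assume x: "x \<in> cball a r" "m \<ge> N" "n \<ge> N"
      show "dist (Re (q m x)) (Re (q n x)) < e"
        using diff[OF x(1), of m n] N[OF x(2)] N[OF x(3)] by (simp add: dist_real_def)
    qed
  qed
  then obtain v where v: "uniform_limit (cball a r) (\<lambda>n z. Re (q n z)) v sequentially"
    using Cauchy_uniformly_convergent uniformly_convergent_on_def by blast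
  have cv: "continuous_on (cball a r) v"
    by (rule uniform_limit_theorem[OF _ v]) (auto intro!: always_eventually qc)
  have lim: "(\<lambda>n. Re (q n z)) \<longlonglongrightarrow> v z" if "z \<in> cball a r" for z
    using tendsto_uniform_limitI[OF v that] .
  have vu: "v z = u z" if z: "z \<in> sphere a r" for z
  proof (rule LIMSEQ_unique)
    show "(\<lambda>n. Re (q n z)) \<longlonglongrightarrow> v z" using lim z by simp
    show "(\<lambda>n. Re (q n z)) \<longlonglongrightarrow> u z"
    proof (rule LIM_zero_cancel, rule Lim_null_comparison[OF _ \<rho>lim])
      show "\<forall>\<^sub>F n in sequentially. norm (Re (q n z) - u z) \<le> \<rho> n"
        using q(2)[OF z] by (simp add: less_imp_le)
    qed
  qed
  have "compact (v ` cball a r)" by (rule compact_continuous_image[OF cv compact_cball])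
  then have "bounded (v ` cball a r)" by (rule compact_imp_bounded)
  then obtain K where "\<forall>x\<in>v ` cball a r. norm x \<le> K" unfolding bounded_iff by (elim exE)
  then have K: "\<bar>v z\<bar> \<le> K" if "z \<in> cball a r" for z using that by simp
  have "\<exists>h. h holomorphic_on ball a r \<and> (\<forall>z\<in>ball a r. v z = Re (h z))"
  proof (rule bounded_harmonic_limit[where f=q and M="K + 1"])
    show "q n holomorphic_on ball a r" for n by (rule qh)
    show "(\<lambda>n. Re (q n z)) \<longlonglongrightarrow> v z" if "z \<in> ball a r" for z using lim that by simp
    show "Re (q n z) \<le> K + 1" if z: "z \<in> ball a r" for n z
    proof -
      have zc: "z \<in> cball a r" using z by simp
      have "\<bar>Re (q n z) - v z\<bar> \<le> \<rho> n + 0"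
      proof (rule LIMSEQ_le)
        show "(\<lambda>m. \<bar>Re (q n z) - Re (q m z)\<bar>) \<longlonglongrightarrow> \<bar>Re (q n z) - v z\<bar>" by (intro tendsto_intros lim zc)
        show "(\<lambda>m. \<rho> n + \<rho> m) \<longlonglongrightarrow> \<rho> n + 0" by (intro tendsto_intros \<rho>lim)
        show "\<exists>N. \<forall>m\<ge>N. \<bar>Re (q n z) - Re (q m z)\<bar> \<le> \<rho> n + \<rho> m" using diff[OF zc] by blast
      qed
      moreover have "\<rho> n \<le> 1" unfolding \<rho>_def by (simp add: field_simps)
      ultimately show ?thesis using K[OF zc] by linarith
    qed
  qed
  then obtain h where "h holomorphic_on ball a r" "\<forall>z\<in>ball a r. v z = Re (h z)" by (elim exE conjE)
  then show ?thesis using cv vu by (intro exI[of _ v] exI[of _ h] conjI) simp_all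
qed

section \<open>Barriers and harmonic extension\<close>

text \<open>Points of \<open>D\<close> near \<open>z0\<close> lie in the sector around
  \<open>e\<close> of half-angle \<open>pi/2 + arcsin s\<close>, so a cone around \<open>- e\<close>
  is exterior; \<open>s\<close> is the sine of the defect from a half-plane. One radius
  \<open>r\<close> serves all boundary points, which makes the later constants uniform in
  \<open>z0\<close>.\<close>

definition ext_cone :: "complex set \<Rightarrow> real \<Rightarrow> real \<Rightarrow> bool" where
  "ext_cone D s r \<longleftrightarrow> (\<forall>z0\<in>frontier D. \<exists>e. norm e = 1 \<and>
     (\<forall>z\<in>D \<inter> ball z0 r. Re ((z - z0) * cnj e) \<ge> - s * norm (z - z0)))"

lemma Arg_le_of_cone:
  assumes "z \<noteq> 0" "Re z \<ge> - sin \<tau> * norm z" "0 < \<tau>" "\<tau> < pi / 2"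
  shows "\<bar>Arg z\<bar> \<le> pi / 2 + \<tau>" "z \<notin> \<real>\<^sub>\<le>\<^sub>0"
proof -
  have "cos (pi / 2 + \<tau>) * norm z \<le> cos \<bar>Arg z\<bar> * norm z"
  proof -
    have "Re z = norm z * cos (Arg z)"
      using Re_rcis[of "norm z" "Arg z"] by (simp add: rcis_cmod_Arg)
    then show ?thesis using assms(2) by (simp add: cos_add mult.commute)
  qed
  then have "cos (pi / 2 + \<tau>) \<le> cos \<bar>Arg z\<bar>" using assms(1) by simp
  moreover have "\<bar>Arg z\<bar> \<le> pi" using Arg_bounded[of z] by auto
  ultimately show *: "\<bar>Arg z\<bar> \<le> pi / 2 + \<tau>"
    using cos_mono_le_eq[of "pi / 2 + \<tau>" "\<bar>Arg z\<bar>"] assms(3,4) by auto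
  show "z \<notin> \<real>\<^sub>\<le>\<^sub>0"
  proof
    assume "z \<in> \<real>\<^sub>\<le>\<^sub>0"
    then have "Arg z = pi" using assms(1) by (auto simp: complex_nonpos_Reals_iff Arg_eq_pi complex_eq_iff order_less_le)
    then show False using * assms(4) by simp
  qed
qed

text \<open>The power has modulus \<open>|z|^\<beta>\<close> and argument
  \<open>\<beta> Arg z\<close>, and the cosine of the latter stays above
  \<open>cos (\<beta> \<theta>) > 0\<close>.\<close>

lemma Re_power_bounds:
  assumes "z \<noteq> 0" "\<bar>Arg z\<bar> \<le> \<theta>" "0 < \<beta>" "\<beta> * \<theta> < pi / 2"
  shows "cos (\<beta> * \<theta>) * norm z powr \<beta> \<le> Re (exp (of_real \<beta> * Ln z))"
    "\<bar>Re (exp (of_real \<beta> * Ln z))\<bar> \<le> norm z powr \<beta>"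
proof -
  have eq: "Re (exp (of_real \<beta> * Ln z)) = norm z powr \<beta> * cos (\<beta> * Arg z)"
    using assms(1) by (simp add: Re_exp powr_def Arg_eq_Im_Ln)
  have "\<beta> * \<bar>Arg z\<bar> \<le> \<beta> * \<theta>" using assms(2,3) by simp
  then have "cos (\<beta> * \<theta>) \<le> cos (\<beta> * \<bar>Arg z\<bar>)"
    using assms(3,4) pi_gt_zero by (intro cos_monotone_0_pi_le) (auto simp del: pi_gt_zero)
  also have "cos (\<beta> * \<bar>Arg z\<bar>) = cos (\<beta> * Arg z)" by (simp add: abs_if)
  finally show "cos (\<beta> * \<theta>) * norm z powr \<beta> \<le> Re (exp (of_real \<beta> * Ln z))"
    unfolding eq by (metis mult.commute mult_left_mono powr_ge_zero)
  show "\<bar>Re (exp (of_real \<beta> * Ln z))\<bar> \<le> norm z powr \<beta>"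
    unfolding eq abs_mult using abs_cos_le_one[of "\<beta> * Arg z"] by (simp add: mult_left_le)
qed

lemma norm_powr_tendsto_0:
  fixes z0 :: complex
  assumes "0 < \<beta>"
  shows "((\<lambda>z. norm (z - z0) powr \<beta>) \<longlongrightarrow> 0) (at z0 within S)"
proof -
  have "((\<lambda>z. norm (z - z0)) \<longlongrightarrow> norm (z0 - z0)) (at z0 within S)" by (intro tendsto_intros)
  then have "((\<lambda>z. norm (z - z0) powr \<beta>) \<longlongrightarrow> norm (z0 - z0) powr \<beta>) (at z0 within S)"
    by (rule tendsto_powr'[OF _ tendsto_const]) (use assms in auto)
  then show ?thesis by simp
qed

text \<open>After rotation by \<open>cnj e\<close> the set lies in a sector off the negative real
  axis, where the principal power is holomorphic. The lower bound makes it a barrier; the upper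
  bound of the same order lets it measure Hoelder growth.\<close>

lemma barrier:
  assumes "open D" "ext_cone D (sin \<tau>) r" and \<tau>: "0 < \<tau>" "\<tau> < pi / 2"
    and \<beta>: "0 < \<beta>" "\<beta> * (pi / 2 + \<tau>) < pi / 2" and z0: "z0 \<in> frontier D"
  shows "\<exists>w g. c2_on (D \<inter> ball z0 r) w g (\<lambda>_. 0) \<and> continuous_on (closure (D \<inter> ball z0 r)) w \<and>
     (\<forall>z\<in>closure (D \<inter> ball z0 r). cos (\<beta> * (pi / 2 + \<tau>)) * norm (z - z0) powr \<beta> \<le> w z \<and>
        w z \<le> norm (z - z0) powr \<beta>)"
proof -
  obtain e where e: "norm e = 1" "\<And>z. z \<in> D \<inter> ball z0 r \<Longrightarrow> Re ((z - z0) * cnj e) \<ge> - sin \<tau> * norm (z - z0)"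
    using assms(2) z0 unfolding ext_cone_def by blast
  let ?O = "D \<inter> ball z0 r"
  define \<zeta> where "\<zeta> = (\<lambda>z. (z - z0) * cnj e)"
  have n\<zeta>: "norm (\<zeta> z) = norm (z - z0)" for z using e(1) by (simp add: \<zeta>_def norm_mult)
  have z0D: "z0 \<notin> D" using z0 assms(1) by (simp add: frontier_def interior_open)
  have "closed {z. - sin \<tau> * norm (z - z0) \<le> Re (\<zeta> z)}"
    unfolding \<zeta>_def by (intro closed_Collect_le continuous_intros)
  then have "closure ?O \<subseteq> {z. - sin \<tau> * norm (z - z0) \<le> Re (\<zeta> z)}"
    by (rule closure_minimal[rotated]) (use e(2) in \<open>auto simp: \<zeta>_def\<close>)
  then have cone: "- sin \<tau> * norm (\<zeta> z) \<le> Re (\<zeta> z)" if "z \<in> closure ?O" for z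
    using that n\<zeta> by auto
  have arg: "\<bar>Arg (\<zeta> z)\<bar> \<le> pi / 2 + \<tau>" "\<zeta> z \<notin> \<real>\<^sub>\<le>\<^sub>0" "\<zeta> z \<noteq> 0" if "z \<in> closure ?O" "z \<noteq> z0" for z
  proof -
    show nz: "\<zeta> z \<noteq> 0" using that(2) n\<zeta>[of z] by auto
    show "\<bar>Arg (\<zeta> z)\<bar> \<le> pi / 2 + \<tau>" "\<zeta> z \<notin> \<real>\<^sub>\<le>\<^sub>0"
      using Arg_le_of_cone[OF nz cone[OF that(1)] \<tau>] by auto
  qed
  define f where "f = (\<lambda>z. exp (of_real \<beta> * Ln (\<zeta> z)))"
  \<comment> \<open>The value 0 at \<open>z0\<close> is the limit of the power along the sector, not
    a reading of the formula with \<open>Ln 0\<close>.\<close>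
  define w where "w = (\<lambda>z. if z = z0 then 0 else Re (f z))"
  have "f holomorphic_on ?O" unfolding f_def
  proof (intro holomorphic_intros)
    show "\<zeta> holomorphic_on ?O" unfolding \<zeta>_def by (intro holomorphic_intros)
    show "\<zeta> z \<notin> \<real>\<^sub>\<le>\<^sub>0" if "z \<in> ?O" for z
      using arg(2)[OF subsetD[OF closure_subset that]] that z0D by auto
  qed
  moreover have oO: "open ?O" using assms(1) by auto
  ultimately have "c2_on ?O (\<lambda>z. Re (f z)) (\<lambda>z. cnj (deriv f z)) (\<lambda>z. 0)"
    by (rule c2_on_Re_holomorphic)
  then have c2: "c2_on ?O w (\<lambda>z. cnj (deriv f z)) (\<lambda>z. 0)"
    by (rule c2_on_cong[OF _ oO]) (use z0D in \<open>auto simp: w_def\<close>)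
  have lower: "cos (\<beta> * (pi / 2 + \<tau>)) * norm (z - z0) powr \<beta> \<le> w z" and upper: "\<bar>w z\<bar> \<le> norm (z - z0) powr \<beta>"
    if z: "z \<in> closure ?O" for z
  proof -
    show "cos (\<beta> * (pi / 2 + \<tau>)) * norm (z - z0) powr \<beta> \<le> w z"
      using Re_power_bounds(1)[OF arg(3,1)[OF z] \<beta>] by (cases "z = z0") (auto simp: w_def f_def n\<zeta>)
    show "\<bar>w z\<bar> \<le> norm (z - z0) powr \<beta>"
      using Re_power_bounds(2)[OF arg(3,1)[OF z] \<beta>] by (cases "z = z0") (auto simp: w_def f_def n\<zeta>)
  qed
  have "continuous (at z within closure ?O) w" if z: "z \<in> closure ?O" for z
  proof (cases "z = z0")
    case True
    have "(w \<longlongrightarrow> 0) (at z0 within closure ?O)"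
    proof (rule Lim_null_comparison[OF _ norm_powr_tendsto_0[OF \<beta>(1)]])
      show "\<forall>\<^sub>F z in at z0 within closure ?O. norm (w z) \<le> cmod (z - z0) powr \<beta>"
        unfolding eventually_at_topological using upper by auto
    qed
    then show ?thesis using True by (simp add: continuous_within w_def)
  next
    case False
    have "isCont (\<lambda>z. Re (f z)) z"
      unfolding f_def \<zeta>_def
      using arg(2)[OF z False] unfolding \<zeta>_def by (auto intro!: continuous_intros)
    then have "isCont w z \<longleftrightarrow> True"
      by (subst isCont_cong[where g="\<lambda>z. Re (f z)"])
        (use False in \<open>auto simp: w_def eventually_nhds intro!: exI[of _ "- {z0}"]\<close>)
    then show ?thesis by (simp add: continuous_at_imp_continuous_at_within)
  qed
  then have "continuous_on (closure ?O) w" by (simp add: continuous_on_eq_continuous_within)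
  then show ?thesis using c2 lower upper
    by (intro exI[of _ w] exI[of _ "\<lambda>z. cnj (deriv f z)"] conjI ballI) (auto simp: abs_le_iff)
qed

text \<open>The inequality \<open>\<triangle>V \<ge> -B\<close> for merely continuous \<open>V\<close>, expressed by comparison with \<open>C\<^sup>2\<close> functions.\<close>

definition subsol :: "complex set \<Rightarrow> (complex \<Rightarrow> real) \<Rightarrow> real \<Rightarrow> bool" where
  "subsol D V B \<longleftrightarrow> (\<forall>\<Omega> v g q. open \<Omega> \<and> \<Omega> \<subseteq> D \<and> c2_on \<Omega> v g q \<and> (\<forall>z\<in>\<Omega>. q z \<le> - B) \<and>
     continuous_on (closure \<Omega>) v \<and> (\<forall>z\<in>frontier \<Omega>. V z \<le> v z) \<longrightarrow> (\<forall>z\<in>\<Omega>. V z \<le> v z))"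

lemma subsolD:
  assumes "subsol D V B" "open \<Omega>" "\<Omega> \<subseteq> D" "c2_on \<Omega> v g q" "\<And>z. z \<in> \<Omega> \<Longrightarrow> q z \<le> - B"
    "continuous_on (closure \<Omega>) v" "\<And>z. z \<in> frontier \<Omega> \<Longrightarrow> V z \<le> v z" "z \<in> \<Omega>"
  shows "V z \<le> v z"
proof -
  have "open \<Omega> \<and> \<Omega> \<subseteq> D \<and> c2_on \<Omega> v g q \<and> (\<forall>z\<in>\<Omega>. q z \<le> - B) \<and>
     continuous_on (closure \<Omega>) v \<and> (\<forall>z\<in>frontier \<Omega>. V z \<le> v z)"
    using assms by simp
  then have "\<forall>z\<in>\<Omega>. V z \<le> v z"
    using assms(1)[unfolded subsol_def, THEN spec[of _ \<Omega>], THEN spec[of _ v], THEN spec[of _ g], THEN spec[of _ q]]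
    by (rule rev_mp)
  then show ?thesis using assms(8) by simp
qed

lemma poisson_subsol:
  assumes "bounded D" "continuous_on (closure D) V" "poisson D V f" "\<And>z. z \<in> D \<Longrightarrow> f z \<ge> - B"
  shows "subsol D V B"
  unfolding subsol_def
proof (intro allI impI ballI, elim conjE)
  fix \<Omega> v g q z
  assume o: "open \<Omega>" "\<Omega> \<subseteq> D" "c2_on \<Omega> v g q" "\<forall>z\<in>\<Omega>. q z \<le> - B"
     "continuous_on (closure \<Omega>) v" "\<forall>z\<in>frontier \<Omega>. V z \<le> v z" and z: "z \<in> \<Omega>"
  have "V z - v z \<le> 0"
  proof (rule maximum_principle[OF o(1) bounded_subset[OF assms(1) o(2)], where V="\<lambda>z. V z - v z" and a=z])
    show "continuous_on (closure \<Omega>) (\<lambda>z. V z - v z)"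
      by (intro continuous_intros o(5) continuous_on_subset[OF assms(2)] closure_mono o(2))
    show "poisson \<Omega> (\<lambda>z. V z - v z) (\<lambda>z. f z - q z)"
      by (intro poisson_diff c2_on_imp_poisson[OF o(3)] poisson_subset[OF assms(3) o(2)])
    show "0 \<le> f z - q z" if "z \<in> \<Omega>" for z
    proof -
      have "f z \<ge> - B" using assms(4) o(2) that by auto
      then show ?thesis using o(4) that by force
    qed
  qed (use o(6) z in auto)
  then show "V z \<le> v z" by simp
qed

text \<open>On \<open>D \<inter> ball z0 r\<close> the comparison function is
  \<open>V z0 + M w - (B/4) |z - z0|^2\<close>, with Laplacian \<open>- B\<close>. The summands of
  \<open>M\<close> pay for the growth on the frontier of \<open>D\<close>, for the quadratic term by
  \<open>|x|^2 \<le> r^(2-\<beta>) |x|^\<beta>\<close>, and for boundary points at distance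
  \<open>r\<close>; division by \<open>c\<close> offsets the lower bound of the barrier.
  \<open>M\<close> depends on \<open>V\<close> only through \<open>A\<close>, \<open>B\<close> and
  \<open>C\<close>, hence is common to all functions arising by sweeping out.\<close>

lemma subsol_boundary_growth:
  assumes "open D" "ext_cone D (sin \<tau>) r" and r: "r > 0" and \<tau>: "0 < \<tau>" "\<tau> < pi / 2"
    and \<beta>: "0 < \<beta>" "\<beta> < 1" "\<beta> * (pi / 2 + \<tau>) < pi / 2" and z0: "z0 \<in> frontier D"
    and V: "subsol D V B" and B: "B \<ge> 0" and A: "\<And>z. z \<in> closure D \<Longrightarrow> \<bar>V z\<bar> \<le> A"
    and C: "C \<ge> 0" "\<And>z. z \<in> frontier D \<Longrightarrow> V z \<le> V z0 + C * norm (z - z0) powr \<beta>"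
    and z: "z \<in> closure D"
  defines "c \<equiv> cos (\<beta> * (pi / 2 + \<tau>))"
  defines "M \<equiv> (C + B / 4 * r powr (2 - \<beta>) + 2 * A / r powr \<beta>) / c"
  shows "V z \<le> V z0 + M * norm (z - z0) powr \<beta>"
proof -
  have c: "0 < c" "c \<le> 1" unfolding c_def using \<beta> \<tau> by (auto intro!: cos_gt_zero)
  have z0c: "z0 \<in> closure D" using z0 by (simp add: frontier_def)
  have A0: "A \<ge> 0" using A[OF z0c] by simp
  define K where "K = C + B / 4 * r powr (2 - \<beta>) + 2 * A / r powr \<beta>"
  have K: "C \<le> K" "2 * A / r powr \<beta> \<le> K" "0 \<le> K" using A0 B C(1) by (auto simp: K_def)
  have cM: "c * M = K" using c by (simp add: M_def K_def)
  have "K * c \<le> K * 1" using c K(3) by (intro mult_left_mono) auto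
  then have KM: "K \<le> M" using c unfolding M_def K_def[symmetric] by (simp add: pos_le_divide_eq)
  then have M0: "M \<ge> 0" using K by simp
  \<comment> \<open>From distance \<open>r\<close> on, the trivial bound \<open>2 A\<close> is
    already below \<open>M |z - z0|^\<beta>\<close>.\<close>
  have far: "V z \<le> V z0 + M * norm (z - z0) powr \<beta>" if "z \<in> closure D" "norm (z - z0) \<ge> r" for z
  proof -
    have "2 * A = 2 * A / r powr \<beta> * r powr \<beta>" using r by simp
    also have "\<dots> \<le> M * norm (z - z0) powr \<beta>"
      using K KM that(2) r \<beta> M0 by (intro mult_mono powr_mono2) auto
    finally show ?thesis using A[OF that(1)] A[OF z0c] by linarith
  qed
  let ?O = "D \<inter> ball z0 r"
  have oO: "open ?O" using assms(1) by auto
  show ?thesis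
  proof (cases "z \<in> ?O")
    case True
    obtain w g where w: "c2_on ?O w g (\<lambda>_. 0)" "continuous_on (closure ?O) w"
      "\<forall>z\<in>closure ?O. c * norm (z - z0) powr \<beta> \<le> w z \<and> w z \<le> norm (z - z0) powr \<beta>"
      using barrier[OF assms(1,2) \<tau> \<beta>(1,3) z0] unfolding c_def[symmetric] by (elim exE conjE) (rule that)
    define v where "v = (\<lambda>z. (V z0 + M * w z) + (- B / 4) * (norm (z - z0))\<^sup>2)"
    have c2v: "c2_on ?O v (\<lambda>z. (0 + M *\<^sub>R g z) + (- B / 4) *\<^sub>R (2 *\<^sub>R (z - z0))) (\<lambda>z. (0 + M * 0) + (- B / 4) * 4)"
      unfolding v_def by (intro c2_on_add c2_on_const c2_on_scale w(1) c2_on_norm_square)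
    have wM: "K * norm (z - z0) powr \<beta> \<le> M * w z" if "z \<in> closure ?O" for z
      using mult_left_mono[OF conjunct1[OF bspec[OF w(3) that]] M0] by (simp add: cM[symmetric] mult_ac)
    have "V z \<le> v z"
    proof (rule subsolD[OF V oO _ c2v _ _ _ True])
      show "continuous_on (closure ?O) v"
        unfolding v_def by (intro continuous_intros w(2))
      fix y assume y: "y \<in> frontier ?O"
      then have yc: "y \<in> closure ?O" by (simp add: frontier_def)
      have yD: "y \<in> closure D" using yc closure_mono[of ?O D] by auto
      have "closure ?O \<subseteq> cball z0 r" by (rule closure_minimal) auto
      then have yr: "norm (y - z0) \<le> r" using yc by (auto simp: dist_norm norm_minus_commute)
      have sq: "(norm (y - z0))\<^sup>2 \<le> r powr (2 - \<beta>) * norm (y - z0) powr \<beta>"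
      proof (cases "y = z0")
        case False
        then have "(norm (y - z0))\<^sup>2 = norm (y - z0) powr (2 - \<beta>) * norm (y - z0) powr \<beta>"
          by (simp add: powr_add[symmetric] powr_numeral)
        also have "\<dots> \<le> r powr (2 - \<beta>) * norm (y - z0) powr \<beta>"
          using yr \<beta> by (intro mult_right_mono powr_mono2) auto
        finally show ?thesis .
      qed simp
      have vy: "V z0 + (C + 2 * A / r powr \<beta>) * norm (y - z0) powr \<beta> \<le> v y"
      proof -
        have "(B / 4) * (norm (y - z0))\<^sup>2 \<le> (B / 4) * (r powr (2 - \<beta>) * norm (y - z0) powr \<beta>)"
          using B by (intro mult_left_mono sq) auto
        then show ?thesis using wM[OF yc] by (simp add: v_def K_def algebra_simps)
      qed
      show "V y \<le> v y"
      proof (cases "y \<in> frontier D")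
        case True
        have "C * norm (y - z0) powr \<beta> \<le> (C + 2 * A / r powr \<beta>) * norm (y - z0) powr \<beta>"
          using A0 by (intro mult_right_mono) auto
        then show ?thesis using C(2)[OF True] vy by linarith
      next
        case False
        then have "y \<in> D" using yD assms(1) by (simp add: frontier_def interior_open)
        moreover have "y \<notin> ?O" using y oO frontier_disjoint_eq[of ?O] by blast
        ultimately have "norm (y - z0) = r" using yr by (auto simp: dist_norm norm_minus_commute)
        then have "2 * A \<le> (C + 2 * A / r powr \<beta>) * norm (y - z0) powr \<beta>"
          using r C(1) by (simp add: distrib_right)
        then show ?thesis using vy A[OF yD] A[OF z0c] by linarith
      qed
    qed auto
    also have "v z \<le> V z0 + M * w z" using B by (simp add: v_def)
    finally have Vw: "V z \<le> V z0 + M * w z" .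
    have "z \<in> closure ?O" by (rule subsetD[OF closure_subset True])
    then have "M * w z \<le> M * norm (z - z0) powr \<beta>" using w(3) M0 by (intro mult_left_mono) auto
    then show ?thesis using Vw by linarith
  next
    case False
    show ?thesis
    proof (cases "z \<in> D")
      case True
      then show ?thesis using far[OF z] False by (auto simp: dist_norm norm_minus_commute)
    next
      case zD: False
      then have "z \<in> frontier D" using z assms(1) by (simp add: frontier_def interior_open)
      moreover have "C * norm (z - z0) powr \<beta> \<le> M * norm (z - z0) powr \<beta>"
        using K KM by (intro mult_right_mono) auto
      ultimately show ?thesis using C(2)[of z] by linarith
    qed
  qed
qed

section \<open>Sweeping out\<close>

text \<open>A subharmonic function lies below the harmonic function with its values on the circle,
  so the replacement only increases it. It stays subharmonic because a comparison on \<Omega> can be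
  split at the circle.\<close>

lemma harmonic_replacement:
  assumes D: "open D" and u: "subsol D u 0" "continuous_on (closure D) u"
    and r: "r > 0" and sub: "cball a r \<subseteq> D"
  shows "\<exists>u'. subsol D u' 0 \<and> continuous_on (closure D) u' \<and> (\<forall>z. u z \<le> u' z) \<and>
     (\<forall>z. z \<notin> D \<longrightarrow> u' z = u z) \<and>
     (\<exists>h. h holomorphic_on ball a r \<and> (\<forall>z\<in>ball a r. u' z = Re (h z)))"
proof -
  have cD: "cball a r \<subseteq> closure D" using sub closure_subset by blast
  have "continuous_on (sphere a r) u"
    by (rule continuous_on_subset[OF u(2)]) (use cD in auto)
  from harmonic_disc_dirichlet[OF this r] obtain v h where v: "continuous_on (cball a r) v"
    "\<forall>z\<in>sphere a r. v z = u z" and h: "h holomorphic_on ball a r" "\<forall>z\<in>ball a r. v z = Re (h z)"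
    by (elim exE conjE) (rule that)
  define u' where "u' = (\<lambda>z. if z \<in> cball a r then v z else u z)"
  have out: "u' z = u z" if "z \<notin> ball a r" for z
    using that v(2) by (auto simp: u'_def)
  have inn: "u' z = Re (h z)" if "z \<in> ball a r" for z
    using that h(2) by (auto simp: u'_def)
  have c2: "c2_on (ball a r) u' (\<lambda>z. cnj (deriv h z)) (\<lambda>_. 0)"
    by (rule c2_on_cong[OF c2_on_Re_holomorphic[OF h(1) open_ball] open_ball]) (use inn in auto)
  have cu': "continuous_on (closure D) u'"
  proof -
    have "continuous_on (cball a r \<union> (closure D - ball a r)) u'"
      unfolding u'_def
    proof (rule continuous_on_cases[OF closed_cball _ v(1)])
      show "closed (closure D - ball a r)" by (intro closed_Diff) auto
      show "continuous_on (closure D - ball a r) u" by (rule continuous_on_subset[OF u(2)]) auto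
      show "\<forall>x. x \<in> cball a r \<and> x \<notin> cball a r \<or> x \<in> closure D - ball a r \<and> x \<in> cball a r \<longrightarrow> v x = u x"
        using v(2) by auto
    qed
    moreover have "cball a r \<union> (closure D - ball a r) = closure D" using cD by auto
    ultimately show ?thesis by simp
  qed
  have ge: "u z \<le> u' z" for z
  proof (cases "z \<in> ball a r")
    case True
    show ?thesis
    proof (rule subsolD[OF u(1) open_ball _ c2 _ _ _ True])
      show "ball a r \<subseteq> D" using sub by auto
      show "continuous_on (closure (ball a r)) u'" using r continuous_on_subset[OF cu' cD] by simp
      show "u z \<le> u' z" if "z \<in> frontier (ball a r)" for z using that r out by simp
    qed auto
  qed (use out in simp)
  have "subsol D u' 0"
    unfolding subsol_def
  proof (intro allI impI, elim conjE)
    fix \<Omega> w g q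
    assume o: "open \<Omega>" "\<Omega> \<subseteq> D" "c2_on \<Omega> w g q" "\<forall>z\<in>\<Omega>. q z \<le> - 0"
      "continuous_on (closure \<Omega>) w" "\<forall>z\<in>frontier \<Omega>. u' z \<le> w z"
    \<comment> \<open>Comparison for the old \<open>u\<close> on all of \<Omega>. It supplies
      \<open>u' \<le> w\<close> on the arcs of the circle inside \<Omega>, where
      \<open>u' = u\<close>; the remaining frontier of \<open>\<Omega> \<inter> ball a r\<close>
      lies on the frontier of \<Omega>.\<close>
    have uw: "u z \<le> w z" if "z \<in> \<Omega>" for z
      by (rule subsolD[OF u(1) o(1,2,3) _ o(5) _ that]) (use o(4,6) order_trans[OF ge] in auto)
    show "\<forall>z\<in>\<Omega>. u' z \<le> w z"
    proof
      fix z assume z: "z \<in> \<Omega>"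
      show "u' z \<le> w z"
      proof (cases "z \<in> ball a r")
        case True
        let ?O = "\<Omega> \<inter> ball a r"
        have "u' z - w z \<le> 0"
        proof (rule maximum_principle[of ?O "\<lambda>z. u' z - w z" "\<lambda>z. 0 - q z"])
          show "open ?O" "bounded ?O" using o(1) by (auto intro: bounded_subset[OF bounded_ball])
          show "continuous_on (closure ?O) (\<lambda>z. u' z - w z)"
            by (intro continuous_intros continuous_on_subset[OF cu'] continuous_on_subset[OF o(5)] closure_mono) (use o(2) in auto)
          show "poisson ?O (\<lambda>z. u' z - w z) (\<lambda>z. 0 - q z)"
            by (intro poisson_diff c2_on_imp_poisson[OF c2_on_subset[OF c2]] c2_on_imp_poisson[OF c2_on_subset[OF o(3)]]) auto
          show "0 \<le> 0 - q z" if "z \<in> ?O" for z using o(4) that by auto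
          fix y assume y: "y \<in> frontier ?O"
          have "y \<in> closure ?O" "y \<notin> ?O"
            using y frontier_disjoint_eq[of ?O] \<open>open ?O\<close> by (simp add: frontier_def, blast)
          then have "y \<in> closure \<Omega>" using closure_mono[of ?O \<Omega>] by auto
          have "u' y \<le> w y"
          proof (cases "y \<in> \<Omega>")
            case True
            then have "y \<notin> ball a r" using \<open>y \<notin> ?O\<close> by auto
            then show ?thesis using out uw[OF True] by simp
          next
            case False
            then show ?thesis using \<open>y \<in> closure \<Omega>\<close> o(1,6) by (simp add: frontier_def interior_open)
          qed
          then show "u' y - w y \<le> 0" by simp
        qed (use z True in auto)
        then show ?thesis by simp
      qed (use out uw[OF z] in simp)
    qed
  qed
  moreover have "\<forall>z. z \<notin> D \<longrightarrow> u' z = u z"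
    using out sub ball_subset_cball[of a r] by blast
  ultimately show ?thesis using cu' ge h(1) inn
    by (intro exI[of _ u'] conjI exI[of _ h]) simp_all
qed

lemma c2_on_lipschitz:
  assumes "c2_on UNIV u g q" "bounded S"
  shows "\<exists>L\<ge>0. \<forall>x\<in>S. \<forall>y\<in>S. \<bar>u x - u y\<bar> \<le> L * norm (x - y)"
proof -
  obtain R where "\<forall>x\<in>S. norm x \<le> R" using assms(2) unfolding bounded_iff by (elim exE)
  then have R: "S \<subseteq> cball 0 R" by auto
  have "continuous_on (cball 0 R) g"
    using c2_on_continuous(2)[OF assms(1)] by (rule continuous_on_subset) auto
  then have "bounded (g ` cball 0 R)" by (intro compact_imp_bounded compact_continuous_image) auto
  then obtain L where L: "L > 0" "\<And>z. z \<in> cball 0 R \<Longrightarrow> norm (g z) \<le> L"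
    unfolding bounded_pos by auto
  have "norm (u x - u y) \<le> L * norm (x - y)" if "x \<in> S" "y \<in> S" for x y
  proof (rule differentiable_bound[of "cball 0 R" u "\<lambda>z h. g z \<bullet> h"])
    show "(u has_derivative (\<bullet>) (g z)) (at z within cball 0 R)" for z
      using c2_on_gradient[OF assms(1)] by (simp add: has_derivative_at_withinI)
    fix z :: complex assume z: "z \<in> cball 0 R"
    have "norm (g z \<bullet> h) \<le> L * norm h" for h
      using Cauchy_Schwarz_ineq2[of "g z" h] mult_right_mono[OF L(2)[OF z], of "norm h"] by simp
    then show "onorm ((\<bullet>) (g z)) \<le> L" by (intro onorm_bound) (use L in auto)
  qed (use that R in auto)
  then show ?thesis using L(1) by (intro exI[of _ L]) auto
qed

text \<open>Countability serves twice: to enumerate the replacement discs, and to unite exceptional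
  null sets when weak gradients are localised.\<close>

lemma countable_ball_cover:
  assumes "open D" "D \<noteq> {}"
  obtains a :: "nat \<Rightarrow> complex" and \<rho> where "\<And>i. \<rho> i > 0" "\<And>i. cball (a i) (\<rho> i) \<subseteq> D"
    "\<And>z. z \<in> D \<Longrightarrow> \<exists>i. z \<in> ball (a i) (\<rho> i)"
proof -
  define \<F> where "\<F> = {ball a r |a r. r > 0 \<and> cball a r \<subseteq> D}"
  have UF: "\<Union>\<F> = D"
  proof
    show "\<Union>\<F> \<subseteq> D" by (force simp: \<F>_def)
    show "D \<subseteq> \<Union>\<F>"
    proof
      fix z assume "z \<in> D"
      then obtain e where "e > 0" "cball z e \<subseteq> D" using assms(1) open_contains_cball by blast
      then show "z \<in> \<Union>\<F>" unfolding \<F>_def by (auto intro!: exI[of _ "ball z e"] exI[of _ z] exI[of _ e])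
    qed
  qed
  obtain \<F>' where F': "\<F>' \<subseteq> \<F>" "countable \<F>'" "\<Union>\<F>' = \<Union>\<F>"
    using Lindelof[of \<F>] unfolding \<F>_def by (smt (verit) mem_Collect_eq open_ball)
  have ne: "\<F>' \<noteq> {}" using F'(3) UF assms(2) by auto
  have "\<forall>i. \<exists>a r. from_nat_into \<F>' i = ball a r \<and> r > 0 \<and> cball a r \<subseteq> D"
  proof
    fix i
    have "from_nat_into \<F>' i \<in> \<F>" using from_nat_into[OF ne] F'(1) by auto
    then show "\<exists>a r. from_nat_into \<F>' i = ball a r \<and> r > 0 \<and> cball a r \<subseteq> D" unfolding \<F>_def by blast
  qed
  from choice[OF this] obtain a where "\<forall>i. \<exists>r. from_nat_into \<F>' i = ball (a i) r \<and> r > 0 \<and> cball (a i) r \<subseteq> D"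
    by (elim exE)
  from choice[OF this] obtain \<rho> where ball: "\<And>i. from_nat_into \<F>' i = ball (a i) (\<rho> i)" "\<And>i. \<rho> i > 0"
    "\<And>i. cball (a i) (\<rho> i) \<subseteq> D" by auto
  have "\<exists>i. z \<in> ball (a i) (\<rho> i)" if "z \<in> D" for z
  proof -
    obtain B where "B \<in> \<F>'" "z \<in> B" using \<open>z \<in> D\<close> unfolding UF[symmetric] F'(3)[symmetric] by (rule UnionE)
    then show ?thesis using from_nat_into_surj[OF F'(2)] ball(1) by metis
  qed
  then show thesis by (rule that[OF ball(2,3)])
qed

text \<open>
  Poincare's method of sweeping out: the subharmonic function \<open>u0\<close> is replaced by harmonic
  functions in the discs of a countable cover, each disc being visited infinitely often.
\<close>

lemma harmonic_extension_subharmonic: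
  assumes D: "open D" "bounded D" and cone: "ext_cone D (sin \<tau>) r" "r > 0" "0 < \<tau>" "\<tau> < pi / 2"
    and \<beta>: "0 < \<beta>" "\<beta> < 1" "\<beta> * (pi / 2 + \<tau>) < pi / 2"
    and u0: "c2_on UNIV u0 g0 q0" "\<And>z. z \<in> D \<Longrightarrow> q0 z \<ge> 0"
  shows "\<exists>u g. continuous_on (closure D) u \<and> (\<forall>z\<in>frontier D. u z = u0 z) \<and> c2_on D u g (\<lambda>_. 0)"
proof (cases "D = {}")
  case True
  then show ?thesis by (intro exI[of _ u0]) (auto simp: c2_on_def)
next
  case False
  obtain a :: "nat \<Rightarrow> complex" and \<rho> where ball: "\<And>i. \<rho> i > 0" "\<And>i. cball (a i) (\<rho> i) \<subseteq> D"
    and cover: "\<And>z. z \<in> D \<Longrightarrow> \<exists>i. z \<in> ball (a i) (\<rho> i)"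
    by (rule countable_ball_cover[OF D(1) False]) (rule that)
  define good where "good = (\<lambda>u. subsol D u 0 \<and> continuous_on (closure D) u \<and> (\<forall>z. z \<notin> D \<longrightarrow> u z = u0 z) \<and> (\<forall>z. u0 z \<le> u z))"
  \<comment> \<open>The disc treated at time \<open>n\<close> is indexed by the first component of
    \<open>prod_decode n\<close>, so every index occurs infinitely often.\<close>
  define step where "step = (\<lambda>(n::nat) (u::complex \<Rightarrow> real) u'. (\<forall>z. u z \<le> u' z) \<and>
     (let i = fst (prod_decode n) in \<exists>h. h holomorphic_on ball (a i) (\<rho> i) \<and> (\<forall>z\<in>ball (a i) (\<rho> i). u' z = Re (h z))))"
  have cu0: "continuous_on S u0" for S
    using c2_on_continuous(1)[OF u0(1)] by (rule continuous_on_subset) auto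
  have good0: "good u0"
    unfolding good_def
    using poisson_subsol[OF D(2) cu0 poisson_subset[OF c2_on_imp_poisson[OF u0(1)]], of 0] u0(2) cu0 by auto
  have "\<exists>U. \<forall>n. good (U n) \<and> step n (U n) (U (Suc n))"
  proof (rule dependent_nat_choice)
    show "\<exists>u. good u" using good0 by blast
    fix u n assume "good u"
    then have u: "subsol D u 0" "continuous_on (closure D) u" "\<forall>z. z \<notin> D \<longrightarrow> u z = u0 z" "\<forall>z. u0 z \<le> u z"
      by (simp_all add: good_def)
    obtain u' where "subsol D u' 0" "continuous_on (closure D) u'" "\<forall>z. u z \<le> u' z"
     "\<forall>z. z \<notin> D \<longrightarrow> u' z = u z" and h: "\<exists>h. h holomorphic_on ball (a (fst (prod_decode n))) (\<rho> (fst (prod_decode n))) \<and> (\<forall>z\<in>ball (a (fst (prod_decode n))) (\<rho> (fst (prod_decode n))). u' z = Re (h z))"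
      using harmonic_replacement[OF D(1) u(1,2) ball] by blast
    then show "\<exists>u'. good u' \<and> step n u u'"
      using u(3,4) by (intro exI[of _ u']) (auto simp: good_def step_def Let_def intro: order_trans)
  qed
  then obtain U where U: "\<And>n. good (U n)" "\<And>n. step n (U n) (U (Suc n))" by blast
  have inc: "incseq (\<lambda>n. U n z)" for z
    by (rule incseq_SucI) (use U(2) in \<open>simp add: step_def\<close>)
  have low: "u0 z \<le> U n z" for n z using U(1)[of n] by (simp add: good_def)
  have out: "U n z = u0 z" if "z \<notin> D" for n z using U(1)[of n] that by (simp add: good_def)
  have "bounded (u0 ` closure D)"
    using D(2) by (intro compact_imp_bounded compact_continuous_image cu0) simp
  then obtain A where A: "\<And>z. z \<in> closure D \<Longrightarrow> \<bar>u0 z\<bar> \<le> A" unfolding bounded_iff by auto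
  have up: "U n z \<le> A" if z: "z \<in> closure D" for n z
  proof (cases "z \<in> D")
    case True
    have fr: "w \<in> closure D" "w \<notin> D" if "w \<in> frontier D" for w
      using that D(1) by (auto simp: frontier_def interior_open)
    have "subsol D (U n) 0" using U(1)[of n] by (simp add: good_def)
    from subsolD[OF this D(1) order_refl c2_on_const[of _ A] _ _ _ True] show ?thesis
      using fr A out by (fastforce simp: abs_le_iff)
  next
    case False
    then show ?thesis using out A[OF z] by (auto simp: abs_le_iff)
  qed
  have AU: "\<bar>U n z\<bar> \<le> A" if "z \<in> closure D" for n z
    using up[OF that, of n] low[of z n] A[OF that] by linarith
  define u where "u = (\<lambda>z. lim (\<lambda>n. U n z))"
  have lim: "(\<lambda>n. U n z) \<longlonglongrightarrow> u z" if z: "z \<in> closure D" for z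
  proof -
    obtain l where "(\<lambda>n. U n z) \<longlonglongrightarrow> l"
      using incseq_convergent[OF inc, of z A] up[OF z] by blast
    then show ?thesis unfolding u_def by (simp add: limI)
  qed
  have loc: "\<exists>h. h holomorphic_on ball (a i) (\<rho> i) \<and> (\<forall>z\<in>ball (a i) (\<rho> i). u z = Re (h z))" for i
  proof -
    \<comment> \<open>The times at which disc \<open>i\<close> is treated; the function harmonic
      there is the result of the step, hence \<open>Suc\<close>.\<close>
    define \<sigma> where "\<sigma> = (\<lambda>k. prod_encode (i, k))"
    have "\<forall>k. \<exists>h. h holomorphic_on ball (a i) (\<rho> i) \<and> (\<forall>z\<in>ball (a i) (\<rho> i). U (Suc (\<sigma> k)) z = Re (h z))"
    proof
      fix k
      have "fst (prod_decode (\<sigma> k)) = i" by (simp add: \<sigma>_def)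
      then show "\<exists>h. h holomorphic_on ball (a i) (\<rho> i) \<and> (\<forall>z\<in>ball (a i) (\<rho> i). U (Suc (\<sigma> k)) z = Re (h z))"
        using U(2)[of "\<sigma> k"] by (simp add: step_def Let_def)
    qed
    from choice[OF this] obtain h where h: "\<And>k. h k holomorphic_on ball (a i) (\<rho> i)"
      "\<And>k z. z \<in> ball (a i) (\<rho> i) \<Longrightarrow> U (Suc (\<sigma> k)) z = Re (h k z)" by blast
    have sub: "z \<in> closure D" if "z \<in> ball (a i) (\<rho> i)" for z
      using that ball(2)[of i] closure_subset[of D] by force
    have tends: "filterlim (\<lambda>k. Suc (\<sigma> k)) sequentially sequentially"
      by (rule filterlim_at_top_mono[OF filterlim_ident])
        (auto intro!: always_eventually le_SucI simp: \<sigma>_def le_prod_encode_2)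
    show ?thesis
    proof (rule bounded_harmonic_limit[OF h(1), where M=A])
      fix z assume z: "z \<in> ball (a i) (\<rho> i)"
      show "Re (h n z) \<le> A" for n using up[OF sub[OF z], of "Suc (\<sigma> n)"] h(2)[OF z] by simp
      have "(\<lambda>k. U (Suc (\<sigma> k)) z) \<longlonglongrightarrow> u z"
        by (rule filterlim_compose[OF lim[OF sub[OF z]] tends])
      then show "(\<lambda>k. Re (h k z)) \<longlonglongrightarrow> u z" using h(2)[OF z] by simp
    qed
  qed
  have "\<exists>g. c2_on D u g (\<lambda>_. 0)"
  proof (rule c2_on_local[OF D(1)])
    fix z assume "z \<in> D"
    then obtain i where i: "z \<in> ball (a i) (\<rho> i)" using cover by blast
    obtain h where h: "h holomorphic_on ball (a i) (\<rho> i)" "\<And>z. z \<in> ball (a i) (\<rho> i) \<Longrightarrow> u z = Re (h z)"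
      using loc by blast
    have "c2_on (ball (a i) (\<rho> i)) u (\<lambda>z. cnj (deriv h z)) (\<lambda>_. 0)"
      by (rule c2_on_cong[OF c2_on_Re_holomorphic[OF h(1) open_ball] open_ball]) (use h in auto)
    then show "\<exists>N g. open N \<and> z \<in> N \<and> c2_on N u g (\<lambda>_. 0)"
      using i by (intro exI[of _ "ball (a i) (\<rho> i)"] exI[of _ "\<lambda>z. cnj (deriv h z)"]) simp
  qed
  then obtain g where g: "c2_on D u g (\<lambda>_. 0)" by blast
  have bd: "u z = u0 z" if z: "z \<in> frontier D" for z
  proof -
    have zz: "z \<in> closure D" "z \<notin> D" using z D(1) by (auto simp: frontier_def interior_open)
    from lim[OF zz(1)] have "(\<lambda>n. u0 z) \<longlonglongrightarrow> u z" unfolding out[OF zz(2)] .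
    then show ?thesis using LIMSEQ_unique tendsto_const by blast
  qed
  have "continuous (at z0 within closure D) u" if z0: "z0 \<in> closure D" for z0
  proof (cases "z0 \<in> D")
    case True
    have "isCont u z0"
      using c2_on_continuous(1)[OF g] True D(1) by (simp add: continuous_on_eq_continuous_at)
    then show ?thesis by (simp add: continuous_at_imp_continuous_at_within)
  next
    case False
    then have z0f: "z0 \<in> frontier D" using z0 D(1) by (simp add: frontier_def interior_open)
    obtain L where L: "L \<ge> 0" "\<And>x y. x \<in> closure D \<Longrightarrow> y \<in> closure D \<Longrightarrow> \<bar>u0 x - u0 y\<bar> \<le> L * norm (x - y)"
      using c2_on_lipschitz[OF u0(1) bounded_closure[OF D(2)]] by blast
    define d where "d = diameter (closure D)"
    \<comment> \<open>The Lipschitz bound for \<open>u0\<close> is turned into growth of order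
      \<beta> by means of the diameter \<open>d\<close>.\<close>
    define C where "C = L * d powr (1 - \<beta>)"
    define M where "M = (C + 0 / 4 * r powr (2 - \<beta>) + 2 * A / r powr \<beta>) / cos (\<beta> * (pi / 2 + \<tau>))"
    have C: "u0 z \<le> u0 z0 + C * norm (z - z0) powr \<beta>" if z: "z \<in> frontier D" for z
    proof (cases "z = z0")
      case False
      have zc: "z \<in> closure D" using z by (simp add: frontier_def)
      have "norm (z - z0) \<le> d"
        using diameter_bounded_bound[OF bounded_closure[OF D(2)] zc z0] by (simp add: d_def dist_norm)
      have "norm (z - z0) = norm (z - z0) powr (1 - \<beta>) * norm (z - z0) powr \<beta>"
        using False by (simp add: powr_add[symmetric])
      also have "\<dots> \<le> d powr (1 - \<beta>) * norm (z - z0) powr \<beta>"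
        using \<beta> \<open>norm (z - z0) \<le> d\<close> by (intro mult_right_mono powr_mono2) auto
      finally have "L * norm (z - z0) \<le> C * norm (z - z0) powr \<beta>"
        unfolding C_def using L(1) by (metis mult.assoc mult_left_mono)
      then show ?thesis using L(2)[OF zc z0] by linarith
    qed simp
    \<comment> \<open>The iterates share their boundary values, the bound \<open>A\<close> and the
      property \<open>subsol\<close>, so the growth bound at \<open>z0\<close> is uniform in
      \<open>n\<close> and survives the limit. From below, \<open>u0\<close> itself squeezes the
      limit.\<close>
    have upper: "U n z \<le> u0 z0 + M * norm (z - z0) powr \<beta>" if z: "z \<in> closure D" for n z
    proof -
      have fr: "U n y = u0 y" if "y \<in> frontier D" for y
        using out that D(1) by (simp add: frontier_def interior_open)
      have s: "subsol D (U n) 0" using U(1)[of n] by (simp add: good_def)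
      have "U n z \<le> U n z0 + M * norm (z - z0) powr \<beta>"
        unfolding M_def
        by (rule subsol_boundary_growth[OF D(1) cone \<beta> z0f s _ AU _ _ z])
          (use C fr z0f L(1) in \<open>auto simp: C_def\<close>)
      then show ?thesis using fr[OF z0f] by simp
    qed
    have up': "u z \<le> u0 z0 + M * norm (z - z0) powr \<beta>" if "z \<in> closure D" for z
      by (rule LIMSEQ_le_const2[OF lim[OF that]]) (use upper[OF that] in blast)
    have low': "u0 z \<le> u z" if "z \<in> closure D" for z
      by (rule LIMSEQ_le_const[OF lim[OF that]]) (use low in blast)
    have "(u \<longlongrightarrow> u0 z0) (at z0 within closure D)"
    proof (rule tendsto_sandwich)
      show "(u0 \<longlongrightarrow> u0 z0) (at z0 within closure D)"
        using cu0[of "closure D"] z0 by (simp add: continuous_on_def)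
      have "((\<lambda>z. u0 z0 + M * norm (z - z0) powr \<beta>) \<longlongrightarrow> u0 z0 + M * 0) (at z0 within closure D)"
        by (intro tendsto_intros norm_powr_tendsto_0[OF \<beta>(1)])
      then show "((\<lambda>z. u0 z0 + M * norm (z - z0) powr \<beta>) \<longlongrightarrow> u0 z0) (at z0 within closure D)" by simp
      show "\<forall>\<^sub>F z in at z0 within closure D. u0 z \<le> u z"
        "\<forall>\<^sub>F z in at z0 within closure D. u z \<le> u0 z0 + M * norm (z - z0) powr \<beta>"
        unfolding eventually_at_topological using low' up' by auto
    qed
    then show ?thesis using bd[OF z0f] by (simp add: continuous_within)
  qed
  then have "continuous_on (closure D) u" by (simp add: continuous_on_eq_continuous_within)
  then show ?thesis using bd g by (intro exI[of _ u] exI[of _ g]) simp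
qed

section \<open>The semilinear Dirichlet problem\<close>

text \<open>\<open>Re P\<close> need not be subharmonic, but \<open>Re P + N\<close> and
  \<open>N\<close> are on \<open>D\<close>, with a large enough multiple \<open>N\<close> of
  \<open>|z|^2\<close>; the difference of their extensions has the required boundary values.\<close>

lemma zpoly_harmonic_extension:
  assumes D: "open D" "bounded D" and cone: "ext_cone D (sin \<tau>) r" "r > 0" "0 < \<tau>" "\<tau> < pi / 2"
    and \<beta>: "0 < \<beta>" "\<beta> < 1" "\<beta> * (pi / 2 + \<tau>) < pi / 2"
    and P: "zpoly P"
  shows "\<exists>u g. continuous_on (closure D) u \<and> (\<forall>z\<in>frontier D. u z = Re (P z)) \<and> c2_on D u g (\<lambda>_. 0)"
proof -
  obtain g p where P2: "c2_on UNIV (\<lambda>z. Re (P z)) g p" using c2_on_zpoly[OF P] by blast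
  have "compact (closure D)" using D(2) by simp
  then have "bounded (p ` closure D)"
    by (intro compact_imp_bounded compact_continuous_image continuous_on_subset[OF c2_on_continuous(3)[OF P2]]) auto
  then obtain K where K: "\<And>z. z \<in> closure D \<Longrightarrow> \<bar>p z\<bar> \<le> K" unfolding bounded_iff by auto
  define N where "N = (\<lambda>z::complex. \<bar>K\<bar> * (norm (z - 0))\<^sup>2)"
  have N2: "c2_on UNIV N (\<lambda>z. \<bar>K\<bar> *\<^sub>R (2 *\<^sub>R (z - 0))) (\<lambda>z. \<bar>K\<bar> * 4)"
    unfolding N_def by (rule c2_on_scale[OF c2_on_norm_square])
  have "\<exists>u g. continuous_on (closure D) u \<and> (\<forall>z\<in>frontier D. u z = Re (P z) + N z) \<and> c2_on D u g (\<lambda>_. 0)"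
  proof (rule harmonic_extension_subharmonic[OF D cone \<beta> c2_on_add[OF P2 N2]])
    fix z assume "z \<in> D"
    then have "\<bar>p z\<bar> \<le> K" using K closure_subset by blast
    then show "0 \<le> p z + \<bar>K\<bar> * 4" by linarith
  qed
  then obtain u1 g1 where u1: "continuous_on (closure D) u1" "\<forall>z\<in>frontier D. u1 z = Re (P z) + N z" "c2_on D u1 g1 (\<lambda>_. 0)"
    by (elim exE conjE)
  have "\<exists>u g. continuous_on (closure D) u \<and> (\<forall>z\<in>frontier D. u z = N z) \<and> c2_on D u g (\<lambda>_. 0)"
    by (rule harmonic_extension_subharmonic[OF D cone \<beta> N2]) simp
  then obtain u2 g2 where u2: "continuous_on (closure D) u2" "\<forall>z\<in>frontier D. u2 z = N z" "c2_on D u2 g2 (\<lambda>_. 0)"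
    by (elim exE conjE)
  have "c2_on D (\<lambda>z. u1 z - u2 z) (\<lambda>z. g1 z - g2 z) (\<lambda>_. 0)"
    using c2_on_diff[OF u1(3) u2(3)] by simp
  moreover have "continuous_on (closure D) (\<lambda>z. u1 z - u2 z)" by (intro continuous_intros u1 u2)
  ultimately show ?thesis using u1(2) u2(2)
    by (intro exI[of _ "\<lambda>z. u1 z - u2 z"] exI[of _ "\<lambda>z. g1 z - g2 z"]) simp
qed

text \<open>A polynomial replaces \<open>f\<close>; \<open>Q\<close> solves that equation with
  uncontrolled boundary values, and a harmonic \<open>h\<close> corrects them up to a polynomial
  approximation of \<open>\<phi> - Q\<close>. By \<open>poisson_bound\<close>, errors in both data
  propagate with the factor \<open>c = 1 + R^2/4\<close>, so the approximate solutions converge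
  uniformly.\<close>

lemma poisson_dirichlet:
  assumes D: "open D" "bounded D" and cone: "ext_cone D (sin \<tau>) r" "r > 0" "0 < \<tau>" "\<tau> < pi / 2"
    and \<beta>: "0 < \<beta>" "\<beta> < 1" "\<beta> * (pi / 2 + \<tau>) < pi / 2"
    and \<phi>: "continuous_on (frontier D) \<phi>" and f: "continuous_on (closure D) f"
  shows "\<exists>V. continuous_on (closure D) V \<and> (\<forall>z\<in>frontier D. V z = \<phi> z) \<and> poisson D V f"
proof -
  define \<rho> where "\<rho> = (\<lambda>n. inverse (real (Suc n)))"
  have \<rho>: "\<rho> n > 0" for n by (simp add: \<rho>_def)
  have \<rho>lim: "\<rho> \<longlonglongrightarrow> 0" unfolding \<rho>_def by (rule LIMSEQ_inverse_real_of_nat)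
  have cc: "compact (closure D)" "compact (frontier D)" using D(2) by (auto simp: compact_frontier_bounded)
  have "\<forall>n. \<exists>V. continuous_on (closure D) V \<and> (\<forall>z\<in>frontier D. \<bar>V z - \<phi> z\<bar> < \<rho> n) \<and>
     (\<exists>p. poisson D V p \<and> (\<forall>z\<in>D. \<bar>p z - f z\<bar> < \<rho> n))"
  proof
    fix n
    obtain P where P: "zpoly P" "\<And>x. x \<in> closure D \<Longrightarrow> \<bar>Re (P x) - f x\<bar> < \<rho> n"
      by (rule zpoly_dense[OF cc(1) f \<rho>]) (rule that)
    obtain Q g where Q: "c2_on UNIV Q g (\<lambda>z. Re (P z))" using zpoly_laplacian_inverse[OF P(1)] by (elim exE)
    have cQ: "continuous_on S Q" for S using c2_on_continuous(1)[OF Q] by (rule continuous_on_subset) auto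
    have "continuous_on (frontier D) (\<lambda>z. \<phi> z - Q z)" by (intro continuous_intros \<phi> cQ)
    then obtain R where R: "zpoly R" "\<And>x. x \<in> frontier D \<Longrightarrow> \<bar>Re (R x) - (\<phi> x - Q x)\<bar> < \<rho> n"
      by (rule zpoly_dense[OF cc(2) _ \<rho>]) (rule that)
    obtain h gh where h: "continuous_on (closure D) h" "\<forall>z\<in>frontier D. h z = Re (R z)" "c2_on D h gh (\<lambda>_. 0)"
      using zpoly_harmonic_extension[OF D cone \<beta> R(1)] by (elim exE conjE)
    have c2: "c2_on D (\<lambda>z. Q z + h z) (\<lambda>z. g z + gh z) (\<lambda>z. Re (P z) + 0)"
      by (rule c2_on_add[OF c2_on_subset[OF Q] h(3)]) auto
    show "\<exists>V. continuous_on (closure D) V \<and> (\<forall>z\<in>frontier D. \<bar>V z - \<phi> z\<bar> < \<rho> n) \<and>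
     (\<exists>p. poisson D V p \<and> (\<forall>z\<in>D. \<bar>p z - f z\<bar> < \<rho> n))"
    proof (rule exI[of _ "\<lambda>z. Q z + h z"], intro conjI ballI exI[of _ "\<lambda>z. Re (P z) + 0"])
      show "continuous_on (closure D) (\<lambda>z. Q z + h z)" by (intro continuous_intros h(1) cQ)
      show "poisson D (\<lambda>z. Q z + h z) (\<lambda>z. Re (P z) + 0)" by (rule c2_on_imp_poisson[OF c2])
      show "\<bar>Q z + h z - \<phi> z\<bar> < \<rho> n" if "z \<in> frontier D" for z
        using R(2)[OF that] h(2) that by (simp add: algebra_simps)
      show "\<bar>Re (P z) + 0 - f z\<bar> < \<rho> n" if "z \<in> D" for z
        using P(2)[OF subsetD[OF closure_subset that]] by simp
    qed
  qed
  from choice[OF this] obtain V where V0: "\<forall>n. continuous_on (closure D) (V n) \<and> (\<forall>z\<in>frontier D. \<bar>V n z - \<phi> z\<bar> < \<rho> n) \<and>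
     (\<exists>p. poisson D (V n) p \<and> (\<forall>z\<in>D. \<bar>p z - f z\<bar> < \<rho> n))" by (elim exE)
  then have "\<forall>n. \<exists>p. poisson D (V n) p \<and> (\<forall>z\<in>D. \<bar>p z - f z\<bar> < \<rho> n)" by simp
  from choice[OF this] obtain p where p: "\<And>n. poisson D (V n) (p n)" "\<And>n z. z \<in> D \<Longrightarrow> \<bar>p n z - f z\<bar> < \<rho> n" by blast
  have V: "continuous_on (closure D) (V n)" "z \<in> frontier D \<Longrightarrow> \<bar>V n z - \<phi> z\<bar> < \<rho> n" for n z
    using V0 by simp_all
  obtain R where "R > 0" "\<forall>x\<in>D. norm x \<le> R"
    using D(2) unfolding bounded_pos by (elim exE conjE)
  then have R: "R > 0" "D \<subseteq> cball 0 R" by auto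
  define c where "c = 1 + R\<^sup>2 / 4"
  have c: "c > 0" by (simp add: c_def add_pos_nonneg)
  have diff: "\<bar>V n z - V m z\<bar> \<le> c * (\<rho> n + \<rho> m)" if z: "z \<in> closure D" for n m z
  proof -
    have fr: "\<bar>V n z - V m z\<bar> \<le> \<rho> n + \<rho> m" if "z \<in> frontier D" for z
      using V(2)[OF that, of n] V(2)[OF that, of m] by linarith
    show ?thesis
    proof (cases "z \<in> D")
      case True
      have "\<bar>V n z - V m z\<bar> \<le> (\<rho> n + \<rho> m) + (\<rho> n + \<rho> m) * R\<^sup>2 / 4"
      proof (rule poisson_bound[OF D _ _ _ fr R(2) True, where f="\<lambda>z. p n z - p m z"])
        show "continuous_on (closure D) (\<lambda>z. V n z - V m z)" by (intro continuous_intros V)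
        show "poisson D (\<lambda>z. V n z - V m z) (\<lambda>z. p n z - p m z)" by (intro poisson_diff p)
        show "\<bar>p n z - p m z\<bar> \<le> \<rho> n + \<rho> m" if "z \<in> D" for z
          using p(2)[OF that, of n] p(2)[OF that, of m] by linarith
        show "0 \<le> \<rho> n + \<rho> m" using \<rho>[of n] \<rho>[of m] by linarith
      qed
      then show ?thesis by (simp add: c_def algebra_simps add_divide_distrib)
    next
      case False
      then have "z \<in> frontier D" using z D(1) by (simp add: frontier_def interior_open)
      moreover have "\<rho> n + \<rho> m \<le> c * (\<rho> n + \<rho> m)"
        using \<rho>[of n] \<rho>[of m] by (simp add: c_def mult_le_cancel_right1)
      ultimately show ?thesis using fr by force
    qed
  qed
  have "uniformly_Cauchy_on (closure D) V"
    unfolding uniformly_Cauchy_on_def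
  proof (intro allI impI)
    fix e :: real assume "e > 0"
    then have "e / (2 * c) > 0" using c by simp
    from order_tendstoD(2)[OF \<rho>lim this] obtain N where N: "\<And>n. n \<ge> N \<Longrightarrow> \<rho> n < e / (2 * c)"
      by (auto simp: eventually_sequentially)
    show "\<exists>M. \<forall>x\<in>closure D. \<forall>m\<ge>M. \<forall>n\<ge>M. dist (V m x) (V n x) < e"
    proof (intro exI[of _ N] ballI allI impI)
      fix x m n assume x: "x \<in> closure D" "m \<ge> N" "n \<ge> N"
      have "c * (\<rho> m + \<rho> n) < c * (e / (2 * c) + e / (2 * c))"
        using N[OF x(2)] N[OF x(3)] c by (intro mult_strict_left_mono) auto
      also have "\<dots> = e" using c by (simp add: field_simps)
      finally show "dist (V m x) (V n x) < e"
        using diff[OF x(1), of m n] by (simp add: dist_real_def)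
    qed
  qed
  then obtain v where v: "uniform_limit (closure D) V v sequentially"
    using Cauchy_uniformly_convergent uniformly_convergent_on_def by blast
  have cv: "continuous_on (closure D) v"
    by (rule uniform_limit_theorem[OF _ v]) (auto intro!: always_eventually V)
  have "v z = \<phi> z" if z: "z \<in> frontier D" for z
  proof (rule LIMSEQ_unique)
    show "(\<lambda>n. V n z) \<longlonglongrightarrow> v z" by (rule tendsto_uniform_limitI[OF v]) (use z in \<open>simp add: frontier_def\<close>)
    show "(\<lambda>n. V n z) \<longlonglongrightarrow> \<phi> z"
    proof (rule LIM_zero_cancel, rule Lim_null_comparison[OF _ \<rho>lim])
      show "\<forall>\<^sub>F n in sequentially. norm (V n z - \<phi> z) \<le> \<rho> n"
        using V(2)[OF z] by (simp add: less_imp_le)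
    qed
  qed
  moreover have "poisson D v f"
  proof (rule poisson_limit)
    fix e :: real assume e: "e > 0"
    have "\<forall>\<^sub>F n in sequentially. (\<forall>z\<in>closure D. dist (V n z) (v z) < e) \<and> \<rho> n < e"
      using uniform_limitD[OF v e] order_tendstoD(2)[OF \<rho>lim e] by (rule eventually_conj)
    then obtain n where n: "\<forall>z\<in>closure D. dist (V n z) (v z) < e" "\<rho> n < e"
      unfolding eventually_sequentially by blast
    show "\<exists>V' f'. poisson D V' f' \<and> (\<forall>z\<in>D. \<bar>V' z - v z\<bar> \<le> e \<and> \<bar>f' z - f z\<bar> \<le> e)"
    proof (rule exI[of _ "V n"], rule exI[of _ "p n"], intro conjI ballI p)
      fix z assume z: "z \<in> D"
      then have "z \<in> closure D" using closure_subset by blast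
      then show "\<bar>V n z - v z\<bar> \<le> e" using n(1) by (auto simp: dist_real_def less_imp_le)
      show "\<bar>p n z - f z\<bar> \<le> e" using p(2)[OF z, of n] n(2) by linarith
    qed
  qed
  ultimately show ?thesis using cv by blast
qed

section \<open>Equations with a monotone nonlinearity\<close>

text \<open>Where \<open>U1 > U2\<close>, the monotone term contributes with the good sign and
  leaves \<open>\<triangle>(U1 - U2) \<ge> - e\<close>. Hence the bound is that of the linear
  equation, whatever \<open>s \<ge> 0\<close> and the monotone \<open>F\<close> are.\<close>

lemma semilinear_stability:
  assumes D: "open D" "bounded D" "D \<subseteq> cball 0 R"
    and U1: "continuous_on (closure D) U1" "poisson D U1 (\<lambda>z. s * F (U1 z) + g1 z)"
    and U2: "continuous_on (closure D) U2" "poisson D U2 (\<lambda>z. s * F (U2 z) + g2 z)"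
    and bd: "\<And>z. z \<in> frontier D \<Longrightarrow> U1 z = U2 z"
    and F: "mono F" "s \<ge> 0" and e: "\<And>z. z \<in> D \<Longrightarrow> \<bar>g1 z - g2 z\<bar> \<le> e" and z: "z \<in> closure D" and e0: "e \<ge> 0"
  shows "\<bar>U1 z - U2 z\<bar> \<le> e * R\<^sup>2 / 4"
proof -
  have *: "u z - v z \<le> e * R\<^sup>2 / 4"
    if u: "continuous_on (closure D) u" "poisson D u (\<lambda>z. s * F (u z) + g z)"
    and v: "continuous_on (closure D) v" "poisson D v (\<lambda>z. s * F (v z) + h z)"
    and bd: "\<And>z. z \<in> frontier D \<Longrightarrow> u z = v z" and gh: "\<And>z. z \<in> D \<Longrightarrow> g z - h z \<ge> - e" for u v g h
  proof (cases "u z > v z")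
    case True
    then have zD: "z \<in> D" using z bd[of z] D(1) by (auto simp: frontier_def interior_open)
    \<comment> \<open>On the frontier of this open set \<open>u \<le> v\<close>, whether the point
      lies in \<open>D\<close> or on the frontier of \<open>D\<close>.\<close>
    define E where "E = {z \<in> D. u z > v z}"
    have cD: "continuous_on D u" "continuous_on D v"
      by (rule continuous_on_subset[OF u(1) closure_subset] continuous_on_subset[OF v(1) closure_subset])+
    have "E = D \<inter> (\<lambda>z. u z - v z) -` {0<..}" by (auto simp: E_def)
    moreover have "open (D \<inter> (\<lambda>z. u z - v z) -` {0<..})"
      by (rule continuous_open_preimage) (auto intro!: continuous_intros cD D)
    ultimately have oE: "open E" by simp
    have ED: "E \<subseteq> D" by (auto simp: E_def)
    have clE: "closure E \<subseteq> closure D" using ED by (rule closure_mono)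
    have "(u z - v z) - - (e/4) * (norm (z - 0))\<^sup>2 \<le> e * R\<^sup>2 / 4"
    proof (rule maximum_principle[OF oE bounded_subset[OF D(2) ED], where V="\<lambda>z. (u z - v z) - - (e/4) * (norm (z - 0))\<^sup>2" and a=z])
      show "continuous_on (closure E) (\<lambda>z. u z - v z - - (e/4) * (norm (z - 0))\<^sup>2)"
        by (intro continuous_intros continuous_on_subset[OF u(1) clE] continuous_on_subset[OF v(1) clE])
      show "poisson E (\<lambda>z. u z - v z - - (e/4) * (norm (z - 0))\<^sup>2) (\<lambda>z. ((s * F (u z) + g z) - (s * F (v z) + h z)) - (- (e/4) * 4))"
        by (intro poisson_diff poisson_subset[OF u(2) ED] poisson_subset[OF v(2) ED] c2_on_imp_poisson[OF c2_on_scale[OF c2_on_norm_square]])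
      show "0 \<le> ((s * F (u z) + g z) - (s * F (v z) + h z)) - (- (e/4) * 4)" if "z \<in> E" for z
      proof -
        have "F (v z) \<le> F (u z)" using that F(1) by (auto simp: E_def mono_def)
        then have "s * F (v z) \<le> s * F (u z)" using F(2) by (rule mult_left_mono)
        moreover have "z \<in> D" using that ED by auto
        ultimately show ?thesis using gh[of z] by linarith
      qed
      fix y assume y: "y \<in> frontier E"
      then have yc: "y \<in> closure E" and yE: "y \<notin> E"
        using frontier_disjoint_eq[of E] oE by (auto simp: frontier_def)
      have le: "u y \<le> v y"
      proof (cases "y \<in> D")
        case True
        then show ?thesis using yE by (simp add: E_def)
      next
        case False
        then have "y \<in> frontier D" using yc clE D(1) by (auto simp: frontier_def interior_open)
        then show ?thesis using bd by simp
      qed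
      have "closure E \<subseteq> cball 0 R" using ED D(3) by (intro closure_minimal) auto
      then have "norm y \<le> R" using yc by auto
      then have "e / 4 * (norm y)\<^sup>2 \<le> e / 4 * R\<^sup>2" using e0 by (intro mult_left_mono power_mono) auto
      then show "u y - v y - - (e/4) * (norm (y - 0))\<^sup>2 \<le> e * R\<^sup>2 / 4" using le by simp
    qed (use zD True in \<open>simp add: E_def\<close>)
    moreover have "0 \<le> e / 4 * (norm z)\<^sup>2" using e0 by simp
    ultimately show ?thesis by simp
  next
    case False
    then show ?thesis using e0 by (smt (verit) divide_nonneg_nonneg mult_nonneg_nonneg zero_le_power2)
  qed
  have "U1 z - U2 z \<le> e * R\<^sup>2 / 4"
    by (rule *[OF U1 U2 bd]) (use e in \<open>force simp: abs_le_iff\<close>)+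
  moreover have "U2 z - U1 z \<le> e * R\<^sup>2 / 4"
    by (rule *[OF U2 U1 bd[symmetric]]) (use e in \<open>force simp: abs_le_iff\<close>)+
  ultimately show ?thesis by linarith
qed

lemma contraction_limit:
  fixes U :: "nat \<Rightarrow> complex \<Rightarrow> real"
  assumes c: "\<And>n. continuous_on S (U n)"
    and d: "\<And>n z. z \<in> S \<Longrightarrow> \<bar>U (Suc n) z - U n z\<bar> \<le> A * (1/2) ^ n"
  shows "\<exists>w. continuous_on S w \<and> uniform_limit S U w sequentially"
proof -
  have A: "A \<ge> 0" if "z \<in> S" for z using order_trans[OF abs_ge_zero d[OF that, of 0]] by simp
  \<comment> \<open>The right side is the geometric sum in closed form, which the induction over
    \<open>k\<close> reproduces.\<close>
  have tele: "\<bar>U (n + k) z - U n z\<bar> \<le> 2 * A * (1/2) ^ n - 2 * A * (1/2) ^ (n + k)" if z: "z \<in> S" for n k z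
  proof (induction k)
    case (Suc k)
    have "\<bar>U (Suc (n + k)) z - U (n + k) z\<bar> \<le> A * (1/2) ^ (n + k)" by (rule d[OF z])
    then have "\<bar>U (n + Suc k) z - U n z\<bar> \<le> 2 * A * (1/2) ^ n - 2 * A * (1/2) ^ (n + k) + A * (1/2) ^ (n + k)"
      using Suc by simp
    then show ?case by simp
  qed simp
  have "uniformly_Cauchy_on S U"
  proof (cases "S = {}")
    case False
    then obtain z0 where "z0 \<in> S" by blast
    then have A0: "A \<ge> 0" by (rule A)
    show ?thesis unfolding uniformly_Cauchy_on_def
    proof (intro allI impI)
      fix e :: real assume e: "e > 0"
      have "(\<lambda>n. 2 * A * (1/2) ^ n) \<longlonglongrightarrow> 2 * A * 0"
        by (intro tendsto_intros LIMSEQ_power_zero) simp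
      then have "(\<lambda>n. 2 * A * (1/2) ^ n) \<longlonglongrightarrow> 0" by simp
      from order_tendstoD(2)[OF this, of "e/2"] e obtain N where N: "2 * A * (1/2) ^ N < e/2"
        unfolding eventually_sequentially by auto
      have near: "\<bar>U m z - U N z\<bar> < e/2" if "m \<ge> N" "z \<in> S" for m z
      proof -
        have "\<bar>U (N + (m - N)) z - U N z\<bar> \<le> 2 * A * (1/2) ^ N - 2 * A * (1/2) ^ (N + (m - N))" by (rule tele[OF that(2)])
        also have "\<dots> \<le> 2 * A * (1/2) ^ N" using A0 by simp
        finally show ?thesis using N that(1) by simp
      qed
      show "\<exists>M. \<forall>x\<in>S. \<forall>m\<ge>M. \<forall>n\<ge>M. dist (U m x) (U n x) < e"
      proof (intro exI[of _ N] ballI allI impI)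
        fix x m n assume "x \<in> S" "m \<ge> N" "n \<ge> N"
        then show "dist (U m x) (U n x) < e"
          using near[of m x] near[of n x] unfolding dist_real_def by linarith
      qed
    qed
  qed (simp add: uniformly_Cauchy_on_def)
  then obtain w where w: "uniform_limit S U w sequentially"
    using Cauchy_uniformly_convergent uniformly_convergent_on_def by blast
  have "continuous_on S w"
    by (rule uniform_limit_theorem[OF _ w]) (auto intro!: always_eventually c)
  then show ?thesis using w by blast
qed

text \<open>
  Continuity method: if the problem with nonlinearity \<open>s F\<close> is solvable for all right-hand sides,
  stability makes the one with \<open>(s + t) F\<close> a contraction, for \<open>t\<close> small independently of \<open>s\<close>.
\<close>

lemma semilinear_step:
  assumes D: "open D" "bounded D" "D \<subseteq> cball 0 R"
    and F: "mono F" "\<And>x y. \<bar>F x - F y\<bar> \<le> L * \<bar>x - y\<bar>" "L \<ge> 0"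
    and s: "s \<ge> 0" "t \<ge> 0" "t * L * (R\<^sup>2 / 4) \<le> 1 / 2"
    and solv: "\<And>g. continuous_on (closure D) g \<Longrightarrow>
      \<exists>U. continuous_on (closure D) U \<and> (\<forall>z\<in>frontier D. U z = \<phi> z) \<and> poisson D U (\<lambda>z. s * F (U z) + g z)"
    and g: "continuous_on (closure D) g"
  shows "\<exists>U. continuous_on (closure D) U \<and> (\<forall>z\<in>frontier D. U z = \<phi> z) \<and> poisson D U (\<lambda>z. (s + t) * F (U z) + g z)"
proof -
  have "L-lipschitz_on UNIV F"
    by (rule lipschitz_onI) (use F in \<open>auto simp: dist_real_def\<close>)
  then have cF: "continuous_on UNIV F" by (rule lipschitz_on_continuous_on)
  have "\<forall>w. \<exists>U. continuous_on (closure D) w \<longrightarrow> continuous_on (closure D) U \<and> (\<forall>z\<in>frontier D. U z = \<phi> z) \<and>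
      poisson D U (\<lambda>z. s * F (U z) + (g z + t * F (w z)))"
  proof
    fix w
    show "\<exists>U. continuous_on (closure D) w \<longrightarrow> continuous_on (closure D) U \<and> (\<forall>z\<in>frontier D. U z = \<phi> z) \<and>
      poisson D U (\<lambda>z. s * F (U z) + (g z + t * F (w z)))"
    proof (cases "continuous_on (closure D) w")
      case True
      have "continuous_on (closure D) (\<lambda>z. g z + t * F (w z))"
        by (intro continuous_intros g continuous_on_compose2[OF cF True]) auto
      from solv[OF this] show ?thesis by simp
    qed simp
  qed
  \<comment> \<open>\<open>S w\<close> solves the equation in which \<open>t F(w)\<close> is frozen
    on the right-hand side; a fixed point of \<open>S\<close> solves the one with
    \<open>s + t\<close>.\<close>
  from choice[OF this] obtain S where "\<forall>w. continuous_on (closure D) w \<longrightarrow> continuous_on (closure D) (S w) \<and>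
      (\<forall>z\<in>frontier D. S w z = \<phi> z) \<and> poisson D (S w) (\<lambda>z. s * F (S w z) + (g z + t * F (w z)))"
    by (elim exE)
  then have S: "continuous_on (closure D) (S w)" "z \<in> frontier D \<Longrightarrow> S w z = \<phi> z"
    "poisson D (S w) (\<lambda>z. s * F (S w z) + (g z + t * F (w z)))" if "continuous_on (closure D) w" for w z
    using that by simp_all
  have contr: "\<bar>S w z - S v z\<bar> \<le> e / 2"
    if w: "continuous_on (closure D) w" and v: "continuous_on (closure D) v"
      and e: "\<And>z. z \<in> closure D \<Longrightarrow> \<bar>w z - v z\<bar> \<le> e" and z: "z \<in> closure D" for w v e z
  proof -
    have e0: "e \<ge> 0" using e[OF z] by linarith
    \<comment> \<open>Stability is applied to two right-hand sides that differ by
      \<open>t (F w - F v)\<close>; the condition on \<open>t\<close> turns the resulting factor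
      into 1/2.\<close>
    have "\<bar>S w z - S v z\<bar> \<le> (t * L * e) * R\<^sup>2 / 4"
    proof (rule semilinear_stability[OF D S(1,3)[OF w] S(1,3)[OF v] _ F(1) s(1) _ z])
      show "S w y = S v y" if "y \<in> frontier D" for y using S(2)[OF w that] S(2)[OF v that] by simp
      fix y assume "y \<in> D"
      then have y: "y \<in> closure D" using closure_subset by (rule subsetD[rotated])
      have "\<bar>F (w y) - F (v y)\<bar> \<le> L * e"
        using F(2)[of "w y" "v y"] mult_left_mono[OF e[OF y] F(3)] by linarith
      then have "t * \<bar>F (w y) - F (v y)\<bar> \<le> t * (L * e)" using s(2) by (rule mult_left_mono)
      moreover have "g y + t * F (w y) - (g y + t * F (v y)) = t * (F (w y) - F (v y))"
        by (simp add: algebra_simps)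
      ultimately show "\<bar>g y + t * F (w y) - (g y + t * F (v y))\<bar> \<le> t * L * e"
        using s(2) by (simp add: abs_mult)
    qed (use s F e0 in simp)
    also have "\<dots> = (t * L * (R\<^sup>2 / 4)) * e" by simp
    also have "\<dots> \<le> 1 / 2 * e" using s(3) e0 by (rule mult_right_mono)
    finally show ?thesis by simp
  qed
  define U where "U = (\<lambda>n. (S ^^ n) (\<lambda>_. 0))"
  have USuc: "U (Suc n) = S (U n)" for n by (simp add: U_def)
  have cU: "continuous_on (closure D) (U n)" for n
    by (induction n) (auto simp: USuc S(1), simp add: U_def)
  have "compact (closure D)" using D by simp
  then have "bounded ((\<lambda>z. U 1 z - U 0 z) ` closure D)"
    by (intro compact_imp_bounded compact_continuous_image continuous_intros cU)
  then obtain A where A: "\<And>z. z \<in> closure D \<Longrightarrow> \<bar>U 1 z - U 0 z\<bar> \<le> A" unfolding bounded_iff by auto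
  have d: "\<forall>z\<in>closure D. \<bar>U (Suc n) z - U n z\<bar> \<le> A * (1/2) ^ n" for n
  proof (induction n)
    case (Suc n)
    have "\<bar>U (Suc (Suc n)) z - U (Suc n) z\<bar> \<le> A * (1/2) ^ n / 2" if "z \<in> closure D" for z
      unfolding USuc[of "Suc n"] USuc[of n]
      by (rule contr) (use Suc cU that in \<open>auto simp: USuc[symmetric]\<close>)
    then show ?case by simp
  qed (use A in simp)
  obtain w where w: "continuous_on (closure D) w" "uniform_limit (closure D) U w sequentially"
    using contraction_limit[of "closure D" U A, OF cU] d by blast
  have fixp: "S w z = w z" if z: "z \<in> closure D" for z
  proof -
    have "\<bar>S w z - w z\<bar> \<le> e" if e: "e > 0" for e
    proof -
      have e2: "e / 2 > 0" using e by simp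
      have "\<forall>\<^sub>F n in sequentially. \<forall>y\<in>closure D. dist (U n y) (w y) < e/2"
        using uniform_limitD[OF w(2) e2] .
      then obtain N where N: "\<And>n y. n \<ge> N \<Longrightarrow> y \<in> closure D \<Longrightarrow> dist (U n y) (w y) < e/2"
        unfolding eventually_sequentially by blast
      have "\<bar>S w z - S (U N) z\<bar> \<le> (e/2) / 2"
        by (rule contr[OF w(1) cU _ z]) (use N[OF order_refl] in \<open>force simp: dist_real_def abs_minus_commute\<close>)
      then have "\<bar>S w z - U (Suc N) z\<bar> \<le> (e/2) / 2" by (simp add: USuc)
      moreover have "\<bar>U (Suc N) z - w z\<bar> < e / 2" using N[of "Suc N", OF _ z] by (simp add: dist_real_def)
      ultimately show ?thesis using e by linarith
    qed
    then show ?thesis by (metis abs_le_zero_iff dense_ge eq_iff_diff_eq_0)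
  qed
  have "w z = \<phi> z" if z: "z \<in> frontier D" for z
  proof -
    have "z \<in> closure D" using z by (simp add: frontier_def)
    then show ?thesis using fixp S(2)[OF w(1) z] by simp
  qed
  moreover have "poisson D w (\<lambda>z. (s + t) * F (w z) + g z)"
  proof (rule poisson_cong[OF S(3)[OF w(1)]])
    fix z assume "z \<in> D"
    then have "z \<in> closure D" using closure_subset by (rule subsetD[rotated])
    then show "S w z = w z" "s * F (S w z) + (g z + t * F (w z)) = (s + t) * F (w z) + g z"
      using fixp by (simp_all add: algebra_simps)
  qed
  ultimately show ?thesis using w(1) by blast
qed

text \<open>\<open>N\<close> is chosen so that \<open>1/N\<close> is an admissible step; from the
  linear problem at 0, \<open>N\<close> steps reach 1. The induction keeps \<open>g\<close>
  arbitrary because each step solves for modified right-hand sides.\<close>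

lemma semilinear_dirichlet:
  assumes D: "open D" "bounded D" and cone: "ext_cone D (sin \<tau>) r" "r > 0" "0 < \<tau>" "\<tau> < pi / 2"
    and \<beta>: "0 < \<beta>" "\<beta> < 1" "\<beta> * (pi / 2 + \<tau>) < pi / 2"
    and \<phi>: "continuous_on (frontier D) \<phi>"
    and F: "mono F" "\<And>x y. \<bar>F x - F y\<bar> \<le> L * \<bar>x - y\<bar>" "L \<ge> 0"
  shows "\<exists>U. continuous_on (closure D) U \<and> (\<forall>z\<in>frontier D. U z = \<phi> z) \<and> poisson D U (\<lambda>z. F (U z))"
proof -
  obtain R where "R > 0" "\<forall>x\<in>D. norm x \<le> R"
    using D(2) unfolding bounded_pos by (elim exE conjE)
  then have R: "R > 0" "D \<subseteq> cball 0 R" by auto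
  obtain N :: nat where N: "real N > 2 * (L * (R\<^sup>2 / 4))" "N > 0"
    using reals_Archimedean2[of "max 0 (2 * (L * (R\<^sup>2 / 4)))"] by auto
  define t where "t = 1 / real N"
  have t: "t \<ge> 0" "t * L * (R\<^sup>2 / 4) \<le> 1 / 2"
    using N by (auto simp: t_def field_simps)
  have solv: "\<exists>U. continuous_on (closure D) U \<and> (\<forall>z\<in>frontier D. U z = \<phi> z) \<and> poisson D U (\<lambda>z. (real n * t) * F (U z) + g z)"
    if "continuous_on (closure D) g" for n g
    using that
  proof (induction n arbitrary: g)
    case 0
    show ?case using poisson_dirichlet[OF D cone \<beta> \<phi> 0] by simp
  next
    case (Suc n)
    have "\<exists>U. continuous_on (closure D) U \<and> (\<forall>z\<in>frontier D. U z = \<phi> z) \<and> poisson D U (\<lambda>z. (real n * t + t) * F (U z) + g z)"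
      by (rule semilinear_step[OF D R(2) F _ t Suc.IH Suc.prems]) (use t(1) in simp)
    then show ?case by (simp add: algebra_simps)
  qed
  have "real N * t = 1" using N by (simp add: t_def)
  then show ?thesis using solv[of "\<lambda>_. 0" N] by simp
qed

lemma exp_lipschitz:
  fixes x y M :: real
  assumes "x \<le> M" "y \<le> M"
  shows "\<bar>exp x - exp y\<bar> \<le> exp M * \<bar>x - y\<bar>"
proof -
  have *: "exp b - exp a \<le> exp M * (b - a)" if "a \<le> b" "b \<le> M" for a b :: real
  proof -
    have "exp b * (1 + (a - b)) \<le> exp b * exp (a - b)"
      by (intro mult_left_mono exp_ge_add_one_self) simp
    then have "exp b - exp a \<le> exp b * (b - a)" by (simp add: mult_exp_exp algebra_simps)
    also have "\<dots> \<le> exp M * (b - a)" using that by (intro mult_right_mono) auto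
    finally show ?thesis .
  qed
  show ?thesis
    using *[of x y] *[of y x] assms by (cases "x \<le> y") (auto simp: abs_if)
qed

text \<open>The cut-off right-hand side is still positive, so the solution is subharmonic and by the
  maximum principle stays below the bound \<open>M\<close> of its boundary values, where the cut-off
  has no effect.\<close>

lemma exponential_dirichlet:
  assumes D: "open D" "bounded D" and cone: "ext_cone D (sin \<tau>) r" "r > 0" "0 < \<tau>" "\<tau> < pi / 2"
    and \<beta>: "0 < \<beta>" "\<beta> < 1" "\<beta> * (pi / 2 + \<tau>) < pi / 2"
    and \<phi>: "continuous_on (frontier D) \<phi>" and \<delta>: "\<delta> > 0"
  shows "\<exists>U. continuous_on (closure D) U \<and> (\<forall>z\<in>frontier D. U z = \<phi> z) \<and> poisson D U (\<lambda>z. \<delta> * exp (U z))"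
proof -
  have "bounded (\<phi> ` frontier D)"
    using D(2) by (intro compact_imp_bounded compact_continuous_image \<phi>) (simp add: compact_frontier_bounded)
  then obtain M where M: "\<And>z. z \<in> frontier D \<Longrightarrow> \<bar>\<phi> z\<bar> \<le> M" unfolding bounded_iff by auto
  define F where "F = (\<lambda>u. \<delta> * exp (min u M))"
  have lip: "\<bar>exp (min x M) - exp (min y M)\<bar> \<le> exp M * \<bar>x - y\<bar>" for x y
  proof -
    have "\<bar>exp (min x M) - exp (min y M)\<bar> \<le> exp M * \<bar>min x M - min y M\<bar>"
      by (rule exp_lipschitz) auto
    also have "\<dots> \<le> exp M * \<bar>x - y\<bar>" by (intro mult_left_mono) auto
    finally show ?thesis .
  qed
  have "\<exists>U. continuous_on (closure D) U \<and> (\<forall>z\<in>frontier D. U z = \<phi> z) \<and> poisson D U (\<lambda>z. F (U z))"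
  proof (rule semilinear_dirichlet[OF D cone \<beta> \<phi>, where L="\<delta> * exp M"])
    show "mono F" unfolding F_def mono_def using \<delta> by (auto intro!: mult_left_mono)
    show "\<bar>F x - F y\<bar> \<le> \<delta> * exp M * \<bar>x - y\<bar>" for x y
    proof -
      have "F x - F y = \<delta> * (exp (min x M) - exp (min y M))" by (simp add: F_def right_diff_distrib)
      then show ?thesis using lip[of x y] \<delta> by (simp add: abs_mult)
    qed
    show "0 \<le> \<delta> * exp M" using \<delta> by simp
  qed
  then obtain U where U: "continuous_on (closure D) U" "\<forall>z\<in>frontier D. U z = \<phi> z" "poisson D U (\<lambda>z. F (U z))"
    by (elim exE conjE)
  have "U z \<le> M" if "z \<in> D" for z
    by (rule maximum_principle[OF D U(1,3) _ _ that]) (use \<delta> M U(2) in \<open>auto simp: F_def abs_le_iff\<close>)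
  then have "poisson D U (\<lambda>z. \<delta> * exp (U z))"
    by (intro poisson_cong[OF U(3)]) (auto simp: F_def min_absorb1)
  then show ?thesis using U(1,2) by blast
qed

section \<open>Exterior cones of smooth Jordan domains\<close>

text \<open>By the Jordan curve theorem the unbounded component of the complement of the curve has
  the whole curve as its frontier. It cannot meet \<open>D\<close>, since a connected set that meets
  \<open>D\<close> and leaves it crosses the frontier. Its points near a boundary point rule out
  that \<open>D\<close> occupies both sides of the curve there.\<close>

lemma jordan_domain_outside:
  assumes "jordan_domain D"
  shows "\<exists>E. E \<inter> D = {} \<and> E \<inter> frontier D = {} \<and> frontier D \<subseteq> closure E"
proof -
  have D: "open D" "bounded D" using assms by (auto simp: jordan_domain_def)
  obtain c :: "complex \<Rightarrow> complex" where c: "continuous_on (sphere 0 1) c" "inj_on c (sphere 0 1)" "c ` sphere 0 1 = frontier D"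
    using assms unfolding jordan_domain_def jordan_parametrization_def by (elim conjE exE)
  let ?p = "c \<circ> circlepath 0 1"
  have pi: "path_image ?p = frontier D" using c(3) by (simp add: path_image_compose)
  have sp: "simple_path ?p"
    by (rule simple_path_continuous_image) (use c in \<open>auto simp: simple_path_circlepath\<close>)
  have cl: "pathfinish ?p = pathstart ?p" by (simp add: pathfinish_compose pathstart_compose)
  let ?E = "outside (frontier D)"
  have out: "connected ?E" "\<not> bounded ?E" "frontier ?E = frontier D"
    using Jordan_inside_outside[OF sp cl] unfolding pi by blast+
  have disj: "?E \<inter> frontier D = {}" by (auto simp: outside_def)
  have "?E \<inter> D = {}"
  proof (rule ccontr)
    assume "?E \<inter> D \<noteq> {}"
    moreover have "?E - D \<noteq> {}" using out(2) D(2) bounded_subset by blast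
    ultimately have "?E \<inter> frontier D \<noteq> {}" by (rule connected_Int_frontier[OF out(1)])
    then show False using disj by simp
  qed
  moreover have "frontier D \<subseteq> closure ?E" using out(3) by (simp add: frontier_def) blast
  ultimately show ?thesis using disj by blast
qed

text \<open>
  Near a boundary point the frontier is a graph over the tangent \<open>T\<close>, contained in a thin double
  cone. If both complementary cones met \<open>D\<close> they would lie in \<open>D\<close>; but a nearby exterior point
  can be joined to one of them by a normal segment not meeting the frontier.
\<close>

lemma ext_cone_at:
  assumes E: "E \<inter> D = {}" "E \<inter> frontier D = {}" "z0 \<in> closure E"
    and T: "norm T = 1" and \<kappa>: "0 < \<kappa>" "\<kappa> \<le> 1 / 4" and \<rho>: "\<rho> > 0"
    and cone: "\<And>z. z \<in> frontier D \<Longrightarrow> norm (z - z0) < 2 * \<rho> \<Longrightarrow>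
       \<bar>Im ((z - z0) * cnj T)\<bar> \<le> 2 * \<kappa> * \<bar>Re ((z - z0) * cnj T)\<bar>"
    and graph: "\<And>z w. z \<in> frontier D \<Longrightarrow> w \<in> frontier D \<Longrightarrow> norm (z - z0) < 2 * \<rho> \<Longrightarrow> norm (w - z0) < 2 * \<rho> \<Longrightarrow>
       Re ((z - z0) * cnj T) = Re ((w - z0) * cnj T) \<Longrightarrow> z = w"
  shows "\<exists>e. norm e = 1 \<and> (\<forall>z\<in>D \<inter> ball z0 \<rho>. Re ((z - z0) * cnj e) \<ge> - (2 * \<kappa>) * norm (z - z0))"
proof -
  have TT: "T * cnj T = 1" using T by (simp add: complex_norm_square[symmetric])
  \<comment> \<open>Coordinates at \<open>z0\<close> in which the tangent is the real axis; the
    inverse map is \<open>(z - z0) * cnj T\<close>.\<close>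
  define \<Phi> where "\<Phi> = (\<lambda>\<zeta>. z0 + \<zeta> * T)"
  have coord: "(\<Phi> \<zeta> - z0) * cnj T = \<zeta>" for \<zeta> by (simp add: \<Phi>_def mult.assoc TT)
  have point: "\<Phi> ((z - z0) * cnj T) = z" for z
    using TT by (simp add: \<Phi>_def mult.assoc mult.commute[of "cnj T"])
  have n\<Phi>: "norm (\<Phi> \<zeta> - z0) = norm \<zeta>" for \<zeta> using T by (simp add: \<Phi>_def norm_mult)
  have sq: "norm \<zeta> < 2 * \<rho>" if "\<bar>Re \<zeta>\<bar> < \<rho>" "\<bar>Im \<zeta>\<bar> < \<rho>" for \<zeta>
    using cmod_le[of \<zeta>] that by linarith
  have cone': "\<bar>Im \<zeta>\<bar> \<le> 2 * \<kappa> * \<bar>Re \<zeta>\<bar>" if "\<Phi> \<zeta> \<in> frontier D" "\<bar>Re \<zeta>\<bar> < \<rho>" "\<bar>Im \<zeta>\<bar> < \<rho>" for \<zeta>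
    using cone[OF that(1)] sq[OF that(2,3)] unfolding n\<Phi> coord by simp
  have graph': "\<zeta> = \<xi>" if "\<Phi> \<zeta> \<in> frontier D" "\<Phi> \<xi> \<in> frontier D" "\<bar>Re \<zeta>\<bar> < \<rho>" "\<bar>Im \<zeta>\<bar> < \<rho>" "\<bar>Im \<xi>\<bar> < \<rho>"
    "Re \<zeta> = Re \<xi>" for \<zeta> \<xi>
  proof -
    have "\<Phi> \<zeta> = \<Phi> \<xi>"
      using graph[OF that(1,2)] sq[of \<zeta>] sq[of \<xi>] that(3-6) unfolding n\<Phi> coord by simp
    then show ?thesis using coord by metis
  qed
  have c\<Phi>: "continuous_on S \<Phi>" for S unfolding \<Phi>_def by (intro continuous_intros)
  have sep: "\<Phi> \<xi> \<in> D" if "connected C" "\<zeta> \<in> C" "\<Phi> \<zeta> \<in> D" "\<xi> \<in> C" "\<And>\<eta>. \<eta> \<in> C \<Longrightarrow> \<Phi> \<eta> \<notin> frontier D" for C \<zeta> \<xi>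
  proof (rule ccontr)
    assume "\<Phi> \<xi> \<notin> D"
    then have "\<Phi> ` C \<inter> frontier D \<noteq> {}"
      using that(2-4) by (intro connected_Int_frontier connected_continuous_image that(1) c\<Phi>) auto
    then show False using that(5) by auto
  qed
  \<comment> \<open>The pieces of the coordinate square above and below the double cone around the
    tangent; both are free of frontier points.\<close>
  define Pp where "Pp = {\<zeta>. \<bar>Re \<zeta>\<bar> < \<rho> \<and> 2 * \<kappa> * \<bar>Re \<zeta>\<bar> < Im \<zeta> \<and> Im \<zeta> < \<rho>}"
  define Pm where "Pm = {\<zeta>. \<bar>Re \<zeta>\<bar> < \<rho> \<and> 2 * \<kappa> * \<bar>Re \<zeta>\<bar> < - Im \<zeta> \<and> - Im \<zeta> < \<rho>}"
  \<comment> \<open>Absolute values are resolved into half-planes, so that convexity gives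
    connectedness.\<close>
  have Ppeq: "Pp = {\<zeta>. Re \<zeta> < \<rho>} \<inter> {\<zeta>. Re \<zeta> > - \<rho>} \<inter> {\<zeta>. Im \<zeta> < \<rho>} \<inter>
     {\<zeta>. Complex (- (2 * \<kappa>)) 1 \<bullet> \<zeta> > 0} \<inter> {\<zeta>. Complex (2 * \<kappa>) 1 \<bullet> \<zeta> > 0}"
  proof -
    have "2 * \<kappa> * \<bar>x\<bar> = \<bar>2 * \<kappa> * x\<bar>" for x using \<kappa> by (simp add: abs_mult)
    then show ?thesis by (auto simp: Pp_def inner_complex_def abs_less_iff)
  qed
  have cp: "connected Pp"
    unfolding Ppeq
    by (intro convex_connected convex_Int convex_halfspace_Re_lt convex_halfspace_Re_gt convex_halfspace_Im_lt convex_halfspace_gt)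
  have "Pm = uminus ` Pp"
  proof
    show "uminus ` Pp \<subseteq> Pm" by (auto simp: Pp_def Pm_def)
    show "Pm \<subseteq> uminus ` Pp"
    proof
      fix x assume "x \<in> Pm"
      then have "- x \<in> Pp" by (simp add: Pp_def Pm_def)
      then show "x \<in> uminus ` Pp" by (rule rev_image_eqI) simp
    qed
  qed
  then have cm: "connected Pm"
    by (simp only:) (intro connected_continuous_image cp continuous_intros)
  have nfp: "\<Phi> \<zeta> \<notin> frontier D" if "\<zeta> \<in> Pp" for \<zeta>
  proof
    assume f: "\<Phi> \<zeta> \<in> frontier D"
    have "0 \<le> 2 * \<kappa> * \<bar>Re \<zeta>\<bar>" using \<kappa> by simp
    then show False using cone'[OF f] that by (auto simp: Pp_def)
  qed
  have nfm: "\<Phi> \<zeta> \<notin> frontier D" if "\<zeta> \<in> Pm" for \<zeta>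
  proof
    assume f: "\<Phi> \<zeta> \<in> frontier D"
    have "0 \<le> 2 * \<kappa> * \<bar>Re \<zeta>\<bar>" using \<kappa> by simp
    then show False using cone'[OF f] that by (auto simp: Pm_def)
  qed
  have "(\<forall>\<zeta>\<in>Pp. \<Phi> \<zeta> \<notin> D) \<or> (\<forall>\<zeta>\<in>Pm. \<Phi> \<zeta> \<notin> D)"
  proof (rule ccontr)
    assume "\<not> ?thesis"
    then obtain \<zeta>p \<zeta>m where pm: "\<zeta>p \<in> Pp" "\<Phi> \<zeta>p \<in> D" "\<zeta>m \<in> Pm" "\<Phi> \<zeta>m \<in> D" by blast
    have inp: "\<Phi> \<zeta> \<in> D" if "\<zeta> \<in> Pp" for \<zeta> using sep[OF cp pm(1,2) that nfp] .
    have inm: "\<Phi> \<zeta> \<in> D" if "\<zeta> \<in> Pm" for \<zeta> using sep[OF cm pm(3,4) that nfm] .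
    \<comment> \<open>An exterior point near \<open>z0\<close>. Both pieces lie in \<open>D\<close>
      by now, so it lies in the double cone, and vertical segments lead from it into each of
      them.\<close>
    obtain w where w: "w \<in> E" "dist w z0 < \<rho>" using E(3) \<rho> closure_approachable by blast
    define \<zeta> where "\<zeta> = (w - z0) * cnj T"
    have \<Phi>\<zeta>: "\<Phi> \<zeta> = w" unfolding \<zeta>_def by (rule point)
    have "norm \<zeta> < \<rho>" using n\<Phi>[of \<zeta>] w(2) by (simp add: \<Phi>\<zeta> dist_norm)
    then have R: "\<bar>Re \<zeta>\<bar> < \<rho>" "\<bar>Im \<zeta>\<bar> < \<rho>" using abs_Re_le_cmod[of \<zeta>] abs_Im_le_cmod[of \<zeta>] by linarith+
    have notin: "\<Phi> \<zeta> \<notin> D" "\<Phi> \<zeta> \<notin> frontier D" using w(1) E(1,2) \<Phi>\<zeta> by auto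
    then have "\<zeta> \<notin> Pp" "\<zeta> \<notin> Pm" using inp inm by auto
    then have Im\<zeta>: "\<bar>Im \<zeta>\<bar> \<le> 2 * \<kappa> * \<bar>Re \<zeta>\<bar>" using R by (auto simp: Pp_def Pm_def abs_if split: if_splits)
    have k\<rho>: "2 * \<kappa> * \<bar>Re \<zeta>\<bar> < \<rho>"
    proof -
      have "2 * \<kappa> * \<bar>Re \<zeta>\<bar> \<le> 1 * \<bar>Re \<zeta>\<bar>" using \<kappa> by (intro mult_right_mono) auto
      then show ?thesis using R(1) by simp
    qed
    \<comment> \<open>Any height between the cone and the edge of the square would do; it puts the
      two ends of the vertical line into the two pieces.\<close>
    define y where "y = (2 * \<kappa> * \<bar>Re \<zeta>\<bar> + \<rho>) / 2"
    have y: "2 * \<kappa> * \<bar>Re \<zeta>\<bar> < y" "y < \<rho>" using k\<rho> by (auto simp: y_def)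
    define Sp where "Sp = (\<lambda>s. Complex (Re \<zeta>) s) ` {Im \<zeta>..y}"
    define Sm where "Sm = (\<lambda>s. Complex (Re \<zeta>) s) ` {-y..Im \<zeta>}"
    have cc: "continuous_on S (\<lambda>s. Complex (Re \<zeta>) s)" for S
      unfolding Complex_eq by (intro continuous_intros)
    have conS: "connected Sp" "connected Sm"
      unfolding Sp_def Sm_def by (intro connected_continuous_image cc connected_Icc)+
    have \<zeta>S: "\<zeta> \<in> Sp" "\<zeta> \<in> Sm"
      unfolding Sp_def Sm_def using Im\<zeta> y by (auto intro!: image_eqI[of _ _ "Im \<zeta>"])
    have tp: "Complex (Re \<zeta>) y \<in> Sp" "Complex (Re \<zeta>) y \<in> Pp"
      unfolding Sp_def Pp_def using Im\<zeta> y R by auto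
    have tm: "Complex (Re \<zeta>) (- y) \<in> Sm" "Complex (Re \<zeta>) (- y) \<in> Pm"
      unfolding Sm_def Pm_def using Im\<zeta> y R by auto
    have "\<exists>\<eta>\<in>Sp. \<Phi> \<eta> \<in> frontier D"
      using sep[OF conS(1) tp(1) inp[OF tp(2)] \<zeta>S(1)] notin(1) by blast
    then obtain s where s: "Im \<zeta> \<le> s" "s \<le> y" "\<Phi> (Complex (Re \<zeta>) s) \<in> frontier D" by (auto simp: Sp_def)
    have "\<exists>\<eta>\<in>Sm. \<Phi> \<eta> \<in> frontier D"
      using sep[OF conS(2) tm(1) inm[OF tm(2)] \<zeta>S(2)] notin(1) by blast
    then obtain s' where s': "- y \<le> s'" "s' \<le> Im \<zeta>" "\<Phi> (Complex (Re \<zeta>) s') \<in> frontier D" by (auto simp: Sm_def)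
    \<comment> \<open>Both segments join the exterior point to \<open>D\<close> and so cross the
      frontier. By the graph property the two crossings coincide; one is not below and the other not
      above \<zeta>, so this point is \<zeta> itself.\<close>
    have "Complex (Re \<zeta>) s = Complex (Re \<zeta>) s'"
      by (rule graph'[OF s(3) s'(3)]) (use R s s' y in auto)
    then have "s = Im \<zeta>" using s(1) s'(2) by simp
    then have "\<Phi> \<zeta> \<in> frontier D" using s(3) by simp
    then show False using notin by simp
  qed
  \<comment> \<open>The sign records which side is free of \<open>D\<close>; the axis of the cone
    condition is \<open>\<sigma> * \<i> * T\<close>.\<close>
  then obtain \<sigma> :: real where \<sigma>: "\<sigma> = 1 \<or> \<sigma> = - 1" and nD: "\<And>\<zeta>. \<bar>Re \<zeta>\<bar> < \<rho> \<Longrightarrow> 2 * \<kappa> * \<bar>Re \<zeta>\<bar> < - (\<sigma> * Im \<zeta>) \<Longrightarrow> \<bar>Im \<zeta>\<bar> < \<rho> \<Longrightarrow> \<Phi> \<zeta> \<notin> D"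
  proof (elim disjE)
    assume a: "\<forall>\<zeta>\<in>Pp. \<Phi> \<zeta> \<notin> D"
    show thesis by (rule that[of "- 1"]) (use a in \<open>auto simp: Pp_def\<close>)
  next
    assume a: "\<forall>\<zeta>\<in>Pm. \<Phi> \<zeta> \<notin> D"
    show thesis by (rule that[of 1]) (use a in \<open>auto simp: Pm_def\<close>)
  qed
  show ?thesis
  proof (intro exI[of _ "\<sigma> * \<i> * T"] conjI ballI)
    show "norm (\<sigma> * \<i> * T) = 1" using \<sigma> T by (auto simp: norm_mult)
    fix z assume z: "z \<in> D \<inter> ball z0 \<rho>"
    define \<zeta> where "\<zeta> = (z - z0) * cnj T"
    have n: "norm \<zeta> = norm (z - z0)" using T by (simp add: \<zeta>_def norm_mult)
    have R: "\<bar>Re \<zeta>\<bar> < \<rho>" "\<bar>Im \<zeta>\<bar> < \<rho>"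
      using abs_Re_le_cmod[of \<zeta>] abs_Im_le_cmod[of \<zeta>] z n by (auto simp: dist_norm norm_minus_commute)
    have "\<Phi> \<zeta> \<in> D" using z point by (simp add: \<zeta>_def)
    then have "- (\<sigma> * Im \<zeta>) \<le> 2 * \<kappa> * \<bar>Re \<zeta>\<bar>" using nD[of \<zeta>] R by force
    also have "\<dots> \<le> 2 * \<kappa> * norm (z - z0)" unfolding n[symmetric] using \<kappa> abs_Re_le_cmod by (intro mult_left_mono) auto
    finally have "- (2 * \<kappa>) * norm (z - z0) \<le> \<sigma> * Im \<zeta>" by simp
    also have "\<sigma> * Im \<zeta> = Re ((z - z0) * cnj (\<sigma> * \<i> * T))" by (simp add: \<zeta>_def algebra_simps)
    finally show "- (2 * \<kappa>) * norm (z - z0) \<le> Re ((z - z0) * cnj (\<sigma> * \<i> * T))" .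
  qed
qed

text \<open>Uniform continuity of \<open>\<gamma>'\<close> keeps arcs of parameter radius \<tau>
  within relative error \<kappa> of their tangents; compactness and injectivity keep the rest of the
  curve at distance at least \<open>r1\<close>. Both numbers are independent of the boundary
  point.\<close>

lemma smooth_jordan_domain_ext_cone:
  assumes "smooth_jordan_domain D" "s > 0"
  shows "\<exists>r>0. ext_cone D s r"
proof -
  obtain c \<gamma>' where c: "continuous_on (sphere 0 1) c" "inj_on c (sphere 0 1)" "c ` sphere 0 1 = frontier D"
    and d: "\<And>t. ((\<lambda>t. c (cis t)) has_vector_derivative \<gamma>' t) (at t)" and nz: "\<And>t. \<gamma>' t \<noteq> 0"
    and c': "continuous_on UNIV \<gamma>'"
    using assms(1) unfolding smooth_jordan_domain_def jordan_parametrization_def by blast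
  define \<gamma> where "\<gamma> = (\<lambda>t. c (cis t))"
  have d\<gamma>: "(\<gamma> has_vector_derivative \<gamma>' t) (at t)" for t using d by (simp add: \<gamma>_def)
  have c\<gamma>: "continuous_on S \<gamma>" for S
    using d\<gamma> by (meson continuous_at_imp_continuous_on has_vector_derivative_continuous)
  \<comment> \<open>\<open>Arg\<close> yields parameters in \<open>[-pi, pi]\<close>, and
    neighbouring parameters differ from them by at most \<open>pi\<close>; the interval holds
    both.\<close>
  define I where "I = {- (2 * pi)..2 * pi}"
  have cI: "continuous_on I \<gamma>'" using c' continuous_on_subset by blast
  have "continuous_on I (\<lambda>t. norm (\<gamma>' t))" using cI by (intro continuous_intros)
  then obtain t1 where t1: "t1 \<in> I" "\<And>t. t \<in> I \<Longrightarrow> norm (\<gamma>' t1) \<le> norm (\<gamma>' t)"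
    using continuous_attains_inf[of I "\<lambda>t. norm (\<gamma>' t)"] by (auto simp: I_def)
  define m where "m = norm (\<gamma>' t1)"
  have m: "m > 0" "\<And>t. t \<in> I \<Longrightarrow> m \<le> norm (\<gamma>' t)" using nz t1 by (auto simp: m_def)
  \<comment> \<open>\<open>2 \<kappa> \<le> s\<close> is the slope asked for, and
    \<open>\<kappa> \<le> 1/4\<close> makes the tangential coordinate at least half of its linear
    approximation.\<close>
  define \<kappa> where "\<kappa> = min (s / 2) (1 / 4)"
  have \<kappa>: "\<kappa> > 0" "\<kappa> \<le> 1 / 4" "2 * \<kappa> \<le> s" using assms(2) by (auto simp: \<kappa>_def)
  have "uniformly_continuous_on I \<gamma>'" by (rule compact_uniformly_continuous[OF cI]) (simp add: I_def)
  then obtain \<tau>0 where \<tau>0: "\<tau>0 > 0" "\<And>t t'. t \<in> I \<Longrightarrow> t' \<in> I \<Longrightarrow> dist t' t < \<tau>0 \<Longrightarrow> dist (\<gamma>' t') (\<gamma>' t) < \<kappa> * m"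
    unfolding uniformly_continuous_on_def using \<kappa> m by (metis mult_pos_pos)
  define \<tau> where "\<tau> = min \<tau>0 pi"
  have \<tau>: "\<tau> > 0" "\<tau> \<le> \<tau>0" "\<tau> \<le> pi" using \<tau>0 by (auto simp: \<tau>_def)
  \<comment> \<open>Mean value inequality for the curve minus its linear part at \<open>t0\<close>,
    whose derivative is small by the choice of \<open>\<tau>0\<close>.\<close>
  have lin: "norm (\<gamma> t - \<gamma> t' - (t - t') *\<^sub>R \<gamma>' t0) \<le> \<kappa> * norm (\<gamma>' t0) * \<bar>t - t'\<bar>"
    if t0: "\<bar>t0\<bar> \<le> pi" and t: "\<bar>t - t0\<bar> < \<tau>" "\<bar>t' - t0\<bar> < \<tau>" for t0 t t'
  proof -
    let ?J = "{t0 - \<tau><..<t0 + \<tau>}"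
    have t0I: "t0 \<in> I" using t0 pi_gt_zero unfolding I_def by (auto simp: abs_le_iff)
    have "norm ((\<gamma> t - t *\<^sub>R \<gamma>' t0) - (\<gamma> t' - t' *\<^sub>R \<gamma>' t0)) \<le> (\<kappa> * norm (\<gamma>' t0)) * norm (t - t')"
    proof (rule differentiable_bound[of ?J "\<lambda>t. \<gamma> t - t *\<^sub>R \<gamma>' t0" "\<lambda>u h. h *\<^sub>R (\<gamma>' u - \<gamma>' t0)"])
      fix u assume u: "u \<in> ?J"
      have uI: "u \<in> I" using u t0 \<tau>(3) unfolding I_def by (auto simp: abs_le_iff)
      have "((\<lambda>t. \<gamma> t - t *\<^sub>R \<gamma>' t0) has_vector_derivative (\<gamma>' u - 1 *\<^sub>R \<gamma>' t0)) (at u)"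
        by (intro has_vector_derivative_diff d\<gamma> has_vector_derivative_scaleR[where g="\<lambda>_. \<gamma>' t0", THEN has_vector_derivative_eq_rhs])
          (auto intro!: derivative_eq_intros)
      then show "((\<lambda>t. \<gamma> t - t *\<^sub>R \<gamma>' t0) has_derivative (\<lambda>h. h *\<^sub>R (\<gamma>' u - \<gamma>' t0))) (at u within ?J)"
        by (simp add: has_vector_derivative_def has_derivative_at_withinI)
      have "dist u t0 < \<tau>0" using u \<tau>(2) by (auto simp: dist_real_def)
      then have "norm (\<gamma>' u - \<gamma>' t0) < \<kappa> * m" using \<tau>0(2)[OF t0I uI] by (simp add: dist_norm)
      also have "\<dots> \<le> \<kappa> * norm (\<gamma>' t0)" using \<kappa> m(2)[OF t0I] by (intro mult_left_mono) auto
      finally have "norm (\<gamma>' u - \<gamma>' t0) \<le> \<kappa> * norm (\<gamma>' t0)" by simp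
      then show "onorm (\<lambda>h. h *\<^sub>R (\<gamma>' u - \<gamma>' t0)) \<le> \<kappa> * norm (\<gamma>' t0)"
        using \<kappa> by (intro onorm_bound) (auto simp: mult.commute intro: mult_left_mono)
    qed (use t in auto)
    then show ?thesis by (simp add: algebra_simps)
  qed
  \<comment> \<open>Pairs of parameters at distance between \<tau> and \<open>pi\<close>. Such a
    distance is no multiple of \<open>2 pi\<close>, so the curve takes different values and their
    distance attains a positive minimum.\<close>
  define K where "K = ({- pi..pi} \<times> I) \<inter> {p. \<tau> \<le> \<bar>snd p - fst p\<bar>} \<inter> {p. \<bar>snd p - fst p\<bar> \<le> pi}"
  have "compact K" unfolding K_def I_def
    by (intro compact_Int_closed closed_Collect_le continuous_intros compact_Times compact_Icc)
  moreover have "(0, pi) \<in> K" using \<tau> pi_gt_zero by (simp add: K_def I_def)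
  then have "K \<noteq> {}" by blast
  moreover have "continuous_on K (\<lambda>p. norm (\<gamma> (snd p) - \<gamma> (fst p)))"
    by (intro continuous_intros continuous_on_compose2[OF c\<gamma>[of UNIV]]) auto
  ultimately obtain p where p: "p \<in> K" "\<And>q. q \<in> K \<Longrightarrow> norm (\<gamma> (snd p) - \<gamma> (fst p)) \<le> norm (\<gamma> (snd q) - \<gamma> (fst q))"
    using continuous_attains_inf by (metis (no_types, lifting))
  define r1 where "r1 = norm (\<gamma> (snd p) - \<gamma> (fst p))"
  have "\<gamma> (snd p) \<noteq> \<gamma> (fst p)"
  proof
    assume "\<gamma> (snd p) = \<gamma> (fst p)"
    then have "cis (snd p) = cis (fst p)" using c(2) by (auto simp: \<gamma>_def inj_on_def)
    then have "cis (snd p - fst p) = 1" by (simp add: cis_divide[symmetric])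
    then have "cos (snd p - fst p) = 1" by (metis cis.simps(1) one_complex.sel(1))
    then have "cos \<bar>snd p - fst p\<bar> = 1" by (simp only: cos_abs_real)
    moreover have "cos \<bar>snd p - fst p\<bar> < cos 0"
      using p(1) \<tau> by (intro cos_monotone_0_pi) (auto simp: K_def)
    ultimately show False by simp
  qed
  then have r1: "r1 > 0" by (simp add: r1_def)
  obtain E where E: "E \<inter> D = {}" "E \<inter> frontier D = {}" "frontier D \<subseteq> closure E"
    using jordan_domain_outside[of D] assms(1) unfolding smooth_jordan_domain_def by blast
  have "ext_cone D s (r1 / 2)"
    unfolding ext_cone_def
  proof
    fix z0 assume z0: "z0 \<in> frontier D"
    then obtain w0 where w0: "norm w0 = 1" "z0 = c w0" using c(3) by force
    define t0 where "t0 = Arg w0"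
    have w0cis: "w0 = cis t0" using w0(1) rcis_cmod_Arg[of w0] by (simp add: t0_def rcis_def)
    have t0: "\<bar>t0\<bar> \<le> pi" using Arg_bounded[of w0] by (auto simp: t0_def)
    have z0\<gamma>: "z0 = \<gamma> t0" by (simp add: \<gamma>_def w0 w0cis[symmetric])
    \<comment> \<open>The parameter of \<open>z\<close> is taken relative to \<open>t0\<close>, by
      the argument of \<open>w / w0\<close>, so that the closing point of the parametrization plays
      no special part.\<close>
    have near: "\<exists>t. \<bar>t - t0\<bar> < \<tau> \<and> z = \<gamma> t" if z: "z \<in> frontier D" "norm (z - z0) < r1" for z
    proof -
      obtain w where w: "norm w = 1" "z = c w" using z(1) c(3) by force
      define \<theta> where "\<theta> = Arg (w / w0)"
      have "norm (w / w0) = 1" using w w0 by (simp add: norm_divide)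
      then have "w / w0 = cis \<theta>" using rcis_cmod_Arg[of "w / w0"] by (simp add: \<theta>_def rcis_def)
      moreover have "w0 \<noteq> 0" using w0(1) by auto
      ultimately have "w = w0 * cis \<theta>" by (simp add: field_simps)
      then have "w = cis (t0 + \<theta>)" by (simp add: w0cis cis_mult)
      then have z\<gamma>: "z = \<gamma> (t0 + \<theta>)" by (simp add: \<gamma>_def w)
      have \<theta>: "\<bar>\<theta>\<bar> \<le> pi" using Arg_bounded[of "w / w0"] by (auto simp: \<theta>_def)
      have "\<bar>\<theta>\<bar> < \<tau>"
      proof (rule ccontr)
        assume "\<not> \<bar>\<theta>\<bar> < \<tau>"
        then have "(t0, t0 + \<theta>) \<in> K" using t0 \<theta> by (auto simp: K_def I_def abs_le_iff)
        then have "r1 \<le> norm (z - z0)" using p(2) unfolding r1_def z\<gamma> z0\<gamma> by force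
        then show False using z(2) by simp
      qed
      then show ?thesis using z\<gamma> by (intro exI[of _ "t0 + \<theta>"]) simp
    qed
    define A where "A = norm (\<gamma>' t0)"
    have A: "A > 0" using nz by (simp add: A_def)
    define T where "T = sgn (\<gamma>' t0)"
    have T: "norm T = 1" using nz by (simp add: T_def norm_sgn)
    have TT: "T * cnj T = 1" using T by (simp add: complex_norm_square[symmetric])
    have \<gamma>T: "\<gamma>' t0 * cnj T = A"
    proof -
      have "\<gamma>' t0 = A * T" using nz by (simp add: T_def A_def sgn_div_norm scaleR_conv_of_real)
      then show ?thesis using TT by (simp add: mult.assoc)
    qed
    have lin': "norm ((\<gamma> t - \<gamma> t') * cnj T - of_real ((t - t') * A)) \<le> \<kappa> * A * \<bar>t - t'\<bar>"
      if t: "\<bar>t - t0\<bar> < \<tau>" "\<bar>t' - t0\<bar> < \<tau>" for t t'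
    proof -
      have "(\<gamma> t - \<gamma> t') * cnj T - of_real ((t - t') * A) = (\<gamma> t - \<gamma> t' - (t - t') *\<^sub>R \<gamma>' t0) * cnj T"
        using \<gamma>T by (simp add: left_diff_distrib scaleR_conv_of_real mult.assoc)
      then show ?thesis using lin[OF t0 t] T by (simp add: norm_mult A_def)
    qed
    have "\<exists>e. norm e = 1 \<and> (\<forall>z\<in>D \<inter> ball z0 (r1 / 2). Re ((z - z0) * cnj e) \<ge> - (2 * \<kappa>) * norm (z - z0))"
    proof (rule ext_cone_at[OF E(1,2) _ T \<kappa>(1,2)])
      show "z0 \<in> closure E" using E(3) z0 by auto
      show "r1 / 2 > 0" using r1 by simp
      fix z assume z: "z \<in> frontier D" "norm (z - z0) < 2 * (r1 / 2)"
      obtain t where t: "\<bar>t - t0\<bar> < \<tau>" "z = \<gamma> t" using near[of z] z by auto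
      have b: "norm ((z - z0) * cnj T - of_real ((t - t0) * A)) \<le> \<kappa> * A * \<bar>t - t0\<bar>"
        using lin'[OF t(1), of t0] \<tau> unfolding z0\<gamma> t(2) by simp
      have ReA: "\<bar>Re ((z - z0) * cnj T) - (t - t0) * A\<bar> \<le> \<kappa> * A * \<bar>t - t0\<bar>"
        using order_trans[OF abs_Re_le_cmod b] by simp
      have ImA: "\<bar>Im ((z - z0) * cnj T)\<bar> \<le> \<kappa> * A * \<bar>t - t0\<bar>"
        using order_trans[OF abs_Im_le_cmod b] by simp
      have kA: "\<kappa> * A * \<bar>t - t0\<bar> \<le> 1/4 * (A * \<bar>t - t0\<bar>)"
        unfolding mult.assoc[of \<kappa>] using \<kappa> A by (intro mult_right_mono) auto
      have "\<bar>(t - t0) * A\<bar> = A * \<bar>t - t0\<bar>" using A by (simp add: abs_mult)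
      then have "A * \<bar>t - t0\<bar> \<le> \<bar>Re ((z - z0) * cnj T)\<bar> + \<kappa> * A * \<bar>t - t0\<bar>"
        using ReA abs_triangle_ineq2_sym[of "Re ((z - z0) * cnj T)" "(t - t0) * A"] by linarith
      then have "A * \<bar>t - t0\<bar> \<le> 2 * \<bar>Re ((z - z0) * cnj T)\<bar>"
        using kA mult_nonneg_nonneg[OF less_imp_le[OF A] abs_ge_zero[of "t - t0"]] by linarith
      then have "\<kappa> * (A * \<bar>t - t0\<bar>) \<le> \<kappa> * (2 * \<bar>Re ((z - z0) * cnj T)\<bar>)" using \<kappa> by (intro mult_left_mono) auto
      then show "\<bar>Im ((z - z0) * cnj T)\<bar> \<le> 2 * \<kappa> * \<bar>Re ((z - z0) * cnj T)\<bar>"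
        using ImA by (simp add: mult_ac)
    next
      fix z w assume z: "z \<in> frontier D" "norm (z - z0) < 2 * (r1 / 2)" and w: "w \<in> frontier D" "norm (w - z0) < 2 * (r1 / 2)"
        and eq: "Re ((z - z0) * cnj T) = Re ((w - z0) * cnj T)"
      obtain t where t: "\<bar>t - t0\<bar> < \<tau>" "z = \<gamma> t" using near[of z] z by auto
      obtain t' where t': "\<bar>t' - t0\<bar> < \<tau>" "w = \<gamma> t'" using near[of w] w by auto
      \<comment> \<open>Equal tangential coordinates force
        \<open>A |t - t'| \<le> \<kappa> A |t - t'|\<close>, so the parameters coincide: the arc is
        a graph over its tangent.\<close>
      have "\<bar>Re ((z - w) * cnj T) - (t - t') * A\<bar> \<le> \<kappa> * A * \<bar>t - t'\<bar>"
        using order_trans[OF abs_Re_le_cmod lin'[OF t(1) t'(1)]] unfolding t(2) t'(2) by simp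
      moreover have "Re ((z - w) * cnj T) = 0" using eq by (simp add: algebra_simps)
      moreover have "\<bar>(t - t') * A\<bar> = A * \<bar>t - t'\<bar>" using A by (simp add: abs_mult)
      moreover have "\<kappa> * (A * \<bar>t - t'\<bar>) \<le> 1/4 * (A * \<bar>t - t'\<bar>)" using \<kappa> A by (intro mult_right_mono) auto
      ultimately have "A * \<bar>t - t'\<bar> \<le> 0" by (simp add: mult.assoc)
      then have "t = t'" using A by (simp add: mult_le_0_iff)
      then show "z = w" using t t' by simp
    qed
    then obtain e where e: "norm e = 1" "\<And>z. z \<in> D \<inter> ball z0 (r1 / 2) \<Longrightarrow> Re ((z - z0) * cnj e) \<ge> - (2 * \<kappa>) * norm (z - z0)"
      by blast
    have "- s * norm (z - z0) \<le> - (2 * \<kappa>) * norm (z - z0)" for z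
      using \<kappa>(3) by (intro mult_right_mono) auto
    then show "\<exists>e. norm e = 1 \<and> (\<forall>z\<in>D \<inter> ball z0 (r1 / 2). - s * norm (z - z0) \<le> Re ((z - z0) * cnj e))"
      using e order_trans by blast
  qed
  then show ?thesis using r1 by (intro exI[of _ "r1 / 2"]) simp
qed

section \<open>Hoelder estimates\<close>

lemma holder_onI:
  assumes "\<And>x y. x \<in> S \<Longrightarrow> y \<in> S \<Longrightarrow> dist (f x) (f y) \<le> C * dist x y powr \<alpha>"
  shows "holder_on \<alpha> S f"
  using assms unfolding holder_on_def by blast

lemma holder_onE:
  assumes "holder_on \<alpha> S f"
  obtains C where "C \<ge> 0" "\<And>x y. x \<in> S \<Longrightarrow> y \<in> S \<Longrightarrow> dist (f x) (f y) \<le> C * dist x y powr \<alpha>"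
proof -
  obtain C where C: "\<forall>x\<in>S. \<forall>y\<in>S. dist (f x) (f y) \<le> C * dist x y powr \<alpha>"
    using assms unfolding holder_on_def by blast
  have "C * dist x y powr \<alpha> \<le> max 0 C * dist x y powr \<alpha>" for x y :: 'a
    by (intro mult_right_mono) auto
  then have "dist (f x) (f y) \<le> max 0 C * dist x y powr \<alpha>" if "x \<in> S" "y \<in> S" for x y
    using C that order_trans by blast
  then show thesis by (rule that[of "max 0 C", rotated]) auto
qed

text \<open>The barrier estimate bounds only from above; as the right-hand side is bounded on both
  sides, it applies to \<open>U\<close> and to \<open>- U\<close>.\<close>

lemma boundary_growth:
  assumes D: "open D" "bounded D" and cone: "ext_cone D (sin \<tau>) r" "r > 0" "0 < \<tau>" "\<tau> < pi / 2"
    and \<beta>: "0 < \<beta>" "\<beta> < 1" "\<beta> * (pi / 2 + \<tau>) < pi / 2"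
    and U: "continuous_on (closure D) U" "poisson D U f" and f: "\<And>z. z \<in> D \<Longrightarrow> \<bar>f z\<bar> \<le> B"
    and h: "holder_on \<beta> (frontier D) U"
  shows "\<exists>M\<ge>0. \<forall>z0\<in>frontier D. \<forall>z\<in>closure D. \<bar>U z - U z0\<bar> \<le> M * norm (z - z0) powr \<beta>"
proof -
  obtain C where C: "C \<ge> 0" "\<And>x y. x \<in> frontier D \<Longrightarrow> y \<in> frontier D \<Longrightarrow> \<bar>U x - U y\<bar> \<le> C * norm (x - y) powr \<beta>"
    by (rule holder_onE[OF h]) (simp add: dist_norm that)
  have "compact (closure D)" using D by simp
  then have "bounded (U ` closure D)" by (intro compact_imp_bounded compact_continuous_image U)
  then obtain A where A: "\<And>z. z \<in> closure D \<Longrightarrow> \<bar>U z\<bar> \<le> A" unfolding bounded_iff by auto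
  define B' where "B' = max 0 B"
  have B': "B' \<ge> 0" "\<And>z. z \<in> D \<Longrightarrow> \<bar>f z\<bar> \<le> B'"
    unfolding B'_def using f by (simp_all add: max.coboundedI2)
  define M where "M = (C + B' / 4 * r powr (2 - \<beta>) + 2 * A / r powr \<beta>) / cos (\<beta> * (pi / 2 + \<tau>))"
  have sub1: "subsol D U B'"
    by (rule poisson_subsol[OF D(2) U]) (use B'(2) in \<open>force simp: abs_le_iff\<close>)
  have sub2: "subsol D (\<lambda>z. - U z) B'"
    by (rule poisson_subsol[OF D(2) continuous_on_minus[OF U(1)] poisson_uminus[OF U(2)]]) (use B'(2) in \<open>force simp: abs_le_iff\<close>)
  have "\<bar>U z - U z0\<bar> \<le> M * norm (z - z0) powr \<beta>" if z0: "z0 \<in> frontier D" and z: "z \<in> closure D" for z0 z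
  proof -
    have "U z \<le> U z0 + M * norm (z - z0) powr \<beta>"
      unfolding M_def
      by (rule subsol_boundary_growth[OF D(1) cone \<beta> z0 sub1 B'(1) A C(1) _ z]) (use C(2)[OF _ z0] in \<open>force simp: abs_le_iff\<close>)+
    moreover have "- U z \<le> - U z0 + M * norm (z - z0) powr \<beta>"
      unfolding M_def
      by (rule subsol_boundary_growth[OF D(1) cone \<beta> z0 sub2 B'(1) _ C(1) _ z]) (use A C(2)[OF _ z0] in \<open>force simp: abs_le_iff\<close>)+
    ultimately show ?thesis by linarith
  qed
  moreover have "M \<ge> 0" if "z0 \<in> frontier D" for z0
  proof -
    have "A \<ge> 0" using A[of z0] that by (simp add: frontier_def)
    moreover have "cos (\<beta> * (pi / 2 + \<tau>)) > 0" using \<beta> cone by (intro cos_gt_zero) auto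
    ultimately show ?thesis using C(1) B' by (simp add: M_def)
  qed
  ultimately have "\<forall>z0\<in>frontier D. \<forall>z\<in>closure D. \<bar>U z - U z0\<bar> \<le> max 0 M * norm (z - z0) powr \<beta>"
    by (simp add: max_absorb2)
  then show ?thesis by (intro exI[of _ "max 0 M"]) simp
qed

text \<open>Near the boundary the modulus of continuity comes from the boundary growth, and at distance
  \<open>d\<close> from it, from the gradient bound on the disc of radius \<open>d\<close>.\<close>

lemma holder_closure:
  assumes D: "open D" "bounded D" "D \<noteq> {}" and \<beta>: "0 < \<beta>" "\<beta> < 1"
    and U: "poisson D U f" and f: "\<And>z. z \<in> D \<Longrightarrow> \<bar>f z\<bar> \<le> B"
    and M: "M \<ge> 0" "\<And>z0 z. z0 \<in> frontier D \<Longrightarrow> z \<in> closure D \<Longrightarrow> \<bar>U z - U z0\<bar> \<le> M * norm (z - z0) powr \<beta>"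
  shows "holder_on \<beta> (closure D) U"
proof -
  have "D \<noteq> UNIV" using D(2) not_bounded_UNIV by blast
  then have fr: "frontier D \<noteq> {}" using D(3) frontier_not_empty by blast
  have B0: "B \<ge> 0" using D(3) f by (meson abs_ge_zero all_not_in_conv order_trans)
  define d0 where "d0 = diameter (closure D)"
  \<comment> \<open>At distance \<open>d\<close> from the frontier, the Lipschitz constant on the
    half disc is at most \<open>K d^(\<beta>-1)\<close>. The factor \<open>2^\<beta>\<close> arises
    because points of the disc are within \<open>2 d\<close> of the nearest frontier point;
    \<open>d0\<close> bounds \<open>d\<close>.\<close>
  define K where "K = 8 * (M * 2 powr \<beta>) + B * d0 powr (2 - \<beta>) / 8"
  define C where "C = M * (2 powr \<beta> + 3 powr \<beta>) + K"
  have d0: "d0 \<ge> 0" unfolding d0_def by (rule diameter_ge_0) (use D in \<open>simp add: bounded_closure\<close>)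
  have K: "K \<ge> 0" using M(1) B0 by (simp add: K_def)
  show ?thesis
  proof (rule holder_onI)
    fix x y assume x: "x \<in> closure D" and y: "y \<in> closure D"
    \<comment> \<open>If \<open>x\<close> is within \<open>2 |x - y|\<close> of a frontier point,
      then \<open>y\<close> is within \<open>3 |x - y|\<close> of it, and both values are compared
      with the one there.\<close>
    have near: "dist (U x) (U y) \<le> M * (2 powr \<beta> + 3 powr \<beta>) * dist x y powr \<beta>"
      if z0: "z0 \<in> frontier D" and le: "dist x z0 \<le> 2 * dist x y" for z0
    proof -
      have "dist y z0 \<le> 3 * dist x y" using dist_triangle[of y z0 x] le by (simp add: dist_commute)
      then have "norm (y - z0) powr \<beta> \<le> (3 * dist x y) powr \<beta>" using \<beta> by (intro powr_mono2) (auto simp: dist_norm)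
      moreover have "norm (x - z0) powr \<beta> \<le> (2 * dist x y) powr \<beta>" using \<beta> le by (intro powr_mono2) (auto simp: dist_norm)
      ultimately have "M * norm (x - z0) powr \<beta> + M * norm (y - z0) powr \<beta> \<le> M * (2 * dist x y) powr \<beta> + M * (3 * dist x y) powr \<beta>"
        using M(1) by (intro add_mono mult_left_mono) auto
      also have "\<dots> = M * (2 powr \<beta> + 3 powr \<beta>) * dist x y powr \<beta>" by (simp add: powr_mult algebra_simps)
      finally show ?thesis using M(2)[OF z0 x] M(2)[OF z0 y] unfolding dist_real_def by linarith
    qed
    have fin: "M * (2 powr \<beta> + 3 powr \<beta>) * dist x y powr \<beta> \<le> C * dist x y powr \<beta>"
      "K * dist x y powr \<beta> \<le> C * dist x y powr \<beta>"
      using K M(1) by (auto simp: C_def intro!: mult_right_mono)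
    show "dist (U x) (U y) \<le> C * dist x y powr \<beta>"
    proof (cases "x \<in> D")
      case False
      then have "x \<in> frontier D" using x D(1) by (simp add: frontier_def interior_open)
      then show ?thesis using near[of x] fin(1) by simp
    next
      case True
      obtain z0 where z0: "z0 \<in> frontier D" "\<And>w. w \<in> frontier D \<Longrightarrow> dist x z0 \<le> dist x w"
        using distance_attains_inf[OF frontier_closed fr, of x] by blast
      define d where "d = dist x z0"
      have "x \<noteq> z0" using True z0(1) D(1) frontier_disjoint_eq[of D] by blast
      then have d: "d > 0" by (simp add: d_def)
      have ball: "ball x d \<subseteq> D"
      proof (rule ccontr)
        assume "\<not> ball x d \<subseteq> D"
        then have "ball x d \<inter> frontier D \<noteq> {}"
          by (intro connected_Int_frontier[OF connected_ball]) (use True d centre_in_ball in blast)+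
        then show False using z0(2) unfolding d_def by fastforce
      qed
      show ?thesis
      proof (cases "d \<le> 2 * dist x y")
        case True
        then show ?thesis using near[OF z0(1)] fin(1) unfolding d_def by linarith
      next
        case False
        have inb: "\<bar>U w - U z0\<bar> \<le> M * (2 * d) powr \<beta>" if w: "w \<in> ball x d" for w
        proof -
          have wD: "w \<in> closure D" using w ball closure_subset[of D] by blast
          have "dist w z0 \<le> 2 * d" using dist_triangle[of w z0 x] w by (simp add: d_def dist_commute)
          then have "norm (w - z0) powr \<beta> \<le> (2 * d) powr \<beta>" using \<beta> by (intro powr_mono2) (auto simp: dist_norm)
          then show ?thesis using M(2)[OF z0(1) wD] mult_left_mono[OF _ M(1)] order_trans by blast
        qed
        \<comment> \<open>Subtracting the constant \<open>U z0\<close> leaves a function of size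
          \<open>d^\<beta>\<close> on the disc, so that dividing by the radius gives
          \<open>d^(\<beta>-1)\<close>.\<close>
        have "poisson (ball x d) (\<lambda>w. U w - U z0) (\<lambda>w. f w - 0)"
          by (intro poisson_diff poisson_subset[OF U ball] c2_on_imp_poisson[OF c2_on_const])
        from poisson_lipschitz[OF this d inb, of B x y]
        have "\<bar>(U x - U z0) - (U y - U z0)\<bar> \<le> (8 * (M * (2 * d) powr \<beta>) / d + B * d / 8) * dist x y"
          using False d f ball by (auto simp: subset_iff)
        also have "8 * (M * (2 * d) powr \<beta>) / d + B * d / 8 \<le> K * d powr (\<beta> - 1)"
        proof -
          have "d \<le> d0"
            using diameter_bounded_bound[OF bounded_closure[OF D(2)], of x z0] x z0(1)
            by (simp add: d_def d0_def frontier_def)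
          then have "d powr (2 - \<beta>) \<le> d0 powr (2 - \<beta>)" using d \<beta> by (intro powr_mono2) auto
          then have "B / 8 * (d powr (2 - \<beta>)) * d powr (\<beta> - 1) \<le> B / 8 * d0 powr (2 - \<beta>) * d powr (\<beta> - 1)"
            using B0 by (intro mult_right_mono mult_left_mono) auto
          moreover have "d powr (2 - \<beta>) * d powr (\<beta> - 1) = d" using d by (simp add: powr_add[symmetric])
          ultimately have "B * d / 8 \<le> B / 8 * d0 powr (2 - \<beta>) * d powr (\<beta> - 1)"
            by (simp add: mult.assoc)
          moreover have "8 * (M * (2 * d) powr \<beta>) / d = 8 * (M * 2 powr \<beta>) * d powr (\<beta> - 1)"
            using d by (simp add: powr_mult powr_diff)
          ultimately show ?thesis by (simp add: K_def distrib_right)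
        qed
        then have "(8 * (M * (2 * d) powr \<beta>) / d + B * d / 8) * dist x y \<le> K * d powr (\<beta> - 1) * dist x y"
          by (rule mult_right_mono) simp
        \<comment> \<open>Here \<open>|x - y| < d / 2\<close>, and the exponent
          \<open>\<beta> - 1\<close> is negative.\<close>
        also have "\<dots> \<le> K * dist x y powr \<beta>"
        proof (cases "x = y")
          case False
          have "d powr (\<beta> - 1) \<le> dist x y powr (\<beta> - 1)"
            using \<beta> False \<open>\<not> d \<le> 2 * dist x y\<close> zero_le_dist[of x y] by (intro powr_mono2') (simp, simp, linarith)
          then have "d powr (\<beta> - 1) * dist x y \<le> dist x y powr (\<beta> - 1) * dist x y" by (intro mult_right_mono) auto
          also have "\<dots> = dist x y powr \<beta>" using False by (simp add: powr_diff)
          finally have "K * (d powr (\<beta> - 1) * dist x y) \<le> K * dist x y powr \<beta>" using K by (rule mult_left_mono)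
          then show ?thesis by (simp add: mult.assoc)
        qed simp
        finally show ?thesis using fin(2) by (simp add: dist_real_def)
      qed
    qed
  qed
qed

section \<open>Regularity of the gradient\<close>

lemma poisson_translate:
  assumes "poisson S V f"
  shows "poisson {z. a + z \<in> S} (\<lambda>z. V (a + z)) (\<lambda>z. f (a + z))"
  unfolding poisson_def
proof (intro allI impI)
  fix e :: real assume "e > 0"
  from poissonE[OF assms this] obtain W g p where W: "c2_on S W g p"
    "\<And>z. z \<in> S \<Longrightarrow> \<bar>W z - V z\<bar> < e" "\<And>z. z \<in> S \<Longrightarrow> \<bar>p z - f z\<bar> < e" by metis
  have "c2_on {z. a + z \<in> S} (\<lambda>z. W (a + z)) (\<lambda>z. g (a + z)) (\<lambda>z. p (a + z))"
    using c2_on_rotate[OF W(1), of 1 a] by simp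
  then show "\<exists>W g p. c2_on {z. a + z \<in> S} W g p \<and> (\<forall>z\<in>{z. a + z \<in> S}. \<bar>W z - V (a + z)\<bar> < e \<and> \<bar>p z - f (a + z)\<bar> < e)"
    using W(2,3) by (intro exI[of _ "\<lambda>z. W (a + z)"], intro exI[of _ "\<lambda>z. g (a + z)"], intro exI[of _ "\<lambda>z. p (a + z)"]) simp
qed

text \<open>
  The gradient is locally Lipschitz because the gradient bound applies to the difference
  \<open>U(z + k) - U(z)\<close>, which solves an equation with right-hand side of size \<open>O(k)\<close>.
\<close>

lemma poisson_gradient_lipschitz:
  assumes U: "poisson (ball a r) U f" "r > 0"
    and A: "\<And>z. z \<in> ball a r \<Longrightarrow> \<bar>U z\<bar> \<le> A" and B: "\<And>z. z \<in> ball a r \<Longrightarrow> \<bar>f z\<bar> \<le> B"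
    and f: "\<And>x y. x \<in> ball a r \<Longrightarrow> y \<in> ball a r \<Longrightarrow> \<bar>f x - f y\<bar> \<le> H * \<bar>U x - U y\<bar>" "H \<ge> 0"
    and G: "\<And>z. z \<in> ball a r \<Longrightarrow> (U has_derivative (\<lambda>h. G z \<bullet> h)) (at z)"
    and b: "b \<in> ball a (r / 4)"
  shows "norm (G b - G a) \<le> (16 / r + H * r / 16) * (8 * A / r + B * r / 8) * dist b a"
proof -
  define L where "L = 8 * A / r + B * r / 8"
  define k where "k = b - a"
  have k: "norm k < r / 4" "norm k = dist b a" using b by (auto simp: k_def dist_norm norm_minus_commute)
  \<comment> \<open>A shift by \<open>k\<close> with \<open>|k| < r/4\<close> keeps the quarter disc
    inside the half disc, where \<open>poisson_lipschitz\<close> holds.\<close>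
  have in2: "z \<in> ball a (r/2)" "k + z \<in> ball a (r/2)" if z: "z \<in> ball a (r/4)" for z
  proof -
    show "z \<in> ball a (r/2)" using z U(2) by simp
    have "dist a (k + z) \<le> dist a z + norm k"
      using norm_triangle_ineq4[of "a - z" k] by (simp add: dist_norm algebra_simps)
    then show "k + z \<in> ball a (r/2)" using z k by simp
  qed
  have sub: "ball a (r/2) \<subseteq> ball a r" using U(2) by auto
  have lip: "\<bar>U (k + z) - U z\<bar> \<le> L * norm k" if "z \<in> ball a (r/4)" for z
    using poisson_lipschitz[OF U A B in2(2,1)[OF that]] by (simp add: L_def dist_norm)
  have r4: "r / 4 > 0" "ball a (r/4) \<subseteq> ball a (r/4)" using U(2) by auto
  define V where "V = (\<lambda>z. U (k + z) - U z)"
  have V: "poisson (ball a (r/4)) V (\<lambda>z. f (k + z) - f z)"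
    unfolding V_def
  proof (rule poisson_diff)
    show "poisson (ball a (r/4)) (\<lambda>z. U (k + z)) (\<lambda>z. f (k + z))"
      by (rule poisson_subset[OF poisson_translate[OF U(1)]]) (use in2(2) sub in blast)
    show "poisson (ball a (r/4)) U f"
      by (rule poisson_subset[OF U(1)]) (use in2(1) sub in blast)
  qed
  obtain GV where GV: "\<And>z. z \<in> ball a (r/4) \<Longrightarrow> (V has_derivative (\<lambda>h. GV z \<bullet> h)) (at z)"
    and bd: "\<And>b s A B. s > 0 \<Longrightarrow> ball b s \<subseteq> ball a (r/4) \<Longrightarrow> \<forall>z\<in>ball b s. \<bar>V z\<bar> \<le> A \<Longrightarrow>
       \<forall>z\<in>ball b s. \<bar>f (k + z) - f z\<bar> \<le> B \<Longrightarrow> norm (GV b) \<le> 4 * A / s + B * s / 4"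
    by (rule poisson_approximation[OF open_ball V]) (rule that)
  have "norm (GV a) \<le> 4 * (L * norm k) / (r/4) + (H * (L * norm k)) * (r/4) / 4"
  proof (rule bd[OF r4]; intro ballI)
    fix z assume z: "z \<in> ball a (r/4)"
    show "\<bar>V z\<bar> \<le> L * norm k" using lip[OF z] by (simp add: V_def)
    have "\<bar>f (k + z) - f z\<bar> \<le> H * \<bar>U (k + z) - U z\<bar>" using f(1) in2[OF z] sub by blast
    also have "\<dots> \<le> H * (L * norm k)" using lip[OF z] f(2) by (rule mult_left_mono)
    finally show "\<bar>f (k + z) - f z\<bar> \<le> H * (L * norm k)" .
  qed
  also have "\<dots> = (16 / r + H * r / 16) * L * dist b a" using k(2) by (simp add: algebra_simps)
  \<comment> \<open>\<open>poisson_approximation\<close> yields a gradient of its own for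
    \<open>V\<close>; uniqueness of derivatives identifies it.\<close>
  also have "GV a = G b - G a"
  proof -
    have a: "a \<in> ball a (r/4)" "a \<in> ball a r" "b \<in> ball a r" using U(2) b by auto
    have "((\<lambda>z. U (k + z)) has_derivative (\<lambda>h. G b \<bullet> h)) (at a)"
      by (rule has_derivative_compose[where f="\<lambda>z. k + z" and g=U])
        (auto intro!: derivative_eq_intros simp: k_def G[OF a(3)])
    then have "(V has_derivative (\<lambda>h. G b \<bullet> h - G a \<bullet> h)) (at a)"
      unfolding V_def by (intro has_derivative_diff G a)
    from has_derivative_unique[OF this GV[OF a(1)]]
    have "(G b - G a) \<bullet> h = GV a \<bullet> h" for h by (metis inner_diff_left)
    then show ?thesis by (metis inner_commute vector_eq_rdot)
  qed
  finally show ?thesis unfolding L_def .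
qed

text \<open>On nearby pairs the local Lipschitz bound for the gradient is traded for order \<alpha>
  with the factor \<open>(r/4)^(1-\<alpha>)\<close>; on pairs at distance at least
  \<open>r/4\<close> the bound \<open>N\<close> for the gradient on the compact set
  suffices.\<close>

lemma exponential_C1_holder:
  assumes D: "open D" "bounded D" and U: "continuous_on (closure D) U" "poisson D U (\<lambda>z. \<delta> * exp (U z))"
    and \<delta>: "\<delta> > 0" and \<alpha>: "0 < \<alpha>" "\<alpha> < 1"
  shows "C1_holder_loc \<alpha> D U"
proof -
  have "compact (closure D)" using D by simp
  then have "bounded (U ` closure D)" by (intro compact_imp_bounded compact_continuous_image U)
  then obtain A where A: "\<And>z. z \<in> closure D \<Longrightarrow> \<bar>U z\<bar> \<le> A" unfolding bounded_iff by auto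
  have A': "\<bar>U z\<bar> \<le> A" if "z \<in> D" for z using A that closure_subset by blast
  define H where "H = \<delta> * exp A"
  have H: "H \<ge> 0" using \<delta> by (simp add: H_def)
  have B: "\<bar>\<delta> * exp (U z)\<bar> \<le> H" if "z \<in> D" for z
    using A'[OF that] \<delta> by (simp add: H_def abs_mult abs_le_iff)
  have lip: "\<bar>\<delta> * exp (U x) - \<delta> * exp (U y)\<bar> \<le> H * \<bar>U x - U y\<bar>" if xy: "x \<in> D" "y \<in> D" for x y
  proof -
    have "\<bar>exp (U x) - exp (U y)\<bar> \<le> exp A * \<bar>U x - U y\<bar>"
      by (rule exp_lipschitz) (use A'[OF xy(1)] A'[OF xy(2)] in auto)
    then have "\<delta> * \<bar>exp (U x) - exp (U y)\<bar> \<le> \<delta> * (exp A * \<bar>U x - U y\<bar>)" using \<delta> by (intro mult_left_mono) auto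
    moreover have "\<bar>\<delta> * exp (U x) - \<delta> * exp (U y)\<bar> = \<delta> * \<bar>exp (U x) - exp (U y)\<bar>"
      using \<delta> by (simp add: abs_mult right_diff_distrib[symmetric])
    ultimately show ?thesis by (simp add: H_def mult_ac)
  qed
  obtain G where G: "\<And>z. z \<in> D \<Longrightarrow> (U has_derivative (\<lambda>h. G z \<bullet> h)) (at z)" and cG: "continuous_on D G"
    by (rule poisson_approximation[OF D(1) U(2)]) (rule that)
  have "holder_on \<alpha> K G" if K: "compact K" "K \<subseteq> D" for K
  proof (cases "K = {}")
    case True
    then show ?thesis by (simp add: holder_on_def)
  next
    case False
    obtain r where r: "r > 0" "\<And>x. x \<in> K \<Longrightarrow> ball x r \<subseteq> D"
      using compact_subset_open_imp_ball_epsilon_subset[OF K(1) D(1) K(2)] by (metis UN_subset_iff)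
    have "bounded (G ` K)"
      by (intro compact_imp_bounded compact_continuous_image continuous_on_subset[OF cG K(2)] K(1))
    then obtain N where N: "\<And>x. x \<in> K \<Longrightarrow> norm (G x) \<le> N" unfolding bounded_iff by auto
    have N0: "N \<ge> 0" using N False norm_ge_zero order_trans by blast
    have A0: "A \<ge> 0" using A' K(2) False by (meson abs_ge_zero all_not_in_conv order_trans subsetD)
    define Q where "Q = (16 / r + H * r / 16) * (8 * A / r + H * r / 8)"
    have Q: "Q \<ge> 0" using r A0 H by (simp add: Q_def)
    define C where "C = Q * (r/4) powr (1 - \<alpha>) + 2 * N / (r/4) powr \<alpha>"
    show ?thesis
    proof (rule holder_onI[where C=C])
      fix x y assume xy: "x \<in> K" "y \<in> K"
      show "dist (G x) (G y) \<le> C * dist x y powr \<alpha>"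
      proof (cases "dist x y < r / 4")
        case True
        have "norm (G y - G x) \<le> Q * dist y x"
          unfolding Q_def
        proof (rule poisson_gradient_lipschitz[OF poisson_subset[OF U(2) r(2)[OF xy(1)]] r(1)])
          show "y \<in> ball x (r/4)" using True by simp
        qed (use r(2)[OF xy(1)] A' B lip G H in blast)+
        then have "dist (G x) (G y) \<le> Q * dist x y" by (simp add: dist_norm norm_minus_commute)
        also have "\<dots> \<le> Q * ((r/4) powr (1 - \<alpha>) * dist x y powr \<alpha>)"
        proof (intro mult_left_mono Q)
          show "dist x y \<le> (r/4) powr (1 - \<alpha>) * dist x y powr \<alpha>"
          proof (cases "x = y")
            case False
            then have "dist x y = dist x y powr (1 - \<alpha>) * dist x y powr \<alpha>" by (simp add: powr_add[symmetric])
            also have "\<dots> \<le> (r/4) powr (1 - \<alpha>) * dist x y powr \<alpha>"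
              using True \<alpha> by (intro mult_right_mono powr_mono2) auto
            finally show ?thesis .
          qed simp
        qed
        also have "\<dots> \<le> C * dist x y powr \<alpha>"
          using N0 r by (simp add: C_def algebra_simps)
        finally show ?thesis .
      next
        case False
        have "dist (G x) (G y) \<le> 2 * N"
          using norm_triangle_ineq4[of "G x" "G y"] N[OF xy(1)] N[OF xy(2)] by (simp add: dist_norm)
        also have "\<dots> = 2 * N / (r/4) powr \<alpha> * (r/4) powr \<alpha>" using r by simp
        also have "\<dots> \<le> 2 * N / (r/4) powr \<alpha> * dist x y powr \<alpha>"
          using False r N0 \<alpha> by (intro mult_left_mono powr_mono2) auto
        also have "\<dots> \<le> C * dist x y powr \<alpha>"
          using Q r by (intro mult_right_mono) (auto simp: C_def)
        finally show ?thesis .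
      qed
    qed
  qed
  moreover have "\<forall>z\<in>D. GDERIV U z :> G z" using G by (simp add: gderiv_def inner_commute)
  ultimately show ?thesis unfolding C1_holder_loc_def by blast
qed

section \<open>Weak gradients\<close>

lemma sigma_finite_lebesgue: "sigma_finite_measure (lebesgue :: complex measure)"
proof
  obtain A :: "complex set set" where A: "countable A" "A \<subseteq> sets lborel" "\<Union>A = space lborel" "\<forall>a\<in>A. emeasure lborel a \<noteq> \<infinity>"
    using lborel.sigma_finite_countable by blast
  show "\<exists>A::complex set set. countable A \<and> A \<subseteq> sets lebesgue \<and> \<Union>A = space lebesgue \<and> (\<forall>a\<in>A. emeasure lebesgue a \<noteq> \<infinity>)"
  proof (intro exI[of _ A] conjI ballI)
    show "A \<subseteq> sets lebesgue" using A(2) sets_completionI_sets by blast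
    show "emeasure lebesgue a \<noteq> \<infinity>" if "a \<in> A" for a
      using A(2,4) that emeasure_completion[of a lborel] by (auto simp: subset_iff)
  qed (use A in auto)
qed

lemma continuous_lebesgue_measurable:
  fixes f :: "complex \<Rightarrow> 'b::{second_countable_topology, metric_space}"
  assumes "continuous_on UNIV f"
  shows "f \<in> borel_measurable lebesgue"
  by (rule measurable_completion) (use borel_measurable_continuous_onI[OF assms] in simp)

lemma continuous_compact_integrable:
  fixes f :: "complex \<Rightarrow> 'b::{banach, second_countable_topology}"
  assumes "continuous_on UNIV f" "compact K" "\<And>z. z \<notin> K \<Longrightarrow> f z = 0"
  shows "integrable lborel f" "integrable lebesgue f"
proof -
  have "integrable lborel (\<lambda>z. indicator K z *\<^sub>R f z)"
    by (rule borel_integrable_compact[OF assms(2) continuous_on_subset[OF assms(1)]]) simp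
  moreover have "(\<lambda>z. indicator K z *\<^sub>R f z) = f" using assms(3) by (auto simp: indicator_def)
  ultimately show "integrable lborel f" by simp
  then show "integrable lebesgue f"
    using borel_measurable_continuous_onI[OF assms(1)] by (simp add: integrable_completion)
qed

lemma integrable_scaleR_bounded:
  fixes F :: "complex \<Rightarrow> 'b::{banach, second_countable_topology}"
  assumes "integrable lebesgue F" "\<psi> \<in> borel_measurable lebesgue" "\<And>z. norm (\<psi> z *\<^sub>R F z) \<le> C * norm (F z)"
  shows "integrable lebesgue (\<lambda>z. \<psi> z *\<^sub>R F z)"
proof (rule Bochner_Integration.integrable_bound[where f="\<lambda>z. C * norm (F z)"])
  show "integrable lebesgue (\<lambda>z. C * norm (F z))" using assms(1) by simp
  show "(\<lambda>z. \<psi> z *\<^sub>R F z) \<in> borel_measurable lebesgue"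
    using assms(1,2) by (intro borel_measurable_scaleR) auto
  show "AE z in lebesgue. norm (\<psi> z *\<^sub>R F z) \<le> norm (C * norm (F z))"
    using order_trans[OF assms(3) abs_ge_self] by (intro AE_I2) simp
qed

text \<open>A fundamental lemma of the calculus of variations: vanishing passes from polynomials to
  continuous functions by Weierstrass approximation on the disc carrying \<open>F\<close>, to
  indicators of open sets by dominated convergence, to Borel sets by a Dynkin system argument, and
  to Lebesgue sets by discarding null sets.\<close>

lemma AE_zero_of_polynomial_moments:
  fixes F :: "complex \<Rightarrow> complex"
  assumes F: "integrable lebesgue F" "\<And>z. z \<notin> cball a r \<Longrightarrow> F z = 0"
    and orth: "\<And>P. zpoly P \<Longrightarrow> (\<integral>z. Re (P z) *\<^sub>R F z \<partial>lebesgue) = 0"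
  shows "AE z in lebesgue. F z = 0"
proof -
  have cont_int: "integrable lebesgue (\<lambda>z. \<psi> z *\<^sub>R F z)" if \<psi>: "continuous_on UNIV \<psi>" for \<psi>
  proof -
    have "bounded (\<psi> ` cball a r)"
      by (intro compact_imp_bounded compact_continuous_image continuous_on_subset[OF \<psi>]) auto
    then obtain C where "\<forall>x\<in>\<psi> ` cball a r. norm x \<le> C" unfolding bounded_iff by (elim exE)
    then have C: "\<bar>\<psi> z\<bar> \<le> C" if "z \<in> cball a r" for z using that by simp
    show ?thesis
    proof (rule integrable_scaleR_bounded[OF F(1) continuous_lebesgue_measurable[OF \<psi>]])
      show "norm (\<psi> z *\<^sub>R F z) \<le> C * norm (F z)" for z
        using C[of z] F(2)[of z] by (cases "z \<in> cball a r") (auto intro: mult_right_mono)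
    qed
  qed
  have cont: "(\<integral>z. \<psi> z *\<^sub>R F z \<partial>lebesgue) = 0" if \<psi>: "continuous_on UNIV \<psi>" for \<psi>
  proof (rule ccontr)
    let ?I = "\<integral>z. \<psi> z *\<^sub>R F z \<partial>lebesgue"
    let ?N = "\<integral>z. norm (F z) \<partial>lebesgue"
    assume "?I \<noteq> 0"
    then have I: "norm ?I > 0" by simp
    have N: "?N \<ge> 0" by simp
    \<comment> \<open>The 1 keeps the denominator positive should \<open>F\<close> vanish almost
      everywhere.\<close>
    define M where "M = ?N + 1"
    have M: "M > 0" unfolding M_def by (rule add_nonneg_pos[OF N zero_less_one])
    define e where "e = norm ?I / (2 * M)"
    have e: "e > 0" using I M by (simp add: e_def)
    obtain P where P: "zpoly P" "\<And>x. x \<in> cball a r \<Longrightarrow> \<bar>Re (P x) - \<psi> x\<bar> < e"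
      by (rule zpoly_dense[OF compact_cball continuous_on_subset[OF \<psi>] e]) (auto intro: that)
    obtain g p where c2: "c2_on UNIV (\<lambda>z. Re (P z)) g p" using c2_on_zpoly[OF P(1)] by (elim exE)
    have cP: "continuous_on UNIV (\<lambda>z. Re (P z))" using c2_on_continuous(1)[OF c2] .
    have "?I = (\<integral>z. \<psi> z *\<^sub>R F z \<partial>lebesgue) - (\<integral>z. Re (P z) *\<^sub>R F z \<partial>lebesgue)" using orth[OF P(1)] by simp
    also have "\<dots> = (\<integral>z. \<psi> z *\<^sub>R F z - Re (P z) *\<^sub>R F z \<partial>lebesgue)"
      by (rule Bochner_Integration.integral_diff[symmetric]) (intro cont_int \<psi> cP)+
    also have "norm \<dots> \<le> (\<integral>z. e * norm (F z) \<partial>lebesgue)"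
    proof (rule Bochner_Integration.integral_norm_bound_integral)
      show "integrable lebesgue (\<lambda>z. \<psi> z *\<^sub>R F z - Re (P z) *\<^sub>R F z)"
        by (intro Bochner_Integration.integrable_diff cont_int \<psi> cP)
      show "integrable lebesgue (\<lambda>z. e * norm (F z))" using F(1) by simp
      fix z
      show "norm (\<psi> z *\<^sub>R F z - Re (P z) *\<^sub>R F z) \<le> e * norm (F z)"
      proof (cases "z \<in> cball a r")
        case True
        have "norm (\<psi> z *\<^sub>R F z - Re (P z) *\<^sub>R F z) = \<bar>Re (P z) - \<psi> z\<bar> * norm (F z)"
          by (simp flip: scaleR_left_diff_distrib add: abs_minus_commute)
        also have "\<dots> \<le> e * norm (F z)" using P(2)[OF True] by (intro mult_right_mono) auto
        finally show ?thesis .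
      qed (use F(2) in simp)
    qed
    also have "\<dots> = e * ?N" by simp
    also have "\<dots> \<le> e * M" using e by (simp add: M_def)
    also have "\<dots> = norm ?I / 2" using M by (simp add: e_def)
    finally show False using I by simp
  qed
  have op: "(\<integral>z. indicator S z *\<^sub>R F z \<partial>lebesgue) = 0" if S: "open S" for S :: "complex set"
  proof (cases "S = UNIV")
    case True
    then show ?thesis using cont[of "\<lambda>_. 1"] by simp
  next
    case False
    \<comment> \<open>Continuous functions increasing to the indicator of \<open>S\<close>. For
      empty \<open>- S\<close> the value of \<open>infdist\<close> would be 0, hence the case
      distinction.\<close>
    define \<psi> where "\<psi> = (\<lambda>(n::nat) z. min 1 (real n * infdist z (- S)))"
    have c\<psi>: "continuous_on UNIV (\<psi> n)" for n unfolding \<psi>_def by (intro continuous_intros)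
    have "(\<lambda>n. \<integral>z. \<psi> n z *\<^sub>R F z \<partial>lebesgue) \<longlonglongrightarrow> (\<integral>z. indicator S z *\<^sub>R F z \<partial>lebesgue)"
    proof (rule integral_dominated_convergence[where w="\<lambda>z. norm (F z)"])
      have SL: "S \<in> sets lebesgue" using S by simp
      show "(\<lambda>z. indicator S z *\<^sub>R F z) \<in> borel_measurable lebesgue"
        using F(1) SL by (intro borel_measurable_scaleR borel_measurable_indicator) auto
      show "(\<lambda>z. \<psi> n z *\<^sub>R F z) \<in> borel_measurable lebesgue" for n
        using cont_int[OF c\<psi>] by simp
      show "AE z in lebesgue. (\<lambda>n. \<psi> n z *\<^sub>R F z) \<longlonglongrightarrow> indicator S z *\<^sub>R F z"
      proof (rule AE_I2)
        fix z
        have "(\<lambda>n. \<psi> n z) \<longlonglongrightarrow> indicator S z"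
        proof (cases "z \<in> S")
          case True
          have d: "infdist z (- S) > 0"
            using infdist_pos_not_in_closed[of "- S" z] S False True by auto
          obtain N where N: "real N * infdist z (- S) > 1" using reals_Archimedean3[OF d] by blast
          have "\<psi> n z = 1" if "n \<ge> N" for n
          proof -
            have "real N * infdist z (- S) \<le> real n * infdist z (- S)" using that d by (intro mult_right_mono) auto
            then show ?thesis using N by (simp add: \<psi>_def)
          qed
          then have "\<forall>\<^sub>F n in sequentially. \<psi> n z = 1" unfolding eventually_sequentially by blast
          then show ?thesis using True by (simp add: tendsto_eventually)
        next
          case False
          then have "\<psi> n z = 0" for n by (simp add: \<psi>_def)
          then show ?thesis using False by simp
        qed
        then show "(\<lambda>n. \<psi> n z *\<^sub>R F z) \<longlonglongrightarrow> indicator S z *\<^sub>R F z" by (intro tendsto_intros)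
      qed
      show "AE z in lebesgue. norm (\<psi> n z *\<^sub>R F z) \<le> norm (F z)" for n
        by (rule AE_I2) (auto simp: \<psi>_def infdist_nonneg intro!: mult_left_le_one_le)
    qed (use F(1) in simp)
    moreover have "(\<integral>z. \<psi> n z *\<^sub>R F z \<partial>lebesgue) = 0" for n by (rule cont[OF c\<psi>])
    ultimately show ?thesis by (simp only: LIMSEQ_const_iff)
  qed
  have setint: "set_integrable lebesgue A F" if "A \<in> sets lebesgue" for A
    unfolding set_integrable_def by (rule integrable_mult_indicator[OF that F(1)])
  have borel: "(\<integral>z. indicator A z *\<^sub>R F z \<partial>lebesgue) = 0" if "A \<in> sets borel" for A :: "complex set"
  proof -
    have leb: "A \<in> sets lebesgue" if "A \<in> sigma_sets UNIV {S. open S}" for A :: "complex set"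
      using that by (simp flip: sets_borel)
    have "Int_stable {S :: complex set. open S}" by (auto simp: Int_stable_def)
    moreover have "{S :: complex set. open S} \<subseteq> Pow UNIV" by simp
    moreover have "A \<in> sigma_sets UNIV {S. open S}" using that by (simp flip: sets_borel)
    ultimately show ?thesis
    proof (induction rule: sigma_sets_induct_disjoint)
      case (basic A)
      then show ?case using op by simp
    next
      case empty
      show ?case by simp
    next
      case (compl A)
      have "(\<integral>z. indicator (UNIV - A) z *\<^sub>R F z \<partial>lebesgue) = (\<integral>z. indicator UNIV z *\<^sub>R F z - indicator A z *\<^sub>R F z \<partial>lebesgue)"
        by (rule Bochner_Integration.integral_cong) (auto simp: indicator_def)
      also have "\<dots> = (\<integral>z. indicator UNIV z *\<^sub>R F z \<partial>lebesgue) - (\<integral>z. indicator A z *\<^sub>R F z \<partial>lebesgue)"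
        using setint[of UNIV] setint[OF leb[OF compl(1)]] unfolding set_integrable_def by (intro Bochner_Integration.integral_diff) auto
      also have "\<dots> = 0" using op[of UNIV] compl(2) by simp
      finally show ?case .
    next
      case (union A)
      have "(LINT z:(\<Union>i. A i)|lebesgue. F z) = (\<Sum>i. (LINT z:(A i)|lebesgue. F z))"
      proof (rule lebesgue_integral_countable_add)
        show "A i \<in> sets lebesgue" for i using union(2) leb by auto
        then show "set_integrable lebesgue (\<Union>i. A i) F" by (intro setint) auto
        show "A i \<inter> A j = {}" if "i \<noteq> j" for i j using union(1) that by (auto simp: disjoint_family_on_def)
      qed
      then show ?case using union(3) by (simp add: set_lebesgue_integral_def)
    qed
  qed
  show ?thesis
  proof (rule sigma_finite_measure.density_zero[OF sigma_finite_lebesgue F(1)])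
    fix A :: "complex set" assume A: "A \<in> sets lebesgue"
    obtain B N where BN: "B \<in> sets borel" "negligible N" "B \<union> N = A" by (rule sets_lebesgue_almost_borel[OF A])
    have "N \<in> null_sets lebesgue" using BN(2) by (simp add: negligible_iff_null_sets)
    then have "AE z in lebesgue. z \<notin> N" by (rule AE_not_in)
    then have "AE z in lebesgue. indicator A z *\<^sub>R F z = indicator B z *\<^sub>R F z"
      by eventually_elim (use BN(3) in \<open>auto simp: indicator_def\<close>)
    moreover have "B \<in> sets lebesgue" using BN(1) by simp
    ultimately have "(\<integral>z. indicator A z *\<^sub>R F z \<partial>lebesgue) = (\<integral>z. indicator B z *\<^sub>R F z \<partial>lebesgue)"
      using setint[OF A] setint[of B] unfolding set_integrable_def by (intro integral_cong_AE) auto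
    then show "set_lebesgue_integral lebesgue A F = 0"
      using borel[OF BN(1)] by (simp add: set_lebesgue_integral_def)
  qed
qed

section \<open>Cutoff functions and locality of weak gradients\<close>

text \<open>Weak gradients are tested with C^1 functions, for which squaring the positive part is
  smooth enough; the gradient is then explicit.\<close>

definition bump :: "complex \<Rightarrow> real \<Rightarrow> complex \<Rightarrow> real" where
  "bump a r z = (max 0 (r\<^sup>2 - (norm (z - a))\<^sup>2))\<^sup>2"

definition bump_grad :: "complex \<Rightarrow> real \<Rightarrow> complex \<Rightarrow> complex" where
  "bump_grad a r z = (- 4 * max 0 (r\<^sup>2 - (norm (z - a))\<^sup>2)) *\<^sub>R (z - a)"

lemma DERIV_max_square: "((\<lambda>s::real. (max 0 s)\<^sup>2) has_real_derivative 2 * max 0 s) (at s)"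
proof -
  consider "s > 0" | "s < 0" | "s = 0" by linarith
  then show ?thesis
  proof cases
    case 1
    have "((\<lambda>s::real. s\<^sup>2) has_real_derivative 2 * s) (at s)" by (auto intro!: derivative_eq_intros)
    then have "((\<lambda>s::real. (max 0 s)\<^sup>2) has_real_derivative 2 * s) (at s)"
      by (rule has_field_derivative_transform_within_open[of _ _ _ "{0<..}"]) (use 1 in auto)
    then show ?thesis using 1 by simp
  next
    case 2
    have "((\<lambda>s::real. 0) has_real_derivative 0) (at s)" by simp
    then have "((\<lambda>s::real. (max 0 s)\<^sup>2) has_real_derivative 0) (at s)"
      by (rule has_field_derivative_transform_within_open[of _ _ _ "{..<0}"]) (use 2 in auto)
    then show ?thesis using 2 by simp
  next
    case 3
    have "((\<lambda>h::real. (max 0 h)\<^sup>2 / h) \<longlongrightarrow> 0) (at 0)"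
    proof (rule Lim_null_comparison)
      show "\<forall>\<^sub>F h::real in at 0. norm ((max 0 h)\<^sup>2 / h) \<le> \<bar>h\<bar>"
        by (rule always_eventually) (auto simp: max_def power2_eq_square)
      show "((\<lambda>h::real. \<bar>h\<bar>) \<longlongrightarrow> 0) (at 0)" by (intro tendsto_eq_intros) auto
    qed
    then show ?thesis using 3 by (simp add: DERIV_def)
  qed
qed

lemma bump_gradient: "(bump a r has_derivative (\<lambda>h. bump_grad a r z \<bullet> h)) (at z)"
proof -
  have "((\<lambda>z. r\<^sup>2 - (norm (z - a))\<^sup>2) has_derivative (\<lambda>h. 0 - (2 *\<^sub>R (z - a)) \<bullet> h)) (at z)"
    by (intro has_derivative_diff c2_on_gradient[OF c2_on_norm_square[of UNIV]] has_derivative_const) simp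
  moreover have "((\<lambda>s::real. (max 0 s)\<^sup>2) has_derivative (*) (2 * max 0 (r\<^sup>2 - (norm (z - a))\<^sup>2))) (at (r\<^sup>2 - (norm (z - a))\<^sup>2))"
    using DERIV_max_square by (simp add: has_field_derivative_def)
  ultimately have "((\<lambda>z. (max 0 (r\<^sup>2 - (norm (z - a))\<^sup>2))\<^sup>2) has_derivative
    (\<lambda>h. 2 * max 0 (r\<^sup>2 - (norm (z - a))\<^sup>2) * (0 - (2 *\<^sub>R (z - a)) \<bullet> h))) (at z)"
    by (rule has_derivative_compose)
  then show ?thesis unfolding bump_def bump_grad_def by (rule has_derivative_eq_rhs) (auto simp: fun_eq_iff inner_simps algebra_simps)
qed

lemma continuous_bump: "continuous_on S (bump a r)" "continuous_on S (bump_grad a r)"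
  unfolding bump_def[abs_def] bump_grad_def[abs_def] by (intro continuous_intros)+

lemma bump_outside:
  assumes "z \<notin> ball a r" "r > 0"
  shows "bump a r z = 0" "bump_grad a r z = 0"
proof -
  have "r\<^sup>2 \<le> (norm (z - a))\<^sup>2" using assms by (intro power_mono) (auto simp: dist_norm norm_minus_commute)
  then show "bump a r z = 0" "bump_grad a r z = 0" by (simp_all add: bump_def bump_grad_def)
qed

lemma bump_nonneg: "bump a r z \<ge> 0" by (simp add: bump_def)

lemma bump_pos:
  assumes "z \<in> ball a r"
  shows "bump a r z > 0"
proof -
  have "(norm (z - a))\<^sup>2 < r\<^sup>2" using assms by (intro power_strict_mono) (auto simp: dist_norm norm_minus_commute)
  then show ?thesis by (simp add: bump_def)
qed

lemma compactly_supported_inI: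
  assumes "compact K" "K \<subseteq> D" "\<And>z. z \<in> D \<Longrightarrow> z \<notin> K \<Longrightarrow> \<psi> z = 0"
  shows "compactly_supported_in D \<psi>"
proof -
  have "closure {z \<in> D. \<psi> z \<noteq> 0} \<subseteq> K"
    by (rule closure_minimal) (use assms compact_imp_closed in auto)
  then show ?thesis
    using assms(1,2) compact_Int_closed[OF assms(1) closed_closure, of "{z \<in> D. \<psi> z \<noteq> 0}"]
    unfolding compactly_supported_in_def by (auto simp: Int_absorb1)
qed

lemma weak_gradientD:
  assumes "has_weak_gradient D u g" "\<And>z. z \<in> D \<Longrightarrow> (\<psi> has_derivative (\<lambda>h. \<psi>' z \<bullet> h)) (at z)"
    "continuous_on D \<psi>'" "compact K" "K \<subseteq> D" "\<And>z. z \<in> D \<Longrightarrow> z \<notin> K \<Longrightarrow> \<psi> z = 0"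
  shows "(\<integral>z. indicator D z *\<^sub>R (u z *\<^sub>R \<psi>' z) \<partial>lebesgue) = - (\<integral>z. indicator D z *\<^sub>R (\<psi> z *\<^sub>R g z) \<partial>lebesgue)"
proof -
  have "(\<forall>z\<in>D. GDERIV \<psi> z :> \<psi>' z) \<and> continuous_on D \<psi>' \<and> compactly_supported_in D \<psi>"
    using assms compactly_supported_inI[OF assms(4-6)] by (simp add: gderiv_def inner_commute)
  then show ?thesis
    using assms(1) unfolding has_weak_gradient_def set_lebesgue_integral_def by blast
qed

text \<open>Test functions \<open>bump * Re P\<close> supported off \<open>K\<close> meet only zeros
  of \<eta>, so all polynomial moments of \<open>bump * H\<close> vanish, and \<open>H = 0\<close>
  almost everywhere on the disc; countably many discs exhaust \<open>D - K\<close>. This lets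
  integrals over \<open>D\<close> against \<open>H\<close> be taken over a compact
  \<open>K\<close>.\<close>

lemma weak_gradient_vanishes:
  assumes D: "open D" and w: "has_weak_gradient D \<eta> H" and K: "closed K"
    and z: "\<And>z. z \<in> D \<Longrightarrow> z \<notin> K \<Longrightarrow> \<eta> z = 0"
  shows "AE z in lebesgue. z \<in> D \<longrightarrow> z \<notin> K \<longrightarrow> H z = 0"
proof -
  have loc: "AE z in lebesgue. z \<in> ball a r \<longrightarrow> H z = 0" if r: "r > 0" "cball a r \<subseteq> D - K" for a r
  proof -
    \<comment> \<open>Integrability of \<open>H\<close> is given on compact sets, hence the
      indicator; \<open>FH\<close> shows that it leaves the product unchanged.\<close>
    define F where "F = (\<lambda>z. bump a r z *\<^sub>R (indicator (cball a r) z *\<^sub>R H z))"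
    have F0: "F z = 0" if "z \<notin> ball a r" for z using bump_outside[OF that r(1)] by (simp add: F_def)
    have FH: "F z = bump a r z *\<^sub>R H z" for z
      using bump_outside(1)[of z a r] r(1) by (cases "z \<in> ball a r") (auto simp: F_def indicator_def)
    have "AE z in lebesgue. F z = 0"
    proof (rule AE_zero_of_polynomial_moments[where a=a and r=r])
      have "L1_loc D H" using w by (simp add: has_weak_gradient_def)
      then have i: "integrable lebesgue (\<lambda>z. indicator (cball a r) z *\<^sub>R H z)"
        unfolding L1_loc_def set_integrable_def using r(2) by (meson Diff_subset compact_cball order_trans)
      show "integrable lebesgue F"
        unfolding F_def
      proof (rule integrable_scaleR_bounded[OF i])
        show "bump a r \<in> borel_measurable lebesgue" by (rule continuous_lebesgue_measurable[OF continuous_bump(1)])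
        have "bump a r z \<le> (r\<^sup>2)\<^sup>2" for z unfolding bump_def by (intro power_mono) auto
        then show "norm (bump a r z *\<^sub>R indicator (cball a r) z *\<^sub>R H z) \<le> (r\<^sup>2)\<^sup>2 * norm (indicator (cball a r) z *\<^sub>R H z)" for z
          using bump_nonneg[of a r z] by (auto simp: mult.assoc intro!: mult_right_mono)
      qed
      show "F z = 0" if "z \<notin> cball a r" for z by (rule F0) (use that in auto)
      fix P assume "zpoly P"
      then obtain g p where c2: "c2_on UNIV (\<lambda>z. Re (P z)) g p" using c2_on_zpoly by blast
      define \<psi> where "\<psi> = (\<lambda>z. Re (P z) * bump a r z)"
      define \<psi>' where "\<psi>' = (\<lambda>z. Re (P z) *\<^sub>R bump_grad a r z + bump a r z *\<^sub>R g z)"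
      have "(\<integral>z. indicator D z *\<^sub>R (\<eta> z *\<^sub>R \<psi>' z) \<partial>lebesgue) = - (\<integral>z. indicator D z *\<^sub>R (\<psi> z *\<^sub>R H z) \<partial>lebesgue)"
      proof (rule weak_gradientD[OF w, where K="cball a r"])
        show "(\<psi> has_derivative (\<lambda>h. \<psi>' z \<bullet> h)) (at z)" for z
          unfolding \<psi>_def \<psi>'_def
          by (rule has_derivative_eq_rhs[OF has_derivative_mult[OF c2_on_gradient[OF c2] bump_gradient]])
            (auto simp: inner_simps)
        show "continuous_on D \<psi>'" unfolding \<psi>'_def
          using c2_on_continuous[OF c2]
          by (intro continuous_on_add continuous_on_scaleR continuous_bump) (auto elim: continuous_on_subset)
        show "\<psi> z = 0" if "z \<notin> cball a r" for z
        proof -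
          have "z \<notin> ball a r" using that by auto
          then show ?thesis using bump_outside r(1) by (simp add: \<psi>_def)
        qed
      qed (use r(2) in auto)
      moreover have "indicator D z *\<^sub>R (\<eta> z *\<^sub>R \<psi>' z) = 0" for z
      proof (cases "z \<in> ball a r")
        case True
        then have "z \<in> cball a r" by simp
        then have "z \<in> D" "z \<notin> K" using r(2) by auto
        then show ?thesis using z by simp
      next
        case False
        then show ?thesis using bump_outside[OF False r(1)] by (simp add: \<psi>'_def)
      qed
      moreover have "indicator D z *\<^sub>R (\<psi> z *\<^sub>R H z) = Re (P z) *\<^sub>R F z" for z
      proof (cases "z \<in> ball a r")
        case True
        then have "z \<in> cball a r" by simp
        then have "z \<in> D" using r(2) by auto
        then show ?thesis by (simp add: \<psi>_def FH)
      next
        case False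
        then show ?thesis using bump_outside[OF False r(1)] by (simp add: \<psi>_def FH)
      qed
      ultimately show "(\<integral>z. Re (P z) *\<^sub>R F z \<partial>lebesgue) = 0"
        by (simp only: Bochner_Integration.integral_zero neg_0_equal_iff_equal)
    qed
    then show ?thesis
      by eventually_elim (use bump_pos in \<open>fastforce simp: FH\<close>)
  qed
  show ?thesis
  proof (cases "D - K = {}")
    case False
    have oDK: "open (D - K)" using D K by (rule open_Diff)
    obtain a :: "nat \<Rightarrow> complex" and \<rho> where c: "\<And>i. \<rho> i > 0" "\<And>i. cball (a i) (\<rho> i) \<subseteq> D - K"
      "\<And>z. z \<in> D - K \<Longrightarrow> \<exists>i. z \<in> ball (a i) (\<rho> i)"
      by (rule countable_ball_cover[OF oDK False]) (rule that)
    have "AE z in lebesgue. \<forall>i. z \<in> ball (a i) (\<rho> i) \<longrightarrow> H z = 0"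
      unfolding AE_all_countable by (intro allI loc c)
    then show ?thesis by eventually_elim (use c(3) in blast)
  qed auto
qed

section \<open>Weak solutions\<close>

text \<open>The values of \<open>f\<close> off \<open>D\<close> are arbitrary, so the indicator
  erases them. The plane is covered by the open sets \<open>D\<close> and \<open>- K\<close>, on
  which the product is \<open>f\<close> and 0 respectively.\<close>

lemma extension_by_zero_continuous:
  fixes f :: "complex \<Rightarrow> 'b::real_normed_vector"
  assumes "open D" "closed K" "K \<subseteq> D" "continuous_on D f" "\<And>z. z \<in> D \<Longrightarrow> z \<notin> K \<Longrightarrow> f z = 0"
  shows "continuous_on UNIV (\<lambda>z. indicator D z *\<^sub>R f z)"
proof -
  have "continuous_on (D \<union> - K) (\<lambda>z. indicator D z *\<^sub>R f z)"
  proof (rule continuous_on_open_Un)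
    show "continuous_on D (\<lambda>z. indicator D z *\<^sub>R f z)"
      by (rule continuous_on_eq[OF assms(4)]) simp
    show "continuous_on (- K) (\<lambda>z. indicator D z *\<^sub>R f z)"
      by (rule continuous_on_eq[OF continuous_on_const[of _ 0]]) (use assms(5) in \<open>auto simp: indicator_def\<close>)
  qed (use assms in auto)
  moreover have "D \<union> - K = UNIV" using assms(3) by auto
  ultimately show ?thesis by simp
qed

lemma extension_by_zero_derivative:
  fixes f :: "complex \<Rightarrow> real"
  assumes "open D" "closed K" "K \<subseteq> D" "\<And>z. z \<in> D \<Longrightarrow> (f has_derivative (\<lambda>h. g z \<bullet> h)) (at z)"
    "\<And>z. z \<in> D \<Longrightarrow> z \<notin> K \<Longrightarrow> f z = 0"
  shows "((\<lambda>z. indicator D z *\<^sub>R f z) has_derivative (\<lambda>h. (indicator D z *\<^sub>R g z) \<bullet> h)) (at z)"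
proof (cases "z \<in> D")
  case True
  then show ?thesis
    using has_derivative_transform_within_open[OF assms(4)[OF True] assms(1) True, of "\<lambda>z. indicator D z *\<^sub>R f z"] by simp
next
  case False
  then have z: "z \<in> - K" using assms(3) by auto
  have "((\<lambda>z. 0::real) has_derivative (\<lambda>h. 0)) (at z)" by simp
  from has_derivative_transform_within_open[OF this _ z, of "\<lambda>z. indicator D z *\<^sub>R f z"]
  show ?thesis using False assms(2,5) by (auto simp: indicator_def open_Compl)
qed

lemma gradient_zero_outside:
  assumes "open D" "closed K" "\<And>z. z \<in> D \<Longrightarrow> (f has_derivative (\<lambda>h. g z \<bullet> h)) (at z)"
    "\<And>z. z \<in> D \<Longrightarrow> z \<notin> K \<Longrightarrow> f z = 0" "z \<in> D" "z \<notin> K"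
  shows "g z = (0::complex)"
proof -
  have "((\<lambda>z. 0::real) has_derivative (\<lambda>h. 0)) (at z)" by simp
  then have "(f has_derivative (\<lambda>h. 0)) (at z)"
    by (rule has_derivative_transform_within_open[of _ _ _ _ "D - K"]) (use assms in auto)
  from has_derivative_unique[OF this assms(3)[OF assms(5)]] have "g z \<bullet> h = 0" for h by metis
  then show ?thesis by (metis inner_eq_zero_iff)
qed

text \<open>Translation invariance of the integral, differentiated at zero.\<close>

lemma integral_gradient_zero:
  fixes v :: "complex \<Rightarrow> real"
  assumes d: "\<And>z. (v has_derivative (\<lambda>h. g z \<bullet> h)) (at z)" and cg: "continuous_on UNIV g"
    and K: "compact K" and v0: "\<And>z. z \<notin> K \<Longrightarrow> v z = 0"
  shows "(\<integral>z. g z \<partial>lebesgue) = 0"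
proof -
  have cv: "continuous_on S v" for S
    by (intro continuous_at_imp_continuous_on ballI has_derivative_continuous[OF d])
  have g0: "g z = 0" if "z \<notin> K" for z
    by (rule gradient_zero_outside[of UNIV K v g]) (use d v0 K that compact_imp_closed in auto)
  have ig: "integrable lborel g" using continuous_compact_integrable(1)[OF cg K g0] .
  have iv: "integrable lborel v" using continuous_compact_integrable(1)[OF cv K v0] .
  obtain R where R: "R > 0" "\<And>z. z \<in> K \<Longrightarrow> norm z \<le> R" using compact_imp_bounded[OF K] unfolding bounded_pos by blast
  have "bounded (g ` K)" by (intro compact_imp_bounded compact_continuous_image continuous_on_subset[OF cg] K) auto
  then obtain L where L: "L > 0" "\<And>z. z \<in> K \<Longrightarrow> norm (g z) \<le> L" unfolding bounded_pos by auto
  have L': "norm (g z) \<le> L" for z using L g0[of z] by (cases "z \<in> K") auto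
  have lip: "\<bar>v x - v y\<bar> \<le> L * norm (x - y)" for x y
  proof -
    have "norm (v x - v y) \<le> L * norm (x - y)"
    proof (rule differentiable_bound[of UNIV v "\<lambda>z h. g z \<bullet> h"])
      fix z
      have "norm (g z \<bullet> h) \<le> L * norm h" for h
        using Cauchy_Schwarz_ineq2[of "g z" h] mult_right_mono[OF L'[of z], of "norm h"] by simp
      then show "onorm ((\<bullet>) (g z)) \<le> L" by (intro onorm_bound) (use L in auto)
    qed (use d in auto)
    then show ?thesis by simp
  qed
  have key: "(\<integral>z. g z \<partial>lborel) \<bullet> e = 0" if e: "norm e = 1" for e
  proof -
    define \<rho> where "\<rho> = (\<lambda>n. inverse (real (Suc n)))"
    have \<rho>: "0 < \<rho> n" "\<rho> n \<le> 1" for n by (auto simp: \<rho>_def field_simps)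
    have \<rho>lim: "\<rho> \<longlonglongrightarrow> 0" unfolding \<rho>_def by (rule LIMSEQ_inverse_real_of_nat)
    \<comment> \<open>Difference quotients in direction \<open>e\<close>. Each has integral 0 by
      translation invariance, they tend to \<open>g \<bullet> e\<close>, and since
      \<open>\<rho> n \<le> 1\<close> they all live on the disc of radius \<open>R + 1\<close>,
      bounded by the Lipschitz constant \<open>L\<close>.\<close>
    define q where "q = (\<lambda>n z. (v (\<rho> n *\<^sub>R e + z) - v z) / \<rho> n)"
    have vm: "v \<in> borel_measurable borel" by (rule borel_measurable_continuous_onI[OF cv])
    have shift: "integrable lborel (\<lambda>z. v (c + z))" "(\<integral>z. v (c + z) \<partial>lborel) = (\<integral>z. v z \<partial>lborel)" for c
    proof -
      have "integrable (distr lborel borel ((+) c)) v" unfolding lborel_distr_plus by (rule iv)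
      then show "integrable lborel (\<lambda>z. v (c + z))" by (subst (asm) integrable_distr_eq) (use vm in auto)
      have "(\<integral>z. v z \<partial>lborel) = (\<integral>z. v z \<partial>distr lborel borel ((+) c))" unfolding lborel_distr_plus ..
      also have "\<dots> = (\<integral>z. v (c + z) \<partial>lborel)" by (rule integral_distr) (use vm in auto)
      finally show "(\<integral>z. v (c + z) \<partial>lborel) = (\<integral>z. v z \<partial>lborel)" ..
    qed
    have q0: "(\<integral>z. q n z \<partial>lborel) = 0" for n
    proof -
      have "(\<integral>z. v (\<rho> n *\<^sub>R e + z) - v z \<partial>lborel) = 0"
        using shift iv by (subst Bochner_Integration.integral_diff) auto
      then show ?thesis unfolding q_def by simp
    qed
    have "(\<lambda>n. \<integral>z. q n z \<partial>lborel) \<longlonglongrightarrow> (\<integral>z. g z \<bullet> e \<partial>lborel)"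
    proof (rule integral_dominated_convergence[where w="\<lambda>z. indicator (cball 0 (R + 1)) z *\<^sub>R L"])
      show "(\<lambda>z. g z \<bullet> e) \<in> borel_measurable lborel" using ig by simp
      show "q n \<in> borel_measurable lborel" for n
        unfolding q_def using shift(1) iv by (intro borel_measurable_divide borel_measurable_diff) auto
      show "integrable lborel (\<lambda>z. indicator (cball 0 (R + 1)) z *\<^sub>R L :: real)"
        by (rule borel_integrable_compact[OF compact_cball continuous_on_const]) 
      show "AE z in lborel. (\<lambda>n. q n z) \<longlonglongrightarrow> g z \<bullet> e"
      proof (rule AE_I2)
        fix z
        have "((\<lambda>t. v (t *\<^sub>R e + z)) has_derivative (\<lambda>h. g z \<bullet> (h *\<^sub>R e))) (at 0)"
          by (rule has_derivative_compose[where f="\<lambda>t. t *\<^sub>R e + z" and g=v]) (auto intro!: derivative_eq_intros d)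
        then have "((\<lambda>t. v (t *\<^sub>R e + z)) has_real_derivative g z \<bullet> e) (at 0)"
          unfolding has_field_derivative_def by (rule has_derivative_eq_rhs) auto
        then have "((\<lambda>h. (v (h *\<^sub>R e + z) - v z) / h) \<longlongrightarrow> g z \<bullet> e) (at 0)" by (simp add: DERIV_def)
        moreover have "filterlim \<rho> (at 0) sequentially"
          unfolding filterlim_at using \<rho>lim \<rho>(1) by (auto intro!: always_eventually simp: less_imp_neq[symmetric])
        ultimately show "(\<lambda>n. q n z) \<longlonglongrightarrow> g z \<bullet> e"
          unfolding q_def by (rule filterlim_compose)
      qed
      show "AE z in lborel. norm (q n z) \<le> indicator (cball 0 (R + 1)) z *\<^sub>R L" for n
      proof (rule AE_I2)
        fix z
        have "\<bar>v (\<rho> n *\<^sub>R e + z) - v z\<bar> \<le> L * \<rho> n"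
          using lip[of "\<rho> n *\<^sub>R e + z" z] e \<rho>(1)[of n] by simp
        then have b: "norm (q n z) \<le> L" using \<rho>(1)[of n] by (simp add: q_def pos_divide_le_eq)
        show "norm (q n z) \<le> indicator (cball 0 (R + 1)) z *\<^sub>R L"
        proof (cases "z \<in> cball 0 (R + 1)")
          case False
          then have nz: "norm z > R + 1" by simp
          have "norm z \<le> norm (\<rho> n *\<^sub>R e + z) + norm (\<rho> n *\<^sub>R e)"
            using norm_triangle_ineq4[of "\<rho> n *\<^sub>R e + z" "\<rho> n *\<^sub>R e"] by simp
          then have "norm (\<rho> n *\<^sub>R e + z) > R" using nz e \<rho>[of n] by simp
          then have "\<rho> n *\<^sub>R e + z \<notin> K" "z \<notin> K" using R(2) nz R(1) by force+
          then show ?thesis using v0 L(1) by (simp add: q_def)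
        qed (use b in simp)
      qed
    qed
    then have "(\<integral>z. g z \<bullet> e \<partial>lborel) = 0" unfolding q0 LIMSEQ_const_iff by simp
    then show ?thesis using ig by simp
  qed
  have "(\<integral>z. g z \<partial>lborel) = 0"
    using key[of 1] key[of \<i>] by (simp add: complex_eq_iff inner_complex_def)
  moreover have "(\<integral>z. g z \<partial>lebesgue) = (\<integral>z. g z \<partial>lborel)"
    using ig by (intro integral_completion) auto
  ultimately show ?thesis by simp
qed

lemma continuous_set_integrable:
  fixes f :: "complex \<Rightarrow> 'b::{banach, second_countable_topology}"
  assumes "compact K" "continuous_on K f"
  shows "set_integrable lebesgue K f"
proof -
  have "integrable lborel (\<lambda>z. indicator K z *\<^sub>R f z)"
    by (rule borel_integrable_compact[OF assms])
  then show ?thesis unfolding set_integrable_def by (subst integrable_completion) auto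
qed

lemma continuous_L2_on:
  fixes f :: "complex \<Rightarrow> 'b::{banach, second_countable_topology}"
  assumes "compact K" "continuous_on K f"
  shows "L2_on K f"
proof -
  have "set_integrable lebesgue K (\<lambda>z. (norm (f z))\<^sup>2)"
    by (rule continuous_set_integrable[OF assms(1)]) (intro continuous_intros assms)
  moreover have "set_borel_measurable lebesgue K f"
    using continuous_set_integrable[OF assms] unfolding set_integrable_def set_borel_measurable_def by simp
  ultimately show ?thesis by (simp add: L2_on_def)
qed

section \<open>Integration by parts and the weak equation\<close>

text \<open>The product \<open>U \<psi>\<close>, extended by zero, is C^1 with compact support, so
  its gradient has integral 0; the product rule splits this into the two sides of the defining
  identity.\<close>

lemma C1_W12_loc:
  assumes D: "open D" and d: "\<And>z. z \<in> D \<Longrightarrow> (U has_derivative (\<lambda>h. G z \<bullet> h)) (at z)" and cG: "continuous_on D G"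
  shows "W12_loc D U G"
proof -
  have cU: "continuous_on D U"
    by (intro continuous_at_imp_continuous_on ballI has_derivative_continuous[OF d])
  have loc: "L1_loc D U" "L1_loc D G" "L2_loc D U" "L2_loc D G"
    unfolding L1_loc_def L2_loc_def
    using continuous_set_integrable continuous_L2_on continuous_on_subset[OF cU] continuous_on_subset[OF cG] by blast+
  have "set_lebesgue_integral lebesgue D (\<lambda>z. U z *\<^sub>R \<psi>' z) = - set_lebesgue_integral lebesgue D (\<lambda>z. \<psi> z *\<^sub>R G z)"
    if \<psi>: "\<forall>z\<in>D. GDERIV \<psi> z :> \<psi>' z" "continuous_on D \<psi>'" "compactly_supported_in D \<psi>" for \<psi> \<psi>'
  proof -
    define K where "K = closure {z \<in> D. \<psi> z \<noteq> 0}"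
    have K: "compact K" "K \<subseteq> D" "closed K" using \<psi>(3) by (auto simp: compactly_supported_in_def K_def)
    have \<psi>0: "\<psi> z = 0" if "z \<in> D" "z \<notin> K" for z
      using that closure_subset[of "{z \<in> D. \<psi> z \<noteq> 0}"] unfolding K_def by blast
    have d\<psi>: "(\<psi> has_derivative (\<lambda>h. \<psi>' z \<bullet> h)) (at z)" if "z \<in> D" for z
      using \<psi>(1) that by (simp add: gderiv_def inner_commute)
    have c\<psi>: "continuous_on D \<psi>"
      by (intro continuous_at_imp_continuous_on ballI has_derivative_continuous[OF d\<psi>])
    have \<psi>'0: "\<psi>' z = 0" if "z \<in> D" "z \<notin> K" for z
      using gradient_zero_outside[OF D K(3) d\<psi> \<psi>0 that] by simp
    define f1 where "f1 = (\<lambda>z. indicator D z *\<^sub>R (U z *\<^sub>R \<psi>' z))"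
    define f2 where "f2 = (\<lambda>z. indicator D z *\<^sub>R (\<psi> z *\<^sub>R G z))"
    have c1: "continuous_on UNIV f1" "continuous_on UNIV f2"
      unfolding f1_def f2_def
      by (rule extension_by_zero_continuous[OF D K(3,2)]; use \<psi>0 \<psi>'0 in \<open>auto intro!: continuous_intros cU cG c\<psi> \<psi>(2)\<close>)+
    have i: "integrable lebesgue f1" "integrable lebesgue f2"
      by (rule continuous_compact_integrable(2)[OF c1(1) K(1)] continuous_compact_integrable(2)[OF c1(2) K(1)];
          use \<psi>0 \<psi>'0 in \<open>auto simp: f1_def f2_def indicator_def\<close>)+
    have "(\<integral>z. indicator D z *\<^sub>R (U z *\<^sub>R \<psi>' z + \<psi> z *\<^sub>R G z) \<partial>lebesgue) = 0"
    proof (rule integral_gradient_zero[OF _ _ K(1)])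
      show "((\<lambda>z. indicator D z *\<^sub>R (U z * \<psi> z)) has_derivative (\<lambda>h. (indicator D z *\<^sub>R (U z *\<^sub>R \<psi>' z + \<psi> z *\<^sub>R G z)) \<bullet> h)) (at z)" for z
      proof (rule extension_by_zero_derivative[OF D K(3,2)])
        show "((\<lambda>z. U z * \<psi> z) has_derivative (\<lambda>h. (U z *\<^sub>R \<psi>' z + \<psi> z *\<^sub>R G z) \<bullet> h)) (at z)" if "z \<in> D" for z
          by (rule has_derivative_eq_rhs[OF has_derivative_mult[OF d[OF that] d\<psi>[OF that]]]) (auto simp: inner_simps)
      qed (use \<psi>0 in auto)
      show "continuous_on UNIV (\<lambda>z. indicator D z *\<^sub>R (U z *\<^sub>R \<psi>' z + \<psi> z *\<^sub>R G z))"
        using continuous_on_add[OF c1] by (simp add: f1_def f2_def scaleR_right_distrib)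
      show "indicator D z *\<^sub>R (U z * \<psi> z) = 0" if "z \<notin> K" for z
        using \<psi>0 that by (auto simp: indicator_def)
    qed
    then have "(\<integral>z. f1 z + f2 z \<partial>lebesgue) = 0" by (simp add: f1_def f2_def scaleR_right_distrib)
    then have "(\<integral>z. f1 z \<partial>lebesgue) + (\<integral>z. f2 z \<partial>lebesgue) = 0" using i by simp
    then show ?thesis by (simp add: set_lebesgue_integral_def f1_def f2_def eq_neg_iff_add_eq_0)
  qed
  then have "has_weak_gradient D U G" using loc by (simp add: has_weak_gradient_def)
  then show ?thesis using loc by (simp add: W12_loc_def)
qed

text \<open>A finite sum \<open>T\<close> of bumps is positive on \<open>K\<close>, hence at least
  some \<open>m > 0\<close> there. The C^1 profile \<open>1 - (max 0 (1 - T/m))^2\<close> is 1 where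
  \<open>T \<ge> m\<close> and 0 where \<open>T = 0\<close>. As \<open>\<theta>'\<close> vanishes on
  \<open>K\<close> too, the cutoff leaves no extra term in tested identities.\<close>

lemma C1_cutoff:
  assumes K: "compact K" "K \<subseteq> D" and D: "open D"
  obtains \<theta> :: "complex \<Rightarrow> real" and \<theta>' K' where "\<And>z. (\<theta> has_derivative (\<lambda>h. \<theta>' z \<bullet> h)) (at z)" "continuous_on UNIV \<theta>'"
    "\<And>z. z \<in> K \<Longrightarrow> \<theta> z = (1::real)" "\<And>z. z \<in> K \<Longrightarrow> \<theta>' z = (0::complex)" "compact K'" "K' \<subseteq> D" "\<And>z. z \<notin> K' \<Longrightarrow> \<theta> z = 0"
proof -
  have "\<forall>z\<in>K. \<exists>r>0. cball z r \<subseteq> D" using K(2) D open_contains_cball by blast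
  from bchoice[OF this] obtain \<rho> where "\<forall>z\<in>K. \<rho> z > 0 \<and> cball z (\<rho> z) \<subseteq> D" by (elim exE)
  then have \<rho>: "\<And>z. z \<in> K \<Longrightarrow> \<rho> z > 0" "\<And>z. z \<in> K \<Longrightarrow> cball z (\<rho> z) \<subseteq> D" by simp_all
  have "K \<subseteq> (\<Union>z\<in>K. ball z (\<rho> z))" using \<rho>(1) by force
  then obtain I where I: "I \<subseteq> K" "finite I" "K \<subseteq> (\<Union>z\<in>I. ball z (\<rho> z))"
    by (rule compactE_image[OF K(1) open_ball]) (rule that)
  define T where "T = (\<lambda>z. \<Sum>a\<in>I. bump a (\<rho> a) z)"
  define T' where "T' = (\<lambda>z. \<Sum>a\<in>I. bump_grad a (\<rho> a) z)"
  have dT: "(T has_derivative (\<lambda>h. T' z \<bullet> h)) (at z)" for z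
    unfolding T_def T'_def by (rule has_derivative_eq_rhs[OF has_derivative_sum[OF bump_gradient]]) (simp add: inner_sum_left)
  have cT: "continuous_on UNIV T" "continuous_on UNIV T'"
    unfolding T_def T'_def by (intro continuous_intros continuous_bump)+
  have Tpos: "T z > 0" if "z \<in> K" for z
  proof -
    obtain a where a: "a \<in> I" "z \<in> ball a (\<rho> a)" using I(3) \<open>z \<in> K\<close> by blast
    then have "bump a (\<rho> a) z \<le> T z" unfolding T_def using I(2) by (intro member_le_sum bump_nonneg) auto
    then show ?thesis using bump_pos[OF a(2)] by linarith
  qed
  obtain m where m: "m > 0" "\<And>z. z \<in> K \<Longrightarrow> m \<le> T z"
  proof (cases "K = {}")
    case True
    then show thesis by (intro that[of 1]) auto
  next
    case False
    obtain b where "b \<in> K" "\<And>z. z \<in> K \<Longrightarrow> T b \<le> T z"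
      using continuous_attains_inf[OF K(1) False continuous_on_subset[OF cT(1) subset_UNIV]] by blast
    then show thesis using Tpos by (intro that[of "T b"]) auto
  qed
  define \<theta> where "\<theta> = (\<lambda>z. 1 - (max 0 (1 - T z / m))\<^sup>2)"
  define \<theta>' where "\<theta>' = (\<lambda>z. (2 * max 0 (1 - T z / m) / m) *\<^sub>R T' z)"
  define K' where "K' = (\<Union>a\<in>I. cball a (\<rho> a))"
  show thesis
  proof (rule that[of \<theta> \<theta>' K'])
    fix z
    have "((\<lambda>z. 1 - T z / m) has_derivative (\<lambda>h. 0 - (T' z \<bullet> h) / m)) (at z)"
      using m(1) by (intro has_derivative_diff has_derivative_const has_derivative_divide' [THEN has_derivative_eq_rhs] dT)
        (auto intro!: derivative_eq_intros dT)
    moreover have "((\<lambda>s::real. (max 0 s)\<^sup>2) has_derivative (*) (2 * max 0 (1 - T z / m))) (at (1 - T z / m))"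
      using DERIV_max_square by (simp add: has_field_derivative_def)
    ultimately have "((\<lambda>z. (max 0 (1 - T z / m))\<^sup>2) has_derivative (\<lambda>h. 2 * max 0 (1 - T z / m) * (0 - (T' z \<bullet> h) / m))) (at z)"
      by (rule has_derivative_compose)
    then have "(\<theta> has_derivative (\<lambda>h. 0 - 2 * max 0 (1 - T z / m) * (0 - (T' z \<bullet> h) / m))) (at z)"
      unfolding \<theta>_def by (intro has_derivative_diff has_derivative_const)
    then show "(\<theta> has_derivative (\<lambda>h. \<theta>' z \<bullet> h)) (at z)"
      by (rule has_derivative_eq_rhs) (simp add: \<theta>'_def)
  next
    show "continuous_on UNIV \<theta>'" unfolding \<theta>'_def using m(1) by (intro continuous_intros cT) auto
    show "\<theta> z = 1" "\<theta>' z = 0" if "z \<in> K" for z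
      using m(1) m(2)[OF that] by (simp_all add: \<theta>_def \<theta>'_def)
    show "compact K'" unfolding K'_def using I(2) by (intro compact_UN) auto
    show "K' \<subseteq> D" unfolding K'_def using \<rho>(2) I(1) by auto
    show "\<theta> z = 0" if "z \<notin> K'" for z
    proof -
      have "bump a (\<rho> a) z = 0" if "a \<in> I" for a
      proof (rule bump_outside(1))
        show "z \<notin> ball a (\<rho> a)" using \<open>z \<notin> K'\<close> that by (force simp: K'_def)
        show "\<rho> a > 0" using \<rho>(1) I(1) that by auto
      qed
      then have "T z = 0" by (simp add: T_def)
      then show ?thesis by (simp add: \<theta>_def)
    qed
  qed
qed

lemma integral_Re_plus_Im:
  assumes f: "complex_integrable M f" and g: "complex_integrable M g"
  shows "(\<integral>z. Re (f z) + Im (g z) \<partial>M) = Re (\<integral>z. f z \<partial>M) + Im (\<integral>z. g z \<partial>M)"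
  unfolding Bochner_Integration.integral_add[OF integrable_Re[OF f] integrable_Im[OF g]]
    integral_Re[OF f] integral_Im[OF g] ..

text \<open>The weak gradient of \<open>\<eta>\<close> is tested against \<open>\<theta>\<close> times the components of the gradient of \<open>W\<close>.\<close>

lemma c2_weak_equation:
  assumes D: "open D" and W: "c2_on D W g p" and K: "compact K" "K \<subseteq> D"
    and \<eta>: "has_weak_gradient D \<eta> H" "continuous_on D \<eta>" "\<And>z. z \<in> D \<Longrightarrow> z \<notin> K \<Longrightarrow> \<eta> z = 0"
  shows "(\<integral>z. indicator K z *\<^sub>R (g z \<bullet> H z) \<partial>lebesgue) = - (\<integral>z. indicator K z *\<^sub>R (p z * \<eta> z) \<partial>lebesgue)"
proof -
  obtain gx gy where c2: "continuous_on D gx" "continuous_on D gy"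
    "\<And>z. z \<in> D \<Longrightarrow> (g has_derivative (\<lambda>h. Re h *\<^sub>R gx z + Im h *\<^sub>R gy z)) (at z)"
    "\<And>z. z \<in> D \<Longrightarrow> p z = Re (gx z) + Im (gy z)"
    by (rule c2_onE[OF W]) (rule that)
  obtain \<theta> \<theta>' K' where \<theta>: "\<And>z. (\<theta> has_derivative (\<lambda>h. \<theta>' z \<bullet> h)) (at z)" "continuous_on UNIV \<theta>'"
    "\<And>z. z \<in> K \<Longrightarrow> \<theta> z = (1::real)" "\<And>z. z \<in> K \<Longrightarrow> \<theta>' z = (0::complex)" "compact K'" "K' \<subseteq> D" "\<And>z. z \<notin> K' \<Longrightarrow> \<theta> z = 0"
    by (rule C1_cutoff[OF K D]) (rule that)
  have c\<theta>: "continuous_on S \<theta>" for S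
    by (intro continuous_at_imp_continuous_on ballI has_derivative_continuous[OF \<theta>(1)])
  have Hz: "AE z in lebesgue. z \<in> D \<longrightarrow> z \<notin> K \<longrightarrow> H z = 0"
    by (rule weak_gradient_vanishes[OF D \<eta>(1) compact_imp_closed[OF K(1)] \<eta>(3)])
  have L1: "integrable lebesgue (\<lambda>z. indicator K z *\<^sub>R H z)"
    using \<eta>(1) K unfolding has_weak_gradient_def L1_loc_def set_integrable_def by blast
  have L1': "integrable lebesgue (\<lambda>z. indicator K' z *\<^sub>R H z)"
    using \<eta>(1) \<theta>(5,6) unfolding has_weak_gradient_def L1_loc_def set_integrable_def by blast
  \<comment> \<open>The weak gradient is tested against \<open>\<theta> u\<close>. Off
    \<open>K\<close> both \<eta> and, almost everywhere, \<open>H\<close> vanish, and on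
    \<open>K\<close> the cutoff is 1 with zero gradient; so no trace of \<theta> remains.\<close>
  have comp: "(\<integral>z. indicator K z *\<^sub>R (\<eta> z *\<^sub>R d z) \<partial>lebesgue) = - (\<integral>z. indicator K z *\<^sub>R (u z *\<^sub>R H z) \<partial>lebesgue)"
    "integrable lebesgue (\<lambda>z. indicator K z *\<^sub>R (\<eta> z *\<^sub>R d z))"
    "integrable lebesgue (\<lambda>z. indicator K z *\<^sub>R (u z *\<^sub>R H z))"
    if u0: "\<forall>z\<in>D. (u has_derivative (\<lambda>h. d z \<bullet> h)) (at z)" and cd: "continuous_on D d" for u d
  proof -
    note u = bspec[OF u0]
    have cu: "continuous_on D u"
      by (intro continuous_at_imp_continuous_on ballI has_derivative_continuous[OF u])
    define \<psi>' where "\<psi>' = (\<lambda>z. \<theta> z *\<^sub>R d z + u z *\<^sub>R \<theta>' z)"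
    have "(\<integral>z. indicator D z *\<^sub>R (\<eta> z *\<^sub>R \<psi>' z) \<partial>lebesgue) = - (\<integral>z. indicator D z *\<^sub>R ((\<theta> z * u z) *\<^sub>R H z) \<partial>lebesgue)"
    proof (rule weak_gradientD[OF \<eta>(1) _ _ \<theta>(5,6)])
      show "((\<lambda>z. \<theta> z * u z) has_derivative (\<lambda>h. \<psi>' z \<bullet> h)) (at z)" if "z \<in> D" for z
        by (rule has_derivative_eq_rhs[OF has_derivative_mult[OF \<theta>(1) u[OF that]]]) (auto simp: \<psi>'_def inner_simps)
      show "continuous_on D \<psi>'"
        unfolding \<psi>'_def by (intro continuous_intros c\<theta> cd cu continuous_on_subset[OF \<theta>(2)]) auto
      show "\<theta> z * u z = 0" if "z \<notin> K'" for z using \<theta>(7)[OF that] by simp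
    qed
    moreover have "indicator D z *\<^sub>R (\<eta> z *\<^sub>R \<psi>' z) = indicator K z *\<^sub>R (\<eta> z *\<^sub>R d z)" for z
      using \<theta>(3,4)[of z] \<eta>(3)[of z] K(2) by (auto simp: indicator_def \<psi>'_def)
    moreover have "(\<integral>z. indicator D z *\<^sub>R ((\<theta> z * u z) *\<^sub>R H z) \<partial>lebesgue) = (\<integral>z. indicator K z *\<^sub>R (u z *\<^sub>R H z) \<partial>lebesgue)"
      and iu: "integrable lebesgue (\<lambda>z. indicator K z *\<^sub>R (u z *\<^sub>R H z))"
    proof -
      have c1: "continuous_on UNIV (\<lambda>z. indicator D z *\<^sub>R (\<theta> z * u z))"
        by (rule extension_by_zero_continuous[OF D compact_imp_closed[OF \<theta>(5)] \<theta>(6)])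
          (use \<theta>(7) in \<open>auto intro!: continuous_intros c\<theta> cu\<close>)
      have m: "(\<lambda>z. indicator D z *\<^sub>R (\<theta> z * u z)) \<in> borel_measurable lebesgue"
        by (rule continuous_lebesgue_measurable[OF c1])
      have "bounded ((\<lambda>z. indicator D z *\<^sub>R (\<theta> z * u z)) ` K')"
        by (intro compact_imp_bounded compact_continuous_image continuous_on_subset[OF c1] \<theta>(5)) auto
      then obtain C where C: "\<forall>x\<in>(\<lambda>z. indicator D z *\<^sub>R (\<theta> z * u z)) ` K'. norm x \<le> C" unfolding bounded_iff by (elim exE)
      then have C': "\<bar>indicator D z *\<^sub>R (\<theta> z * u z)\<bar> \<le> C" if "z \<in> K'" for z using that by simp
      have "norm ((indicator D z *\<^sub>R (\<theta> z * u z)) *\<^sub>R (indicator K' z *\<^sub>R H z)) \<le> C * norm (indicator K' z *\<^sub>R H z)" for z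
        using C'[of z] by (cases "z \<in> K'") (auto intro: mult_right_mono)
      from integrable_scaleR_bounded[OF L1' m this]
      have i1: "integrable lebesgue (\<lambda>z. (indicator D z *\<^sub>R (\<theta> z * u z)) *\<^sub>R (indicator K' z *\<^sub>R H z))" .
      have e1: "(indicator D z *\<^sub>R (\<theta> z * u z)) *\<^sub>R (indicator K' z *\<^sub>R H z) = indicator D z *\<^sub>R ((\<theta> z * u z) *\<^sub>R H z)" for z
        using \<theta>(7)[of z] by (auto simp: indicator_def)
      have i2: "integrable lebesgue (\<lambda>z. indicator D z *\<^sub>R ((\<theta> z * u z) *\<^sub>R H z))" using i1 unfolding e1 .
      have "K \<in> sets lebesgue" using K(1) by (simp add: compact_imp_closed)
      from integrable_mult_indicator[OF this i2]
      have i3: "integrable lebesgue (\<lambda>z. indicator K z *\<^sub>R (indicator D z *\<^sub>R ((\<theta> z * u z) *\<^sub>R H z)))" .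
      have e2: "indicator K z *\<^sub>R (indicator D z *\<^sub>R ((\<theta> z * u z) *\<^sub>R H z)) = indicator K z *\<^sub>R (u z *\<^sub>R H z)" for z
        using \<theta>(3)[of z] K(2) by (auto simp: indicator_def)
      show i4: "integrable lebesgue (\<lambda>z. indicator K z *\<^sub>R (u z *\<^sub>R H z))" using i3 unfolding e2 .
      show "(\<integral>z. indicator D z *\<^sub>R ((\<theta> z * u z) *\<^sub>R H z) \<partial>lebesgue) = (\<integral>z. indicator K z *\<^sub>R (u z *\<^sub>R H z) \<partial>lebesgue)"
      proof (rule integral_cong_AE)
        show "AE z in lebesgue. indicator D z *\<^sub>R ((\<theta> z * u z) *\<^sub>R H z) = indicator K z *\<^sub>R (u z *\<^sub>R H z)"
          using Hz by eventually_elim (use \<theta>(3) K(2) in \<open>auto simp: indicator_def\<close>)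
      qed (use i2 i4 in auto)
    qed
    ultimately show "(\<integral>z. indicator K z *\<^sub>R (\<eta> z *\<^sub>R d z) \<partial>lebesgue) = - (\<integral>z. indicator K z *\<^sub>R (u z *\<^sub>R H z) \<partial>lebesgue)" by simp
    show "integrable lebesgue (\<lambda>z. indicator K z *\<^sub>R (u z *\<^sub>R H z))" by (rule iu)
    have "continuous_on K (\<lambda>z. \<eta> z *\<^sub>R d z)"
      by (intro continuous_intros continuous_on_subset[OF \<eta>(2) K(2)] continuous_on_subset[OF cd K(2)])
    from continuous_set_integrable[OF K(1) this]
    show "integrable lebesgue (\<lambda>z. indicator K z *\<^sub>R (\<eta> z *\<^sub>R d z))" by (simp add: set_integrable_def)
  qed
  \<comment> \<open>The gradients of the two components of \<open>g\<close>, that is, the rows of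
    the Hessian whose columns are \<open>gx\<close> and \<open>gy\<close>.\<close>
  define d1 where "d1 = (\<lambda>z. Complex (Re (gx z)) (Re (gy z)))"
  define d2 where "d2 = (\<lambda>z. Complex (Im (gx z)) (Im (gy z)))"
  have du: "((\<lambda>z. Re (g z)) has_derivative (\<lambda>h. d1 z \<bullet> h)) (at z)" "((\<lambda>z. Im (g z)) has_derivative (\<lambda>h. d2 z \<bullet> h)) (at z)" if "z \<in> D" for z
    by (rule has_derivative_eq_rhs[OF has_derivative_Re[OF c2(3)[OF that]]], simp add: d1_def inner_complex_def mult.commute)
      (rule has_derivative_eq_rhs[OF has_derivative_Im[OF c2(3)[OF that]]], simp add: d2_def inner_complex_def mult.commute)
  have cdu: "continuous_on D d1" "continuous_on D d2"
    unfolding d1_def d2_def Complex_eq by (intro continuous_intros c2)+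
  have du': "\<forall>z\<in>D. ((\<lambda>z. Re (g z)) has_derivative (\<lambda>h. d1 z \<bullet> h)) (at z)"
    "\<forall>z\<in>D. ((\<lambda>z. Im (g z)) has_derivative (\<lambda>h. d2 z \<bullet> h)) (at z)"
    using du by simp_all
  note A = comp[OF du'(1) cdu(1)] and B = comp[OF du'(2) cdu(2)]
  \<comment> \<open>\<open>g \<bullet> H\<close> is the real part of \<open>Re g * H\<close> plus
    the imaginary part of \<open>Im g * H\<close>, so the identity for each component is read in
    that part; on the other side this selects the diagonal of the Hessian.\<close>
  have "(\<integral>z. indicator K z *\<^sub>R (g z \<bullet> H z) \<partial>lebesgue)
     = (\<integral>z. Re (indicator K z *\<^sub>R (Re (g z) *\<^sub>R H z)) + Im (indicator K z *\<^sub>R (Im (g z) *\<^sub>R H z)) \<partial>lebesgue)"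
    by (rule Bochner_Integration.integral_cong) (auto simp: inner_complex_def algebra_simps)
  also have "\<dots> = Re (\<integral>z. indicator K z *\<^sub>R (Re (g z) *\<^sub>R H z) \<partial>lebesgue) + Im (\<integral>z. indicator K z *\<^sub>R (Im (g z) *\<^sub>R H z) \<partial>lebesgue)"
    by (rule integral_Re_plus_Im[OF A(3) B(3)])
  also have "\<dots> = - (Re (\<integral>z. indicator K z *\<^sub>R (\<eta> z *\<^sub>R d1 z) \<partial>lebesgue) + Im (\<integral>z. indicator K z *\<^sub>R (\<eta> z *\<^sub>R d2 z) \<partial>lebesgue))"
    using arg_cong[OF A(1), of Re] arg_cong[OF B(1), of Im] by simp
  also have "\<dots> = - (\<integral>z. Re (indicator K z *\<^sub>R (\<eta> z *\<^sub>R d1 z)) + Im (indicator K z *\<^sub>R (\<eta> z *\<^sub>R d2 z)) \<partial>lebesgue)"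
    unfolding integral_Re_plus_Im[OF A(2) B(2)] ..
  also have "(\<integral>z. Re (indicator K z *\<^sub>R (\<eta> z *\<^sub>R d1 z)) + Im (indicator K z *\<^sub>R (\<eta> z *\<^sub>R d2 z)) \<partial>lebesgue) = (\<integral>z. indicator K z *\<^sub>R (p z * \<eta> z) \<partial>lebesgue)"
    by (rule Bochner_Integration.integral_cong)
      (use c2(4) K(2) in \<open>auto simp: d1_def d2_def indicator_def algebra_simps\<close>)
  finally show ?thesis .
qed

text \<open>The equation holds for the C^2 approximants. On the compact \<open>K\<close> carrying
  \<eta> their gradients and Laplacians converge uniformly, which is enough against integrable
  \<open>H\<close> and \<eta>.\<close>

lemma poisson_weak_solution:
  assumes D: "open D" and U: "poisson D U (\<lambda>z. f (U z))" and cU: "continuous_on D U" and cf: "continuous_on UNIV f"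
  shows "weak_poisson_solution D f U"
proof -
  obtain W g p G where
    W: "\<And>n. c2_on D (W n) (g n) (p n)"
    and pf: "\<And>n z. z \<in> D \<Longrightarrow> \<bar>p n z - f (U z)\<bar> \<le> inverse (real (Suc n))"
    and gG: "\<And>n a r. r > 0 \<Longrightarrow> ball a r \<subseteq> D \<Longrightarrow> norm (g n a - G a) \<le> (4 / r + r / 4) * inverse (real (Suc n))"
    and dU: "\<And>z. z \<in> D \<Longrightarrow> (U has_derivative (\<lambda>h. G z \<bullet> h)) (at z)" and cG: "continuous_on D G"
    by (rule poisson_approximation[OF D U]) (rule that)
  have \<rho>lim: "(\<lambda>n. inverse (real (Suc n))) \<longlonglongrightarrow> 0" by (rule LIMSEQ_inverse_real_of_nat)
  have "set_lebesgue_integral lebesgue D (\<lambda>z. G z \<bullet> H z) + set_lebesgue_integral lebesgue D (\<lambda>z. f (U z) * \<eta> z) = 0"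
    if \<eta>: "continuous_on D \<eta>" "W12 D \<eta> H" "compactly_supported_in D \<eta>" for \<eta> H
  proof -
    define K where "K = closure {z \<in> D. \<eta> z \<noteq> 0}"
    have K: "compact K" "K \<subseteq> D" "closed K" using \<eta>(3) by (auto simp: compactly_supported_in_def K_def)
    have \<eta>0: "\<eta> z = 0" if "z \<in> D" "z \<notin> K" for z
      using that closure_subset[of "{z \<in> D. \<eta> z \<noteq> 0}"] unfolding K_def by blast
    have w: "has_weak_gradient D \<eta> H" using \<eta>(2) by (simp add: W12_def)
    have eq: "(\<integral>z. indicator K z *\<^sub>R (g n z \<bullet> H z) \<partial>lebesgue) = - (\<integral>z. indicator K z *\<^sub>R (p n z * \<eta> z) \<partial>lebesgue)" for n
      by (rule c2_weak_equation[OF D W K(1,2) w \<eta>(1) \<eta>0])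
    have L1: "integrable lebesgue (\<lambda>z. indicator K z *\<^sub>R H z)"
      using w K unfolding has_weak_gradient_def L1_loc_def set_integrable_def by blast
    have iK: "integrable lebesgue (\<lambda>z. indicator K z *\<^sub>R (u z \<bullet> H z))" if "continuous_on D u" for u
    proof -
      have cu: "continuous_on K u" by (rule continuous_on_subset[OF that K(2)])
      have "bounded (u ` K)" by (intro compact_imp_bounded compact_continuous_image cu K(1))
      then obtain C where C: "C > 0" "\<And>z. z \<in> K \<Longrightarrow> norm (u z) \<le> C" unfolding bounded_pos by auto
      have mu: "(\<lambda>z. indicator K z *\<^sub>R u z) \<in> borel_measurable lebesgue"
        using continuous_set_integrable[OF K(1) cu] by (simp add: set_integrable_def)
      have e: "(indicator K z *\<^sub>R u z) \<bullet> (indicator K z *\<^sub>R H z) = indicator K z *\<^sub>R (u z \<bullet> H z)" for z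
        by (auto simp: indicator_def)
      have "integrable lebesgue (\<lambda>z. (indicator K z *\<^sub>R u z) \<bullet> (indicator K z *\<^sub>R H z))"
      proof (rule Bochner_Integration.integrable_bound[where f="\<lambda>z. C * norm (indicator K z *\<^sub>R H z)"])
        show "integrable lebesgue (\<lambda>z. C * norm (indicator K z *\<^sub>R H z))" using L1 by (intro integrable_mult_right integrable_norm)
        show "(\<lambda>z. (indicator K z *\<^sub>R u z) \<bullet> (indicator K z *\<^sub>R H z)) \<in> borel_measurable lebesgue"
          using mu L1 by (intro borel_measurable_inner) auto
        show "AE z in lebesgue. norm ((indicator K z *\<^sub>R u z) \<bullet> (indicator K z *\<^sub>R H z)) \<le> norm (C * norm (indicator K z *\<^sub>R H z))"
        proof (rule AE_I2)
          fix z
          show "norm ((indicator K z *\<^sub>R u z) \<bullet> (indicator K z *\<^sub>R H z)) \<le> norm (C * norm (indicator K z *\<^sub>R H z))"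
          proof (cases "z \<in> K")
            case True
            have "\<bar>u z \<bullet> H z\<bar> \<le> norm (u z) * norm (H z)" by (rule Cauchy_Schwarz_ineq2)
            also have "\<dots> \<le> C * norm (H z)" using C(2)[OF True] by (intro mult_right_mono) auto
            finally show ?thesis using True C(1) by (simp add: abs_mult)
          qed simp
        qed
      qed
      then show ?thesis unfolding e .
    qed
    have i\<eta>: "integrable lebesgue (\<lambda>z. indicator K z *\<^sub>R (u z * \<eta> z))" if "continuous_on D u" for u
      using continuous_set_integrable[OF K(1), of "\<lambda>z. u z * \<eta> z"] continuous_on_subset[OF that K(2)] continuous_on_subset[OF \<eta>(1) K(2)]
      by (simp add: set_integrable_def continuous_on_mult)
    have cfU: "continuous_on D (\<lambda>z. f (U z))" by (rule continuous_on_compose2[OF cf cU]) auto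
    obtain r where r: "r > 0" "\<And>x. x \<in> K \<Longrightarrow> ball x r \<subseteq> D"
      using compact_subset_open_imp_ball_epsilon_subset[OF K(1) D K(2)] by (metis UN_subset_iff)
    \<comment> \<open>Discs of one radius \<open>r\<close> fit around all points of
      \<open>K\<close>, so the gradients converge on \<open>K\<close> at the single rate
      \<open>c / (n + 1)\<close>.\<close>
    define c where "c = 4 / r + r / 4"
    have lim1: "(\<lambda>n. \<integral>z. indicator K z *\<^sub>R (g n z \<bullet> H z) \<partial>lebesgue) \<longlonglongrightarrow> (\<integral>z. indicator K z *\<^sub>R (G z \<bullet> H z) \<partial>lebesgue)"
    proof (rule LIM_zero_cancel, rule Lim_null_comparison)
      show "(\<lambda>n. inverse (real (Suc n)) * (c * (\<integral>z. norm (indicator K z *\<^sub>R H z) \<partial>lebesgue))) \<longlonglongrightarrow> 0"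
        using tendsto_mult_left_zero[OF \<rho>lim] by blast
      have "norm ((\<integral>z. indicator K z *\<^sub>R (g n z \<bullet> H z) \<partial>lebesgue) - (\<integral>z. indicator K z *\<^sub>R (G z \<bullet> H z) \<partial>lebesgue))
        \<le> inverse (real (Suc n)) * (c * (\<integral>z. norm (indicator K z *\<^sub>R H z) \<partial>lebesgue))" for n
      proof -
        have cgn: "continuous_on D (g n)" by (rule c2_on_continuous(2)[OF W])
        have "norm (\<integral>z. indicator K z *\<^sub>R (g n z \<bullet> H z) - indicator K z *\<^sub>R (G z \<bullet> H z) \<partial>lebesgue)
          \<le> (\<integral>z. (c * inverse (real (Suc n))) * norm (indicator K z *\<^sub>R H z) \<partial>lebesgue)"
        proof (rule Bochner_Integration.integral_norm_bound_integral)
          show "integrable lebesgue (\<lambda>z. indicator K z *\<^sub>R (g n z \<bullet> H z) - indicator K z *\<^sub>R (G z \<bullet> H z))"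
            by (intro Bochner_Integration.integrable_diff iK cgn cG)
          show "integrable lebesgue (\<lambda>z. (c * inverse (real (Suc n))) * norm (indicator K z *\<^sub>R H z))"
            using L1 by (intro integrable_mult_right integrable_norm)
          fix z
          show "norm (indicator K z *\<^sub>R (g n z \<bullet> H z) - indicator K z *\<^sub>R (G z \<bullet> H z)) \<le> (c * inverse (real (Suc n))) * norm (indicator K z *\<^sub>R H z)"
          proof (cases "z \<in> K")
            case True
            have "\<bar>(g n z - G z) \<bullet> H z\<bar> \<le> norm (g n z - G z) * norm (H z)" by (rule Cauchy_Schwarz_ineq2)
            also have "\<dots> \<le> (c * inverse (real (Suc n))) * norm (H z)"
              using gG[OF r(1) r(2)[OF True], of n] unfolding c_def by (intro mult_right_mono) auto
            finally show ?thesis using True by (simp add: inner_diff_left)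
          qed simp
        qed
        then show ?thesis
          unfolding Bochner_Integration.integral_diff[OF iK[OF cgn] iK[OF cG]] integral_mult_right_zero
          by (simp only: mult_ac)
      qed
      then show "\<forall>\<^sub>F n in sequentially. norm ((\<integral>z. indicator K z *\<^sub>R (g n z \<bullet> H z) \<partial>lebesgue) - (\<integral>z. indicator K z *\<^sub>R (G z \<bullet> H z) \<partial>lebesgue))
        \<le> inverse (real (Suc n)) * (c * (\<integral>z. norm (indicator K z *\<^sub>R H z) \<partial>lebesgue))" by simp
    qed
    have lim2: "(\<lambda>n. \<integral>z. indicator K z *\<^sub>R (p n z * \<eta> z) \<partial>lebesgue) \<longlonglongrightarrow> (\<integral>z. indicator K z *\<^sub>R (f (U z) * \<eta> z) \<partial>lebesgue)"
    proof (rule LIM_zero_cancel, rule Lim_null_comparison)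
      have i1: "integrable lebesgue (\<lambda>z. indicator K z *\<^sub>R (1 * \<eta> z))" by (rule i\<eta>) simp
      then have i1: "integrable lebesgue (\<lambda>z. indicator K z *\<^sub>R \<eta> z)" by simp
      show "(\<lambda>n. inverse (real (Suc n)) * (\<integral>z. norm (indicator K z *\<^sub>R \<eta> z) \<partial>lebesgue)) \<longlonglongrightarrow> 0"
        using tendsto_mult_left_zero[OF \<rho>lim] by blast
      have "norm ((\<integral>z. indicator K z *\<^sub>R (p n z * \<eta> z) \<partial>lebesgue) - (\<integral>z. indicator K z *\<^sub>R (f (U z) * \<eta> z) \<partial>lebesgue))
        \<le> inverse (real (Suc n)) * (\<integral>z. norm (indicator K z *\<^sub>R \<eta> z) \<partial>lebesgue)" for n
      proof -
        have cpn: "continuous_on D (p n)" by (rule c2_on_continuous(3)[OF W])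
        have "norm (\<integral>z. indicator K z *\<^sub>R (p n z * \<eta> z) - indicator K z *\<^sub>R (f (U z) * \<eta> z) \<partial>lebesgue)
          \<le> (\<integral>z. inverse (real (Suc n)) * norm (indicator K z *\<^sub>R \<eta> z) \<partial>lebesgue)"
        proof (rule Bochner_Integration.integral_norm_bound_integral)
          show "integrable lebesgue (\<lambda>z. indicator K z *\<^sub>R (p n z * \<eta> z) - indicator K z *\<^sub>R (f (U z) * \<eta> z))"
            by (intro Bochner_Integration.integrable_diff i\<eta> cpn cfU)
          show "integrable lebesgue (\<lambda>z. inverse (real (Suc n)) * norm (indicator K z *\<^sub>R \<eta> z))"
            using i1 by (intro integrable_mult_right integrable_norm)
          fix z
          show "norm (indicator K z *\<^sub>R (p n z * \<eta> z) - indicator K z *\<^sub>R (f (U z) * \<eta> z)) \<le> inverse (real (Suc n)) * norm (indicator K z *\<^sub>R \<eta> z)"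
          proof (cases "z \<in> K")
            case True
            then have "z \<in> D" using K(2) by auto
            have "\<bar>(p n z - f (U z)) * \<eta> z\<bar> \<le> inverse (real (Suc n)) * \<bar>\<eta> z\<bar>"
              unfolding abs_mult by (intro mult_right_mono pf[OF \<open>z \<in> D\<close>]) simp
            then show ?thesis using True by (simp add: left_diff_distrib)
          qed simp
        qed
        then show ?thesis
          using Bochner_Integration.integral_diff[OF i\<eta>[OF cpn] i\<eta>[OF cfU]] by simp
      qed
      then show "\<forall>\<^sub>F n in sequentially. norm ((\<integral>z. indicator K z *\<^sub>R (p n z * \<eta> z) \<partial>lebesgue) - (\<integral>z. indicator K z *\<^sub>R (f (U z) * \<eta> z) \<partial>lebesgue))
        \<le> inverse (real (Suc n)) * (\<integral>z. norm (indicator K z *\<^sub>R \<eta> z) \<partial>lebesgue)" by simp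
    qed
    have main: "(\<integral>z. indicator K z *\<^sub>R (G z \<bullet> H z) \<partial>lebesgue) = - (\<integral>z. indicator K z *\<^sub>R (f (U z) * \<eta> z) \<partial>lebesgue)"
      using LIMSEQ_unique[OF lim1[unfolded eq] tendsto_minus[OF lim2]] .
    have e2: "indicator D z *\<^sub>R (f (U z) * \<eta> z) = indicator K z *\<^sub>R (f (U z) * \<eta> z)" for z
      using \<eta>0[of z] K(2) by (auto simp: indicator_def)
    define X where "X = (\<lambda>z. indicator D z *\<^sub>R (G z \<bullet> H z))"
    have "AE z in lebesgue. z \<in> D \<longrightarrow> z \<notin> K \<longrightarrow> H z = 0"
      by (rule weak_gradient_vanishes[OF D w K(3) \<eta>0])
    then have ae: "AE z in lebesgue. indicator K z *\<^sub>R (G z \<bullet> H z) = X z"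
      by eventually_elim (use K(2) in \<open>auto simp: X_def indicator_def\<close>)
    \<comment> \<open>Passing from equality almost everywhere to equality of integrals uses
      measurability on all of \<open>D\<close>; for \<open>H\<close> it is contained in
      \<open>L2_on D H\<close>.\<close>
    have "X \<in> borel_measurable lebesgue"
    proof -
      have "(\<lambda>z. indicator D z *\<^sub>R G z) \<in> borel_measurable lebesgue"
        using D by (intro measurable_completion) (simp add: borel_measurable_continuous_on_indicator cG)
      moreover have "(\<lambda>z. indicator D z *\<^sub>R H z) \<in> borel_measurable lebesgue"
        using \<eta>(2) by (simp add: W12_def L2_on_def set_borel_measurable_def)
      ultimately have "(\<lambda>z. (indicator D z *\<^sub>R G z) \<bullet> (indicator D z *\<^sub>R H z)) \<in> borel_measurable lebesgue"
        by (rule borel_measurable_inner)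
      moreover have "(\<lambda>z. (indicator D z *\<^sub>R G z) \<bullet> (indicator D z *\<^sub>R H z)) = X"
        by (auto simp: X_def indicator_def)
      ultimately show ?thesis by simp
    qed
    then have "(\<integral>z. X z \<partial>lebesgue) = (\<integral>z. indicator K z *\<^sub>R (G z \<bullet> H z) \<partial>lebesgue)"
      using iK[OF cG] ae by (intro integral_cong_AE) (auto elim: eventually_mono)
    then show ?thesis using main unfolding set_lebesgue_integral_def e2 X_def by simp
  qed
  then show ?thesis using C1_W12_loc[OF D dU cG] cU unfolding weak_poisson_solution_def by blast
qed

theorem corollary8:
  fixes D :: "complex set" and \<phi> :: "complex \<Rightarrow> real" and \<delta> :: real
  assumes "smooth_jordan_domain D"
    and "continuous_on (frontier D) \<phi>"
    and "\<delta> > 0"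
  shows "\<exists>U :: complex \<Rightarrow> real.
           weak_poisson_solution D (\<lambda>u. \<delta> * exp u) U \<and>
           continuous_on (closure D) U \<and>
           (\<forall>z\<in>frontier D. U z = \<phi> z) \<and>
           (\<forall>\<alpha>\<in>{0<..<1}. C1_holder_loc \<alpha> D U) \<and>
           (\<forall>\<beta>\<in>{0<..<1}. holder_on \<beta> (frontier D) \<phi> \<longrightarrow> holder_on \<beta> (closure D) U)"
proof -
  have D: "open D" "bounded D" "D \<noteq> {}"
    using assms(1) by (auto simp: smooth_jordan_domain_def jordan_domain_def)
  have cone: "\<exists>\<tau> r. 0 < \<tau> \<and> \<tau> < pi / 2 \<and> r > 0 \<and> ext_cone D (sin \<tau>) r \<and> \<beta> * (pi / 2 + \<tau>) < pi / 2"
    if \<beta>: "0 < \<beta>" "\<beta> < 1" for \<beta>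
  proof -
    \<comment> \<open>Half of \<open>(pi/2) (1 - \<beta>)\<close>: then
      \<open>\<beta> \<tau> \<le> \<tau> < (pi/2) (1 - \<beta>)\<close>, which leaves
      \<open>\<beta> (pi/2 + \<tau>)\<close> below \<open>pi/2\<close>.\<close>
    define \<tau> where "\<tau> = pi / 2 * ((1 - \<beta>) / 2)"
    have "\<tau> < pi / 2 * 1" unfolding \<tau>_def using \<beta> by (intro mult_strict_left_mono) auto
    then have \<tau>: "0 < \<tau>" "\<tau> < pi / 2" using \<beta> by (simp_all add: \<tau>_def)
    have "\<beta> * \<tau> \<le> 1 * \<tau>" using \<beta> \<tau> by (intro mult_right_mono) auto
    also have "1 * \<tau> < pi / 2 * (1 - \<beta>)" using \<beta> by (simp add: \<tau>_def)
    finally have "\<beta> * (pi / 2 + \<tau>) < pi / 2" by (simp add: algebra_simps)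
    moreover have "sin \<tau> > 0" using \<tau> by (intro sin_gt_zero) auto
    then obtain r where "r > 0" "ext_cone D (sin \<tau>) r"
      using smooth_jordan_domain_ext_cone[OF assms(1)] by blast
    ultimately show ?thesis using \<tau> by blast
  qed
  \<comment> \<open>For existence and continuity up to the boundary any exponent in (0, 1) will do,
    here 1/2. The Hoelder part takes a new cone adapted to the given \<beta>, for the same
    \<open>U\<close>.\<close>
  obtain \<tau> r where c: "0 < \<tau>" "\<tau> < pi / 2" "r > 0" "ext_cone D (sin \<tau>) r" "(1/2) * (pi / 2 + \<tau>) < pi / 2"
    using cone[of "1/2"] by auto
  have "\<exists>U. continuous_on (closure D) U \<and> (\<forall>z\<in>frontier D. U z = \<phi> z) \<and> poisson D U (\<lambda>z. \<delta> * exp (U z))"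
    by (rule exponential_dirichlet[OF D(1,2) c(4,3,1,2) _ _ c(5) assms(2,3)]) auto
  then obtain U where U: "continuous_on (closure D) U" "\<forall>z\<in>frontier D. U z = \<phi> z" "poisson D U (\<lambda>z. \<delta> * exp (U z))"
    by (elim exE conjE)
  have cU: "continuous_on D U" by (rule continuous_on_subset[OF U(1) closure_subset])
  have "compact (closure D)" using D(2) by simp
  then have "bounded ((\<lambda>z. \<delta> * exp (U z)) ` closure D)"
    by (intro compact_imp_bounded compact_continuous_image continuous_intros U(1))
  then obtain B where "\<forall>x\<in>(\<lambda>z. \<delta> * exp (U z)) ` closure D. norm x \<le> B" unfolding bounded_iff by (elim exE)
  then have B: "\<bar>\<delta> * exp (U z)\<bar> \<le> B" if "z \<in> D" for z
    using subsetD[OF closure_subset that] by simp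
  have "weak_poisson_solution D (\<lambda>u. \<delta> * exp u) U"
    by (rule poisson_weak_solution[OF D(1) U(3) cU]) (intro continuous_intros)
  moreover have "C1_holder_loc \<alpha> D U" if "\<alpha> \<in> {0<..<1}" for \<alpha>
    using exponential_C1_holder[OF D(1,2) U(1,3) assms(3)] that by simp
  moreover have "holder_on \<beta> (closure D) U" if \<beta>: "\<beta> \<in> {0<..<1}" and h: "holder_on \<beta> (frontier D) \<phi>" for \<beta>
  proof -
    have b: "0 < \<beta>" "\<beta> < 1" using \<beta> by auto
    obtain \<tau> r where c: "0 < \<tau>" "\<tau> < pi / 2" "r > 0" "ext_cone D (sin \<tau>) r" "\<beta> * (pi / 2 + \<tau>) < pi / 2"
      using cone[OF b] by (elim exE conjE)
    have hU: "holder_on \<beta> (frontier D) U" using h U(2) by (simp add: holder_on_def)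
    obtain M where M: "M \<ge> 0" "\<forall>z0\<in>frontier D. \<forall>z\<in>closure D. \<bar>U z - U z0\<bar> \<le> M * norm (z - z0) powr \<beta>"
      using boundary_growth[OF D(1,2) c(4,3,1,2) b c(5) U(1,3) B hU] by blast
    show ?thesis
      by (rule holder_closure[OF D b U(3) B M(1)]) (use M(2) in auto)
  qed
  ultimately show ?thesis using U(1,2) by blast
qed

end
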